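(* Let $\mathcal{P}$ be a binary quadratic nonsymmetric operad. There is an isomorphism of nonsymmetric operads $$\mathrm{TSu}(\mathcal{P})\;\cong\;\mathit{TriDend}\ \blacksquare\ \mathcal{P},$$ where $\mathrm{TSu}(\mathcal P)$ is the trisuccessor of $\mathcal P$ and $\blacksquare$ is the black square product.
   Context: Fix a field $\mathbf{k}$. For a vector space $V$ in arity 2, $\mathcal{T}_{ns}(V)$ is the free nonsymmetric (ns) operad on $V$: in arity $n$, it is spanned by planar binary rooted trees with $n$ leaves (numbered $1,\dots,n$ from left to right) with vertices labeled by elements of $V$, multilinearly. A binary quadratic ns operad is $\mathcal{P}=\mathcal{T}_{ns}(V)/(R)$ with $R$ a subspace of $\mathcal{T}_{ns}(V)_3=(V\circ_1V)\oplus(V\circ_2V)$, where $\omega\circ_1\nu=\omega(\nu(x,y),z)$ and $\omega\circ_2\nu=\omega(x,\nu(y,z))$. **Trisuccessor.** $\widehat V=V\otimes(\mathbf{k}\prec\oplus\,\mathbf{k}\succ\oplus\,\mathbf k\,\cdot\,)$, $\omega_\prec=\omega\otimes\prec$, $\omega_\succ=\omega\otimes\succ$, $\omega_\cdot=\omega\otimes\cdot$, $\omega_\star=\omega_\prec+\omega_\succ+\omega_\cdot$. For a labeled tree $\tau$ and a nonempty set $J$ of leaves, $\mathrm{TSu}_J(\tau)$ is obtained by relabeling: a vertex labeled $\omega$ lying on at least one of the paths from the root to the leaves in $J$ gets $\omega_\prec$ if all such paths through it turn left there, $\omega_\succ$ if all turn right, $\omega_\cdot$ if some turn left and some turn right;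 every other vertex labeled $\omega$ gets $\omega_\star$. Extend linearly. $\mathrm{TSu}(\mathcal{P})=\mathcal{T}_{ns}(\widehat V)/(\mathrm{TSu}_J(r):r\in R,\ \emptyset\ne J\subseteq\{1,2,3\})$. **TriDend.** $\mathit{TriDend}$ is the ns operad of tridendriform algebras (Loday-Ronco): operations $\prec,\succ,\cdot$ and, with $\star=\prec+\succ+\cdot$, relations $(x\prec y)\prec z=x\prec(y\star z)$, $(x\succ y)\prec z=x\succ(y\prec z)$, $(x\star y)\succ z=x\succ(y\succ z)$, $(x\succ y)\cdot z=x\succ(y\cdot z)$, $(x\prec y)\cdot z=x\cdot(y\succ z)$, $(x\cdot y)\prec z=x\cdot(y\prec z)$, $(x\cdot y)\cdot z=x\cdot(y\cdot z)$. **Black square product.** For binary quadratic ns operads, $\mathcal{T}_{ns}(V)/(R)\ \blacksquare\ \mathcal{T}_{ns}(W)/(S)=\mathcal{T}_{ns}(V\otimes W)/(\Psi(R\otimes S))$ with $\Psi((\omega\circ_1\nu)\otimes(\omega'\circ_1\nu'))=(\omega\otimes\omega')\circ_1(\nu\otimes\nu')$, $\Psi((\omega\circ_2\nu)\otimes(\omega'\circ_2\nu'))=-(\omega\otimes\omega')\circ_2(\nu\otimes\nu')$, and $\Psi((\omega\circ_a\nu)\otimes(\omega'\circ_b\nu'))=0$ for $a\neq b$. *)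

theory Defs
  imports "HOL-Algebra.Module" "HOL-Algebra.AbelCoset" "HOL-Library.Tree"
begin

section \<open>Linear algebra over a ring of scalars\<close>

text \<open>
  Vector spaces are HOL-Algebra modules over a field. The ring multiplication slots
  \<open>mult\<close> and \<open>one\<close> of the module record play no role and are left undefined.
\<close>

definition gen_submodule ::
  "('k, 'r) ring_scheme \<Rightarrow> ('k, 'a, 'm) module_scheme \<Rightarrow> 'a set \<Rightarrow> 'a set" where
  "gen_submodule K M S = \<Inter>{N. submodule N K M \<and> S \<subseteq> N}"

definition free_mod :: "('k, 'r) ring_scheme \<Rightarrow> 'x set \<Rightarrow> ('k, 'x \<Rightarrow> 'k) module" where
  "free_mod K X =
    \<lparr> carrier = {f. (\<forall>x. f x \<in> carrier K) \<and> (\<forall>x. x \<notin> X \<longrightarrow> f x = \<zero>\<^bsub>K\<^esub>) \<and> finite {x. f x \<noteq> \<zero>\<^bsub>K\<^esub>}},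
      mult = undefined, one = undefined,
      zero = (\<lambda>x. \<zero>\<^bsub>K\<^esub>), add = (\<lambda>f g x. f x \<oplus>\<^bsub>K\<^esub> g x),
      smult = (\<lambda>c f x. c \<otimes>\<^bsub>K\<^esub> f x) \<rparr>"

definition basis_vec :: "('k, 'r) ring_scheme \<Rightarrow> 'x \<Rightarrow> 'x \<Rightarrow> 'k" where
  "basis_vec K x = (\<lambda>y. if y = x then \<one>\<^bsub>K\<^esub> else \<zero>\<^bsub>K\<^esub>)"

text \<open>Linear extension to a free module of a map \<open>h\<close> defined on its basis.\<close>

definition lin_ext ::
  "('k, 'r) ring_scheme \<Rightarrow> ('k, 'a, 'm) module_scheme \<Rightarrow> ('x \<Rightarrow> 'a) \<Rightarrow> ('x \<Rightarrow> 'k) \<Rightarrow> 'a" where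
  "lin_ext K M h f = (\<Oplus>\<^bsub>M\<^esub>x\<in>{x. f x \<noteq> \<zero>\<^bsub>K\<^esub>}. f x \<odot>\<^bsub>M\<^esub> h x)"

definition quot_mod :: "('k, 'a, 'm) module_scheme \<Rightarrow> 'a set \<Rightarrow> ('k, 'a set) module" where
  "quot_mod M N =
    \<lparr> carrier = A_RCOSETS M N,
      mult = undefined, one = undefined,
      zero = N, add = set_add M,
      smult = (\<lambda>c A. \<Union>a\<in>A. N +>\<^bsub>M\<^esub> c \<odot>\<^bsub>M\<^esub> a) \<rparr>"

text \<open>The tensor product, as the free module on pairs modulo bilinearity.\<close>

definition bilinear_rels ::
  "('k, 'r) ring_scheme \<Rightarrow> ('k, 'v, 'm) module_scheme \<Rightarrow> ('k, 'w, 'n) module_scheme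
    \<Rightarrow> ('v \<times> 'w \<Rightarrow> 'k) set" where
  "bilinear_rels K V W =
    (let F = free_mod K (carrier V \<times> carrier W); \<delta> = basis_vec K in
     gen_submodule K F
      ({\<delta> (v \<oplus>\<^bsub>V\<^esub> v', w) \<ominus>\<^bsub>F\<^esub> (\<delta> (v, w) \<oplus>\<^bsub>F\<^esub> \<delta> (v', w)) | v v' w.
          v \<in> carrier V \<and> v' \<in> carrier V \<and> w \<in> carrier W}
     \<union> {\<delta> (v, w \<oplus>\<^bsub>W\<^esub> w') \<ominus>\<^bsub>F\<^esub> (\<delta> (v, w) \<oplus>\<^bsub>F\<^esub> \<delta> (v, w')) | v w w'.
          v \<in> carrier V \<and> w \<in> carrier W \<and> w' \<in> carrier W}
     \<union> {\<delta> (c \<odot>\<^bsub>V\<^esub> v, w) \<ominus>\<^bsub>F\<^esub> c \<odot>\<^bsub>F\<^esub> \<delta> (v, w) | c v w.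
          c \<in> carrier K \<and> v \<in> carrier V \<and> w \<in> carrier W}
     \<union> {\<delta> (v, c \<odot>\<^bsub>W\<^esub> w) \<ominus>\<^bsub>F\<^esub> c \<odot>\<^bsub>F\<^esub> \<delta> (v, w) | c v w.
          c \<in> carrier K \<and> v \<in> carrier V \<and> w \<in> carrier W}))"

definition tensor ::
  "('k, 'r) ring_scheme \<Rightarrow> ('k, 'v, 'm) module_scheme \<Rightarrow> ('k, 'w, 'n) module_scheme
    \<Rightarrow> ('k, ('v \<times> 'w \<Rightarrow> 'k) set) module" where
  "tensor K V W = quot_mod (free_mod K (carrier V \<times> carrier W)) (bilinear_rels K V W)"

definition pure_tensor ::
  "('k, 'r) ring_scheme \<Rightarrow> ('k, 'v, 'm) module_scheme \<Rightarrow> ('k, 'w, 'n) module_scheme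
    \<Rightarrow> 'v \<Rightarrow> 'w \<Rightarrow> ('v \<times> 'w \<Rightarrow> 'k) set" where
  "pure_tensor K V W v w =
    bilinear_rels K V W +>\<^bsub>free_mod K (carrier V \<times> carrier W)\<^esub> basis_vec K (v, w)"


section \<open>Nonsymmetric operads\<close>

text \<open>
  Partial composition presentation: \<open>pcomp P m n i a b\<close> is \<open>a \<circ>\<^sub>i b\<close> for \<open>a\<close> of arity \<open>m\<close>
  and \<open>b\<close> of arity \<open>n\<close>, meaningful for \<open>1 \<le> i \<le> m\<close>.
\<close>

record ('k, 'a) ns_op =
  component :: "nat \<Rightarrow> ('k, 'a) module"
  idop :: 'a
  pcomp :: "nat \<Rightarrow> nat \<Rightarrow> nat \<Rightarrow> 'a \<Rightarrow> 'a \<Rightarrow> 'a"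

locale ns_operad =
  fixes K :: "('k, 'r) ring_scheme" and P :: "('k, 'a) ns_op"
  assumes component_module: "\<And>n. module K (component P n)"
    and idop_closed: "idop P \<in> carrier (component P 1)"
    and pcomp_closed:
      "\<And>m n i a b. \<lbrakk>1 \<le> i; i \<le> m; a \<in> carrier (component P m); b \<in> carrier (component P n)\<rbrakk>
        \<Longrightarrow> pcomp P m n i a b \<in> carrier (component P (m + n - 1))"
    and pcomp_add_left:
      "\<And>m n i a a' b. \<lbrakk>1 \<le> i; i \<le> m; a \<in> carrier (component P m); a' \<in> carrier (component P m);
          b \<in> carrier (component P n)\<rbrakk>
        \<Longrightarrow> pcomp P m n i (a \<oplus>\<^bsub>component P m\<^esub> a') b
          = pcomp P m n i a b \<oplus>\<^bsub>component P (m + n - 1)\<^esub> pcomp P m n i a' b"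
    and pcomp_add_right:
      "\<And>m n i a b b'. \<lbrakk>1 \<le> i; i \<le> m; a \<in> carrier (component P m); b \<in> carrier (component P n);
          b' \<in> carrier (component P n)\<rbrakk>
        \<Longrightarrow> pcomp P m n i a (b \<oplus>\<^bsub>component P n\<^esub> b')
          = pcomp P m n i a b \<oplus>\<^bsub>component P (m + n - 1)\<^esub> pcomp P m n i a b'"
    and pcomp_smult_left:
      "\<And>m n i c a b. \<lbrakk>1 \<le> i; i \<le> m; c \<in> carrier K; a \<in> carrier (component P m);
          b \<in> carrier (component P n)\<rbrakk>
        \<Longrightarrow> pcomp P m n i (c \<odot>\<^bsub>component P m\<^esub> a) b
          = c \<odot>\<^bsub>component P (m + n - 1)\<^esub> pcomp P m n i a b"
    and pcomp_smult_right:
      "\<And>m n i c a b. \<lbrakk>1 \<le> i; i \<le> m; c \<in> carrier K; a \<in> carrier (component P m);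
          b \<in> carrier (component P n)\<rbrakk>
        \<Longrightarrow> pcomp P m n i a (c \<odot>\<^bsub>component P n\<^esub> b)
          = c \<odot>\<^bsub>component P (m + n - 1)\<^esub> pcomp P m n i a b"
    and idop_left: "\<And>n b. b \<in> carrier (component P n) \<Longrightarrow> pcomp P 1 n 1 (idop P) b = b"
    and idop_right:
      "\<And>m i a. \<lbrakk>1 \<le> i; i \<le> m; a \<in> carrier (component P m)\<rbrakk> \<Longrightarrow> pcomp P m 1 i a (idop P) = a"
    and sequential:
      "\<And>l m n i j a b c. \<lbrakk>1 \<le> i; i \<le> l; 1 \<le> j; j \<le> m; a \<in> carrier (component P l);
          b \<in> carrier (component P m); c \<in> carrier (component P n)\<rbrakk>
        \<Longrightarrow> pcomp P (l + m - 1) n (i - 1 + j) (pcomp P l m i a b) c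
          = pcomp P l (m + n - 1) i a (pcomp P m n j b c)"
    and parallel:
      "\<And>l m n i k a b c. \<lbrakk>1 \<le> i; i < k; k \<le> l; a \<in> carrier (component P l);
          b \<in> carrier (component P m); c \<in> carrier (component P n)\<rbrakk>
        \<Longrightarrow> pcomp P (l + m - 1) n (k - 1 + m) (pcomp P l m i a b) c
          = pcomp P (l + n - 1) m i (pcomp P l n k a c) b"

definition ns_isos ::
  "('k, 'r) ring_scheme \<Rightarrow> ('k, 'a) ns_op \<Rightarrow> ('k, 'b) ns_op \<Rightarrow> (nat \<Rightarrow> 'a \<Rightarrow> 'b) set" where
  "ns_isos K P Q =
    {\<phi>. (\<forall>n. \<phi> n \<in> iso (add_monoid (component P n)) (add_monoid (component Q n)))
      \<and> (\<forall>n. \<forall>c\<in>carrier K. \<forall>a\<in>carrier (component P n).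
            \<phi> n (c \<odot>\<^bsub>component P n\<^esub> a) = c \<odot>\<^bsub>component Q n\<^esub> \<phi> n a)
      \<and> \<phi> 1 (idop P) = idop Q
      \<and> (\<forall>m n i. 1 \<le> i \<and> i \<le> m \<longrightarrow>
            (\<forall>a\<in>carrier (component P m). \<forall>b\<in>carrier (component P n).
               \<phi> (m + n - 1) (pcomp P m n i a b) = pcomp Q m n i (\<phi> m a) (\<phi> n b)))}"

definition ns_isomorphic ::
  "('k, 'r) ring_scheme \<Rightarrow> ('k, 'a) ns_op \<Rightarrow> ('k, 'b) ns_op \<Rightarrow> bool" where
  "ns_isomorphic K P Q \<longleftrightarrow> ns_operad K P \<and> ns_operad K Q \<and> ns_isos K P Q \<noteq> {}"

definition ns_ideal :: "('k, 'r) ring_scheme \<Rightarrow> ('k, 'a) ns_op \<Rightarrow> (nat \<Rightarrow> 'a set) \<Rightarrow> bool" where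
  "ns_ideal K P I \<longleftrightarrow>
    (\<forall>n. submodule (I n) K (component P n))
    \<and> (\<forall>m n i a b. 1 \<le> i \<and> i \<le> m \<and> a \<in> I m \<and> b \<in> carrier (component P n)
          \<longrightarrow> pcomp P m n i a b \<in> I (m + n - 1))
    \<and> (\<forall>m n i a b. 1 \<le> i \<and> i \<le> m \<and> a \<in> carrier (component P m) \<and> b \<in> I n
          \<longrightarrow> pcomp P m n i a b \<in> I (m + n - 1))"

text \<open>The operadic ideal generated by a set \<open>S\<close> of elements of arity \<open>r\<close>.\<close>

definition gen_ideal ::
  "('k, 'r) ring_scheme \<Rightarrow> ('k, 'a) ns_op \<Rightarrow> nat \<Rightarrow> 'a set \<Rightarrow> nat \<Rightarrow> 'a set" where
  "gen_ideal K P r S n = \<Inter>{I n | I. ns_ideal K P I \<and> S \<subseteq> I r}"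

definition quot_op :: "('k, 'a) ns_op \<Rightarrow> (nat \<Rightarrow> 'a set) \<Rightarrow> ('k, 'a set) ns_op" where
  "quot_op P I =
    \<lparr> component = (\<lambda>n. quot_mod (component P n) (I n)),
      idop = I 1 +>\<^bsub>component P 1\<^esub> idop P,
      pcomp = (\<lambda>m n i A B. \<Union>a\<in>A. \<Union>b\<in>B.
         I (m + n - 1) +>\<^bsub>component P (m + n - 1)\<^esub> pcomp P m n i a b) \<rparr>"


section \<open>The free nonsymmetric operad on a space of binary operations\<close>

text \<open>
  Planar binary rooted trees with labelled vertices are library trees: \<open>Node l \<omega> r\<close> is a vertex
  labelled \<open>\<omega>\<close>, and \<open>size1\<close> counts the leaves, which are numbered from left to right
  starting with 1.
\<close>

definition trees :: "'v set \<Rightarrow> nat \<Rightarrow> 'v tree set" where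
  "trees X n = {t. size1 t = n \<and> set_tree t \<subseteq> X}"

fun graft :: "'v tree \<Rightarrow> nat \<Rightarrow> 'v tree \<Rightarrow> 'v tree" where
  "graft Leaf i t = t"
| "graft (Node l a r) i t =
    (if i \<le> size1 l then Node (graft l i t) a r else Node l a (graft r (i - size1 l) t))"

text \<open>Linear combinations of trees labelled by a set, before multilinearity is imposed.\<close>

definition tree_op :: "('k, 'r) ring_scheme \<Rightarrow> 'v set \<Rightarrow> ('k, 'v tree \<Rightarrow> 'k) ns_op" where
  "tree_op K X =
    \<lparr> component = (\<lambda>n. free_mod K (trees X n)),
      idop = basis_vec K Leaf,
      pcomp = (\<lambda>m n i f g.
         let F = free_mod K (trees X (m + n - 1)) in
         lin_ext K F (\<lambda>s. lin_ext K F (\<lambda>t. basis_vec K (graft s i t)) g) f) \<rparr>"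

text \<open>Trees with one distinguished vertex, as functions of the label of that vertex.\<close>

inductive_set vertex_ctx :: "('v \<Rightarrow> 'v tree) set" where
  here: "(\<lambda>\<omega>. Node l \<omega> r) \<in> vertex_ctx"
| left: "C \<in> vertex_ctx \<Longrightarrow> (\<lambda>\<omega>. Node (C \<omega>) a r) \<in> vertex_ctx"
| right: "C \<in> vertex_ctx \<Longrightarrow> (\<lambda>\<omega>. Node l a (C \<omega>)) \<in> vertex_ctx"

definition multilinear_rels ::
  "('k, 'r) ring_scheme \<Rightarrow> ('k, 'v, 'm) module_scheme \<Rightarrow> nat \<Rightarrow> ('v tree \<Rightarrow> 'k) set" where
  "multilinear_rels K V n =
    (let F = free_mod K (trees (carrier V) n); \<delta> = basis_vec K in
     gen_submodule K F
      ({\<delta> (C (\<omega> \<oplus>\<^bsub>V\<^esub> \<nu>)) \<ominus>\<^bsub>F\<^esub> (\<delta> (C \<omega>) \<oplus>\<^bsub>F\<^esub> \<delta> (C \<nu>)) | C \<omega> \<nu>.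
          C \<in> vertex_ctx \<and> C \<omega> \<in> trees (carrier V) n \<and> C \<nu> \<in> trees (carrier V) n}
     \<union> {\<delta> (C (c \<odot>\<^bsub>V\<^esub> \<omega>)) \<ominus>\<^bsub>F\<^esub> c \<odot>\<^bsub>F\<^esub> \<delta> (C \<omega>) | C c \<omega>.
          C \<in> vertex_ctx \<and> c \<in> carrier K \<and> C \<omega> \<in> trees (carrier V) n}))"

definition free_op ::
  "('k, 'r) ring_scheme \<Rightarrow> ('k, 'v, 'm) module_scheme \<Rightarrow> ('k, ('v tree \<Rightarrow> 'k) set) ns_op" where
  "free_op K V = quot_op (tree_op K (carrier V)) (multilinear_rels K V)"

text \<open>The binary quadratic operad presented by the operations \<open>V\<close> and the relators \<open>R\<close>.\<close>

definition quadratic_op ::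
  "('k, 'r) ring_scheme \<Rightarrow> ('k, 'v, 'm) module_scheme \<Rightarrow> ('v tree \<Rightarrow> 'k) set set
    \<Rightarrow> ('k, ('v tree \<Rightarrow> 'k) set set) ns_op" where
  "quadratic_op K V R = quot_op (free_op K V) (gen_ideal K (free_op K V) 3 R)"

text \<open>The trees \<open>\<omega>(\<nu>(x,y),z)\<close> and \<open>\<omega>(x,\<nu>(y,z))\<close>, and their classes in the free operad.\<close>

abbreviation tree1 :: "'v \<Rightarrow> 'v \<Rightarrow> 'v tree" where
  "tree1 \<omega> \<nu> \<equiv> Node (Node Leaf \<nu> Leaf) \<omega> Leaf"

abbreviation tree2 :: "'v \<Rightarrow> 'v \<Rightarrow> 'v tree" where
  "tree2 \<omega> \<nu> \<equiv> Node Leaf \<omega> (Node Leaf \<nu> Leaf)"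

definition tree_class ::
  "('k, 'r) ring_scheme \<Rightarrow> ('k, 'v, 'm) module_scheme \<Rightarrow> 'v tree \<Rightarrow> ('v tree \<Rightarrow> 'k) set" where
  "tree_class K V t =
    multilinear_rels K V (size1 t) +>\<^bsub>free_mod K (trees (carrier V) (size1 t))\<^esub> basis_vec K t"


section \<open>Trisuccessors\<close>

datatype tri = Prec | Succ | Dot

definition tri_space :: "('k, 'r) ring_scheme \<Rightarrow> ('k, tri \<Rightarrow> 'k) module" where
  "tri_space K = free_mod K UNIV"

definition tri_star :: "('k, 'r) ring_scheme \<Rightarrow> tri \<Rightarrow> 'k" where
  "tri_star K =
    basis_vec K Prec \<oplus>\<^bsub>tri_space K\<^esub> basis_vec K Succ \<oplus>\<^bsub>tri_space K\<^esub> basis_vec K Dot"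

definition tri_hat ::
  "('k, 'r) ring_scheme \<Rightarrow> ('k, 'v, 'm) module_scheme
    \<Rightarrow> ('k, ('v \<times> (tri \<Rightarrow> 'k) \<Rightarrow> 'k) set) module" where
  "tri_hat K V = tensor K V (tri_space K)"

definition tri_label ::
  "('k, 'r) ring_scheme \<Rightarrow> ('k, 'v, 'm) module_scheme \<Rightarrow> tri \<Rightarrow> 'v
    \<Rightarrow> ('v \<times> (tri \<Rightarrow> 'k) \<Rightarrow> 'k) set" where
  "tri_label K V d \<omega> = pure_tensor K V (tri_space K) \<omega> (basis_vec K d)"

definition star_label ::
  "('k, 'r) ring_scheme \<Rightarrow> ('k, 'v, 'm) module_scheme \<Rightarrow> 'v
    \<Rightarrow> ('v \<times> (tri \<Rightarrow> 'k) \<Rightarrow> 'k) set" where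
  "star_label K V \<omega> =
    tri_label K V Prec \<omega> \<oplus>\<^bsub>tri_hat K V\<^esub> tri_label K V Succ \<omega> \<oplus>\<^bsub>tri_hat K V\<^esub> tri_label K V Dot \<omega>"

text \<open>
  At each vertex, \<open>JL\<close> and \<open>JR\<close> are the leaves of \<open>J\<close> in the left and in the right subtree,
  numbered within that subtree. The paths from the root to the leaves in \<open>J\<close> that pass through
  the vertex and turn left (right) there are those ending in \<open>JL\<close> (\<open>JR\<close>).
\<close>

fun tsu_tree ::
  "('k, 'r) ring_scheme \<Rightarrow> ('k, 'v, 'm) module_scheme \<Rightarrow> nat set \<Rightarrow> 'v tree
    \<Rightarrow> ('v \<times> (tri \<Rightarrow> 'k) \<Rightarrow> 'k) set tree" where
  "tsu_tree K V J Leaf = Leaf"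
| "tsu_tree K V J (Node l \<omega> r) =
    (let JL = {j \<in> J. j \<le> size1 l}; JR = {j - size1 l | j. j \<in> J \<and> size1 l < j} in
     Node (tsu_tree K V JL l)
       (if JL \<noteq> {} \<and> JR = {} then tri_label K V Prec \<omega>
        else if JL = {} \<and> JR \<noteq> {} then tri_label K V Succ \<omega>
        else if JL \<noteq> {} \<and> JR \<noteq> {} then tri_label K V Dot \<omega>
        else star_label K V \<omega>)
       (tsu_tree K V JR r))"

text \<open>The linear map induced by \<open>tsu_tree\<close> on the arity \<open>n\<close> component of the free operad.\<close>

definition tsu ::
  "('k, 'r) ring_scheme \<Rightarrow> ('k, 'v, 'm) module_scheme \<Rightarrow> nat \<Rightarrow> nat set \<Rightarrow> ('v tree \<Rightarrow> 'k) set
    \<Rightarrow> (('v \<times> (tri \<Rightarrow> 'k) \<Rightarrow> 'k) set tree \<Rightarrow> 'k) set" where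
  "tsu K V n J A =
    (let F = free_mod K (trees (carrier (tri_hat K V)) n) in
     \<Union>a\<in>A. multilinear_rels K (tri_hat K V) n +>\<^bsub>F\<^esub>
       lin_ext K F (\<lambda>t. basis_vec K (tsu_tree K V J t)) a)"

definition trisuccessor ::
  "('k, 'r) ring_scheme \<Rightarrow> ('k, 'v, 'm) module_scheme \<Rightarrow> ('v tree \<Rightarrow> 'k) set set
    \<Rightarrow> ('k, (('v \<times> (tri \<Rightarrow> 'k) \<Rightarrow> 'k) set tree \<Rightarrow> 'k) set set) ns_op" where
  "trisuccessor K V R =
    quadratic_op K (tri_hat K V) {tsu K V 3 J r | r J. r \<in> R \<and> J \<noteq> {} \<and> J \<subseteq> {1, 2, 3}}"


section \<open>The operad of tridendriform algebras\<close>

text \<open>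
  \<open>TriDend\<close> is presented by \<open>tri_space K\<close> and the span of the following relators: the
  identity \<open>(x b y) a z = x c (y d z)\<close> contributes \<open>a \<circ>\<^sub>1 b - c \<circ>\<^sub>2 d\<close>.
\<close>

definition tridend_rels :: "('k, 'r) ring_scheme \<Rightarrow> ((tri \<Rightarrow> 'k) tree \<Rightarrow> 'k) set set" where
  "tridend_rels K =
    (let T3 = component (free_op K (tri_space K)) 3; cl = tree_class K (tri_space K);
         p = basis_vec K Prec; s = basis_vec K Succ; d = basis_vec K Dot; st = tri_star K in
     gen_submodule K T3
      {cl (tree1 p p) \<ominus>\<^bsub>T3\<^esub> cl (tree2 p st),
       cl (tree1 p s) \<ominus>\<^bsub>T3\<^esub> cl (tree2 s p),
       cl (tree1 s st) \<ominus>\<^bsub>T3\<^esub> cl (tree2 s s),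
       cl (tree1 d s) \<ominus>\<^bsub>T3\<^esub> cl (tree2 s d),
       cl (tree1 d p) \<ominus>\<^bsub>T3\<^esub> cl (tree2 d s),
       cl (tree1 p d) \<ominus>\<^bsub>T3\<^esub> cl (tree2 d p),
       cl (tree1 d d) \<ominus>\<^bsub>T3\<^esub> cl (tree2 d d)})"


section \<open>The black square product\<close>

fun psi_tree ::
  "('k, 'r) ring_scheme \<Rightarrow> ('k, 'v, 'm) module_scheme \<Rightarrow> ('k, 'w, 'n) module_scheme
    \<Rightarrow> 'v tree \<Rightarrow> 'w tree \<Rightarrow> (('v \<times> 'w \<Rightarrow> 'k) set tree \<Rightarrow> 'k)" where
  "psi_tree K V W (tree1 \<omega> \<nu>) (tree1 \<omega>' \<nu>') =
    basis_vec K (tree1 (pure_tensor K V W \<omega> \<omega>') (pure_tensor K V W \<nu> \<nu>'))"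
| "psi_tree K V W (tree2 \<omega> \<nu>) (tree2 \<omega>' \<nu>') =
    \<ominus>\<^bsub>free_mod K (trees (carrier (tensor K V W)) 3)\<^esub>
      basis_vec K (tree2 (pure_tensor K V W \<omega> \<omega>') (pure_tensor K V W \<nu> \<nu>'))"
| "psi_tree K V W _ _ = \<zero>\<^bsub>free_mod K (trees (carrier (tensor K V W)) 3)\<^esub>"

text \<open>
  \<open>psi K V W r s\<close> is the value of the linear map \<open>\<Psi>\<close> on the pure tensor \<open>r \<otimes> s\<close>, where \<open>r\<close> and
  \<open>s\<close> are arity 3 elements of the free operads on \<open>V\<close> and \<open>W\<close>.
\<close>

definition psi ::
  "('k, 'r) ring_scheme \<Rightarrow> ('k, 'v, 'm) module_scheme \<Rightarrow> ('k, 'w, 'n) module_scheme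
    \<Rightarrow> ('v tree \<Rightarrow> 'k) set \<Rightarrow> ('w tree \<Rightarrow> 'k) set \<Rightarrow> (('v \<times> 'w \<Rightarrow> 'k) set tree \<Rightarrow> 'k) set" where
  "psi K V W r s =
    (let F = free_mod K (trees (carrier (tensor K V W)) 3) in
     \<Union>a\<in>r. \<Union>b\<in>s. multilinear_rels K (tensor K V W) 3 +>\<^bsub>F\<^esub>
       lin_ext K F (\<lambda>t. lin_ext K F (\<lambda>u. psi_tree K V W t u) b) a)"

text \<open>
  The product of the operads presented by \<open>(V, R)\<close> and \<open>(W, S)\<close>. As \<open>R \<otimes> S\<close> is spanned by pure
  tensors, its image under \<open>\<Psi>\<close> is the span of the elements \<open>\<Psi>(r \<otimes> s)\<close>.
\<close>

definition black_square ::
  "('k, 'r) ring_scheme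
    \<Rightarrow> ('k, 'v, 'm) module_scheme \<Rightarrow> ('v tree \<Rightarrow> 'k) set set
    \<Rightarrow> ('k, 'w, 'n) module_scheme \<Rightarrow> ('w tree \<Rightarrow> 'k) set set
    \<Rightarrow> ('k, (('v \<times> 'w \<Rightarrow> 'k) set tree \<Rightarrow> 'k) set set) ns_op" where
  "black_square K V R W S =
    quadratic_op K (tensor K V W)
      (gen_submodule K (component (free_op K (tensor K V W)) 3)
        {psi K V W r s | r s. r \<in> R \<and> s \<in> S})"

end

theory Submission
  imports Defs
begin

text \<open>
  The seven relations of \<open>TriDend\<close> are indexed by the nonempty subsets \<open>J\<close> of \<open>{1, 2, 3}\<close>: they are
  \<open>s\<^sub>J = a\<^sub>J \<circ>\<^sub>1 b\<^sub>J - c\<^sub>J \<circ>\<^sub>2 d\<^sub>J\<close>, where \<open>a\<^sub>J, b\<^sub>J\<close> and \<open>c\<^sub>J, d\<^sub>J\<close> are the symbols that \<open>TSu\<^sub>J\<close> puts on the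
  vertices of the left and of the right comb with three leaves. The sign in \<open>\<Psi>\<close> cancels the sign
  in \<open>s\<^sub>J\<close>, so the exchange of tensor factors sends \<open>TSu\<^sub>J r\<close> to \<open>\<Psi> (s\<^sub>J \<otimes> r)\<close>. Hence the isomorphism
  of free operads induced by the exchange identifies the two ideals of relations.
\<close>

section \<open>Linear maps, quotients and free modules\<close>

text \<open>The exchange can match \<open>TSu\<^sub>J\<close> with \<Psi> because the symbol put on
  a vertex depends on \<open>J\<close> and on the shape of the tree, but not on the label. Every new
  label is thus a pure tensor in which \<open>J\<close> is visible only in the
  \<open>TriDend\<close> factor and the old label only in the other one. The obstacle is
  well-definedness. Tensor products and free operads are quotients of free modules, presented
  operads are quotients of these quotients, and \<open>tsu\<close> and \<open>psi\<close> are unions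
  over representatives. So each map is built on basis vectors, extended linearly, shown to preserve
  the relations (for multilinearity always by the criterion \<open>multilinear_rels_image\<close>),
  and only then passed to cosets. The relators also come in different forms: a bare set of elements
  \<open>TSu\<^sub>J r\<close> on one side, the span of all \<open>\<Psi> (s \<otimes> r)\<close>
  with \<open>s\<close> in the span of the \<open>s\<^sub>J\<close> on the other. The exchange sends
  the former into the latter directly; the way back uses linearity of \<Psi> in \<open>s\<close> and
  the fact that the generated ideal is a submodule in arity 3.\<close>

definition linear_map ::
  "('k, 'r) ring_scheme \<Rightarrow> ('k, 'a, 'm) module_scheme \<Rightarrow> ('k, 'b, 'n) module_scheme
    \<Rightarrow> ('a \<Rightarrow> 'b) \<Rightarrow> bool" where
  "linear_map K M N f \<longleftrightarrow>
    (\<forall>x\<in>carrier M. f x \<in> carrier N)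
    \<and> (\<forall>x\<in>carrier M. \<forall>y\<in>carrier M. f (x \<oplus>\<^bsub>M\<^esub> y) = f x \<oplus>\<^bsub>N\<^esub> f y)
    \<and> (\<forall>c\<in>carrier K. \<forall>x\<in>carrier M. f (c \<odot>\<^bsub>M\<^esub> x) = c \<odot>\<^bsub>N\<^esub> f x)"

lemma linear_mapI:
  assumes "\<And>x. x \<in> carrier M \<Longrightarrow> f x \<in> carrier N"
    and "\<And>x y. x \<in> carrier M \<Longrightarrow> y \<in> carrier M \<Longrightarrow> f (x \<oplus>\<^bsub>M\<^esub> y) = f x \<oplus>\<^bsub>N\<^esub> f y"
    and "\<And>c x. c \<in> carrier K \<Longrightarrow> x \<in> carrier M \<Longrightarrow> f (c \<odot>\<^bsub>M\<^esub> x) = c \<odot>\<^bsub>N\<^esub> f x"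
  shows "linear_map K M N f"
  using assms by (auto simp: linear_map_def)

lemma linear_mapD:
  assumes "linear_map K M N f"
  shows linear_map_closed: "x \<in> carrier M \<Longrightarrow> f x \<in> carrier N"
    and linear_map_add: "x \<in> carrier M \<Longrightarrow> y \<in> carrier M \<Longrightarrow> f (x \<oplus>\<^bsub>M\<^esub> y) = f x \<oplus>\<^bsub>N\<^esub> f y"
    and linear_map_smult: "c \<in> carrier K \<Longrightarrow> x \<in> carrier M \<Longrightarrow> f (c \<odot>\<^bsub>M\<^esub> x) = c \<odot>\<^bsub>N\<^esub> f x"
  using assms by (auto simp: linear_map_def)

lemma linear_map_id: "linear_map K M M (\<lambda>x. x)"
  by (simp add: linear_map_def)

lemma linear_map_comp:
  "linear_map K M N f \<Longrightarrow> linear_map K N L g \<Longrightarrow> linear_map K M L (\<lambda>x. g (f x))"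
  by (simp add: linear_map_def)

lemma linear_map_neg:
  assumes "module K M" "module K N" "linear_map K M N f" "x \<in> carrier M"
  shows "f (\<ominus>\<^bsub>M\<^esub> x) = \<ominus>\<^bsub>N\<^esub> f x"
proof -
  interpret M: module K M by fact
  interpret N: module K N by fact
  have "f (\<ominus>\<^bsub>K\<^esub> \<one>\<^bsub>K\<^esub> \<odot>\<^bsub>M\<^esub> x) = \<ominus>\<^bsub>K\<^esub> \<one>\<^bsub>K\<^esub> \<odot>\<^bsub>N\<^esub> f x"
    using assms by (simp add: linear_map_smult)
  then show ?thesis
    using assms linear_map_closed[OF assms(3,4)] by (simp add: M.smult_l_minus N.smult_l_minus)
qed

lemma linear_map_minus:
  assumes "module K M" "module K N" "linear_map K M N f" "x \<in> carrier M" "y \<in> carrier M"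
  shows "f (x \<ominus>\<^bsub>M\<^esub> y) = f x \<ominus>\<^bsub>N\<^esub> f y"
proof -
  interpret M: module K M by fact
  show ?thesis
    using assms by (simp add: a_minus_def linear_map_add linear_map_neg[OF assms(1-3)])
qed

lemma linear_map_zero:
  assumes "module K M" "module K N" "linear_map K M N f"
  shows "f \<zero>\<^bsub>M\<^esub> = \<zero>\<^bsub>N\<^esub>"
proof -
  interpret M: module K M by fact
  interpret N: module K N by fact
  have "f (\<zero>\<^bsub>K\<^esub> \<odot>\<^bsub>M\<^esub> \<zero>\<^bsub>M\<^esub>) = \<zero>\<^bsub>K\<^esub> \<odot>\<^bsub>N\<^esub> f \<zero>\<^bsub>M\<^esub>"
    by (rule linear_map_smult[OF assms(3)]) simp_all
  then show ?thesis
    using linear_map_closed[OF assms(3) M.M.zero_closed] by simp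
qed

section \<open>Submodules and spans\<close>

lemma submodule_closed:
  assumes "module K M" "submodule N K M"
  shows submodule_subset: "N \<subseteq> carrier M"
    and submodule_carrier: "a \<in> N \<Longrightarrow> a \<in> carrier M"
    and submodule_zero: "\<zero>\<^bsub>M\<^esub> \<in> N"
    and submodule_neg: "a \<in> N \<Longrightarrow> \<ominus>\<^bsub>M\<^esub> a \<in> N"
    and submodule_add: "a \<in> N \<Longrightarrow> b \<in> N \<Longrightarrow> a \<oplus>\<^bsub>M\<^esub> b \<in> N"
    and submodule_minus: "a \<in> N \<Longrightarrow> b \<in> N \<Longrightarrow> a \<ominus>\<^bsub>M\<^esub> b \<in> N"
    and submodule_smult: "c \<in> carrier K \<Longrightarrow> a \<in> N \<Longrightarrow> c \<odot>\<^bsub>M\<^esub> a \<in> N"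
proof -
  interpret M: module K M by fact
  interpret N: submodule N K M by fact
  note E = M.submoduleE[OF assms(2)]
  show "N \<subseteq> carrier M" "a \<in> N \<Longrightarrow> a \<in> carrier M" "a \<in> N \<Longrightarrow> \<ominus>\<^bsub>M\<^esub> a \<in> N"
    "a \<in> N \<Longrightarrow> b \<in> N \<Longrightarrow> a \<oplus>\<^bsub>M\<^esub> b \<in> N" "a \<in> N \<Longrightarrow> b \<in> N \<Longrightarrow> a \<ominus>\<^bsub>M\<^esub> b \<in> N"
    "c \<in> carrier K \<Longrightarrow> a \<in> N \<Longrightarrow> c \<odot>\<^bsub>M\<^esub> a \<in> N"
    using E by (auto simp: a_minus_def)
  show "\<zero>\<^bsub>M\<^esub> \<in> N" using N.one_closed by simp
qed

text \<open>The means of showing that a linear map sends one span into another: the preimage of the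
  target is a submodule, so only generators have to be tested.\<close>

lemma submodule_vimage:
  assumes "module K M" "module K N" "linear_map K M N f" "submodule L K N"
  shows "submodule {x \<in> carrier M. f x \<in> L} K M"
proof -
  interpret M: module K M by fact
  show ?thesis
    by (rule M.submoduleI)
      (use assms in \<open>auto simp: linear_map_zero linear_map_neg linear_map_add linear_map_smult
        intro: submodule_closed[OF assms(2,4)]\<close>)
qed

text \<open>Reduces the equality of two linear maps to a spanning set; \<open>free_mod_ext\<close>
  applies it to the basis vectors.\<close>

lemma submodule_equalizer:
  assumes "module K M" "module K N" "linear_map K M N f" "linear_map K M N g"
  shows "submodule {x \<in> carrier M. f x = g x} K M"
proof -
  interpret M: module K M by fact
  show ?thesis
    by (rule M.submoduleI)
      (use assms in \<open>auto simp: linear_map_zero linear_map_neg linear_map_add linear_map_smult\<close>)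
qed

lemma submodule_Inter:
  assumes "module K M" "\<And>N. N \<in> \<N> \<Longrightarrow> submodule N K M" "\<N> \<noteq> {}"
  shows "submodule (\<Inter>\<N>) K M"
proof -
  interpret M: module K M by fact
  show ?thesis
    by (rule M.submoduleI)
      (use assms(2,3) in \<open>auto intro: submodule_closed[OF assms(1) assms(2)]
        dest: submodule_carrier[OF assms(1) assms(2)]\<close>)
qed

text \<open>The inclusion of \<open>S\<close> in the carrier makes the intersected family nonempty,
  the carrier being a member. Over an empty family the intersection would be
  \<open>UNIV\<close>.\<close>

lemma gen_submodule_submodule:
  assumes "module K M" "S \<subseteq> carrier M"
  shows "submodule (gen_submodule K M S) K M"
  unfolding gen_submodule_def
  using assms module.carrier_is_submodule[OF assms(1)] by (intro submodule_Inter) auto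

lemma gen_submodule_incl: "S \<subseteq> gen_submodule K M S"
  by (auto simp: gen_submodule_def)

lemma gen_submodule_least: "submodule N K M \<Longrightarrow> S \<subseteq> N \<Longrightarrow> gen_submodule K M S \<subseteq> N"
  by (auto simp: gen_submodule_def)

lemma gen_submodule_image:
  assumes "module K M" "module K N" "linear_map K M N f" "submodule L K N" "S \<subseteq> carrier M"
    and "\<And>x. x \<in> S \<Longrightarrow> f x \<in> L" "x \<in> gen_submodule K M S"
  shows "f x \<in> L"
  using gen_submodule_least[OF submodule_vimage[OF assms(1-4)], of S] assms(5-7) by auto

section \<open>Cosets and quotient modules\<close>

context
  fixes K :: "('k, 'r) ring_scheme" and M :: "('k, 'a, 'm) module_scheme" and N :: "'a set"
  assumes M: "module K M" and N: "submodule N K M"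
begin

interpretation M: module K M by (fact M)

interpretation abelian_subgroup N M
  by (rule abelian_subgroupI3)
    (use N in \<open>auto simp: submodule_def intro: additive_subgroup.intro M.abelian_group_axioms\<close>)

lemma coset_eq_iff:
  assumes "a \<in> carrier M" "b \<in> carrier M"
  shows "N +>\<^bsub>M\<^esub> a = N +>\<^bsub>M\<^esub> b \<longleftrightarrow> a \<ominus>\<^bsub>M\<^esub> b \<in> N"
  using assms a_rcos_module[of b a] a_repr_independence'[of a b] a_rcos_self[of a]
  by (auto simp: a_minus_def)

lemma coset_memD:
  assumes "a \<in> carrier M" "b \<in> N +>\<^bsub>M\<^esub> a"
  shows "b \<in> carrier M" "N +>\<^bsub>M\<^esub> b = N +>\<^bsub>M\<^esub> a"
  by (rule a_elemrcos_carrier[OF assms], rule a_repr_independence'[OF assms(2,1), symmetric])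

lemma coset_self: "a \<in> carrier M \<Longrightarrow> a \<in> N +>\<^bsub>M\<^esub> a"
  by (rule a_rcos_self)

text \<open>Scalar multiplication and composition on quotients, and all maps between them, are
  unions over representatives. Such a union collapses to one value as soon as the value depends only
  on the coset, so this is where well-definedness enters.\<close>

lemma coset_UN:
  assumes "a \<in> carrier M"
    and "\<And>b. b \<in> carrier M \<Longrightarrow> b \<ominus>\<^bsub>M\<^esub> a \<in> N \<Longrightarrow> g b = g a"
  shows "(\<Union>b\<in>N +>\<^bsub>M\<^esub> a. g b) = g a"
proof -
  have "g b = g a" if "b \<in> N +>\<^bsub>M\<^esub> a" for b
    using that coset_memD[OF assms(1) that] assms by (auto simp: coset_eq_iff)
  then show ?thesis using coset_self[OF assms(1)] by blast
qed

lemma quot_mod_carrier: "carrier (quot_mod M N) = {N +>\<^bsub>M\<^esub> a | a. a \<in> carrier M}"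
  by (auto simp: quot_mod_def A_RCOSETS_def')

lemma quot_mod_closed: "a \<in> carrier M \<Longrightarrow> N +>\<^bsub>M\<^esub> a \<in> carrier (quot_mod M N)"
  by (auto simp: quot_mod_carrier)

lemma quot_modE:
  assumes "A \<in> carrier (quot_mod M N)"
  obtains a where "a \<in> carrier M" "A = N +>\<^bsub>M\<^esub> a"
  using assms by (auto simp: quot_mod_carrier)

lemma quot_mod_add:
  "a \<in> carrier M \<Longrightarrow> b \<in> carrier M
    \<Longrightarrow> (N +>\<^bsub>M\<^esub> a) \<oplus>\<^bsub>quot_mod M N\<^esub> (N +>\<^bsub>M\<^esub> b) = N +>\<^bsub>M\<^esub> (a \<oplus>\<^bsub>M\<^esub> b)"
  by (simp add: quot_mod_def a_rcos_sum)

lemma quot_mod_smult: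
  assumes "c \<in> carrier K" "a \<in> carrier M"
  shows "c \<odot>\<^bsub>quot_mod M N\<^esub> (N +>\<^bsub>M\<^esub> a) = N +>\<^bsub>M\<^esub> (c \<odot>\<^bsub>M\<^esub> a)"
proof -
  have "N +>\<^bsub>M\<^esub> (c \<odot>\<^bsub>M\<^esub> b) = N +>\<^bsub>M\<^esub> (c \<odot>\<^bsub>M\<^esub> a)"
    if b: "b \<in> carrier M" "b \<ominus>\<^bsub>M\<^esub> a \<in> N" for b
  proof -
    have "c \<odot>\<^bsub>M\<^esub> b \<ominus>\<^bsub>M\<^esub> c \<odot>\<^bsub>M\<^esub> a = c \<odot>\<^bsub>M\<^esub> (b \<ominus>\<^bsub>M\<^esub> a)"
      using assms b by (simp add: a_minus_def M.smult_r_distr M.smult_r_minus)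
    then show ?thesis
      using assms b by (simp add: coset_eq_iff submodule_smult[OF M N])
  qed
  then show ?thesis
    using coset_UN[OF assms(2), of "\<lambda>b. N +>\<^bsub>M\<^esub> (c \<odot>\<^bsub>M\<^esub> b)"] by (simp add: quot_mod_def)
qed

lemma quot_mod_zero: "\<zero>\<^bsub>quot_mod M N\<^esub> = N +>\<^bsub>M\<^esub> \<zero>\<^bsub>M\<^esub>"
  using a_subset by (simp add: quot_mod_def M.a_coset_add_zero)

lemma quot_mod_module: "module K (quot_mod M N)"
proof (rule moduleI)
  show "cring K" by (rule M.R.cring_axioms)
  show "abelian_group (quot_mod M N)"
  proof (rule abelian_groupI)
    fix x assume "x \<in> carrier (quot_mod M N)"
    then obtain a where a: "a \<in> carrier M" "x = N +>\<^bsub>M\<^esub> a" by (rule quot_modE)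
    show "\<zero>\<^bsub>quot_mod M N\<^esub> \<oplus>\<^bsub>quot_mod M N\<^esub> x = x"
      unfolding a(2) quot_mod_zero using a(1) by (simp only: quot_mod_add M.M.zero_closed M.l_zero)
    have "N +>\<^bsub>M\<^esub> (\<ominus>\<^bsub>M\<^esub> a) \<in> carrier (quot_mod M N)"
      by (rule quot_mod_closed) (use a in simp)
    moreover have "(N +>\<^bsub>M\<^esub> (\<ominus>\<^bsub>M\<^esub> a)) \<oplus>\<^bsub>quot_mod M N\<^esub> x = \<zero>\<^bsub>quot_mod M N\<^esub>"
      unfolding a(2) quot_mod_zero using a(1) by (simp only: quot_mod_add M.a_inv_closed M.l_neg)
    ultimately show "\<exists>y\<in>carrier (quot_mod M N). y \<oplus>\<^bsub>quot_mod M N\<^esub> x = \<zero>\<^bsub>quot_mod M N\<^esub>"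
      by (rule bexI[rotated])
  next
    show "\<zero>\<^bsub>quot_mod M N\<^esub> \<in> carrier (quot_mod M N)"
      unfolding quot_mod_zero by (rule quot_mod_closed) simp
  next
    fix x y assume "x \<in> carrier (quot_mod M N)" "y \<in> carrier (quot_mod M N)"
    then obtain a b where ab: "a \<in> carrier M" "x = N +>\<^bsub>M\<^esub> a" "b \<in> carrier M" "y = N +>\<^bsub>M\<^esub> b"
      by (elim quot_modE)
    show "x \<oplus>\<^bsub>quot_mod M N\<^esub> y \<in> carrier (quot_mod M N)"
      unfolding ab(2,4) quot_mod_add[OF ab(1,3)] by (rule quot_mod_closed) (use ab in simp)
    show "x \<oplus>\<^bsub>quot_mod M N\<^esub> y = y \<oplus>\<^bsub>quot_mod M N\<^esub> x"
      unfolding ab(2,4) quot_mod_add[OF ab(1,3)] quot_mod_add[OF ab(3,1)]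
      using M.a_comm[OF ab(1,3)] by (rule arg_cong)
    fix z assume "z \<in> carrier (quot_mod M N)"
    then obtain c where c: "c \<in> carrier M" "z = N +>\<^bsub>M\<^esub> c" by (rule quot_modE)
    show "x \<oplus>\<^bsub>quot_mod M N\<^esub> y \<oplus>\<^bsub>quot_mod M N\<^esub> z = x \<oplus>\<^bsub>quot_mod M N\<^esub> (y \<oplus>\<^bsub>quot_mod M N\<^esub> z)"
      unfolding ab(2,4) c(2) using ab(1,3) c(1) by (simp only: quot_mod_add M.a_closed M.a_assoc)
  qed
next
  fix c x assume c: "c \<in> carrier K" and "x \<in> carrier (quot_mod M N)"
  then obtain a where a: "a \<in> carrier M" "x = N +>\<^bsub>M\<^esub> a" by (elim quot_modE)
  show "c \<odot>\<^bsub>quot_mod M N\<^esub> x \<in> carrier (quot_mod M N)"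
    unfolding a(2) quot_mod_smult[OF c a(1)] by (rule quot_mod_closed) (use a c in simp)
  fix d assume d: "d \<in> carrier K"
  show "(c \<oplus>\<^bsub>K\<^esub> d) \<odot>\<^bsub>quot_mod M N\<^esub> x = c \<odot>\<^bsub>quot_mod M N\<^esub> x \<oplus>\<^bsub>quot_mod M N\<^esub> d \<odot>\<^bsub>quot_mod M N\<^esub> x"
    unfolding a(2) using a(1) c d
    by (simp only: quot_mod_add quot_mod_smult M.R.a_closed M.smult_closed M.smult_l_distr)
  show "(c \<otimes>\<^bsub>K\<^esub> d) \<odot>\<^bsub>quot_mod M N\<^esub> x = c \<odot>\<^bsub>quot_mod M N\<^esub> (d \<odot>\<^bsub>quot_mod M N\<^esub> x)"
    unfolding a(2) using a(1) c d
    by (simp only: quot_mod_smult M.R.m_closed M.smult_closed M.smult_assoc1)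
  fix y assume "y \<in> carrier (quot_mod M N)"
  then obtain b where b: "b \<in> carrier M" "y = N +>\<^bsub>M\<^esub> b" by (elim quot_modE)
  show "c \<odot>\<^bsub>quot_mod M N\<^esub> (x \<oplus>\<^bsub>quot_mod M N\<^esub> y) = c \<odot>\<^bsub>quot_mod M N\<^esub> x \<oplus>\<^bsub>quot_mod M N\<^esub> c \<odot>\<^bsub>quot_mod M N\<^esub> y"
    unfolding a(2) b(2) using a(1) b(1) c
    by (simp only: quot_mod_add quot_mod_smult M.a_closed M.smult_closed M.smult_r_distr)
next
  fix x assume "x \<in> carrier (quot_mod M N)"
  then obtain a where a: "a \<in> carrier M" "x = N +>\<^bsub>M\<^esub> a" by (rule quot_modE)
  show "\<one>\<^bsub>K\<^esub> \<odot>\<^bsub>quot_mod M N\<^esub> x = x"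
    unfolding a(2) quot_mod_smult[OF M.R.one_closed a(1)] using a(1) by simp
qed

lemma linear_map_coset: "linear_map K M (quot_mod M N) (\<lambda>a. N +>\<^bsub>M\<^esub> a)"
  by (rule linear_mapI) (simp_all add: quot_mod_closed quot_mod_add quot_mod_smult)

end

text \<open>A union over representatives, the same shape as in \<open>tsu\<close> and in each layer
  of \<open>psi\<close>, so that both can be treated as instances by unfolding.\<close>

definition quot_map ::
  "('k, 'b, 'm) module_scheme \<Rightarrow> 'b set \<Rightarrow> ('a \<Rightarrow> 'b) \<Rightarrow> 'a set \<Rightarrow> 'b set" where
  "quot_map L J f A = (\<Union>a\<in>A. J +>\<^bsub>L\<^esub> f a)"

lemma quot_map_coset:
  assumes M: "module K M" "submodule N K M" and L: "module K L" "submodule J K L"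
    and f: "linear_map K M L f" "\<And>x. x \<in> N \<Longrightarrow> f x \<in> J" and a: "a \<in> carrier M"
  shows "quot_map L J f (N +>\<^bsub>M\<^esub> a) = J +>\<^bsub>L\<^esub> f a"
  unfolding quot_map_def
proof (rule coset_UN[OF M a])
  fix b assume b: "b \<in> carrier M" "b \<ominus>\<^bsub>M\<^esub> a \<in> N"
  then have "f b \<ominus>\<^bsub>L\<^esub> f a \<in> J"
    using f(2) a linear_map_minus[OF M(1) L(1) f(1)] by metis
  then show "J +>\<^bsub>L\<^esub> f b = J +>\<^bsub>L\<^esub> f a"
    using coset_eq_iff[OF L] linear_map_closed[OF f(1)] a b by simp
qed

lemma linear_map_quot_map:
  assumes M: "module K M" "submodule N K M" and L: "module K L" "submodule J K L"
    and f: "linear_map K M L f" "\<And>x. x \<in> N \<Longrightarrow> f x \<in> J"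
  shows "linear_map K (quot_mod M N) (quot_mod L J) (quot_map L J f)"
proof -
  interpret M: module K M by (fact M)
  have c: "quot_map L J f (N +>\<^bsub>M\<^esub> a) = J +>\<^bsub>L\<^esub> f a" if "a \<in> carrier M" for a
    using M L f that by (rule quot_map_coset)
  note l = linear_mapD[OF f(1)]
  show ?thesis
  proof (rule linear_mapI)
    fix x assume "x \<in> carrier (quot_mod M N)"
    then obtain a where a: "a \<in> carrier M" "x = N +>\<^bsub>M\<^esub> a" by (rule quot_modE[OF M])
    show "quot_map L J f x \<in> carrier (quot_mod L J)"
      unfolding a(2) c[OF a(1)] by (rule quot_mod_closed[OF L l(1)[OF a(1)]])
    show "quot_map L J f (k \<odot>\<^bsub>quot_mod M N\<^esub> x) = k \<odot>\<^bsub>quot_mod L J\<^esub> quot_map L J f x"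
      if "k \<in> carrier K" for k
      unfolding a(2) using a(1) that
      by (simp only: quot_mod_smult[OF M] quot_mod_smult[OF L] c l M.smult_closed)
    fix y assume "y \<in> carrier (quot_mod M N)"
    then obtain b where b: "b \<in> carrier M" "y = N +>\<^bsub>M\<^esub> b" by (rule quot_modE[OF M])
    show "quot_map L J f (x \<oplus>\<^bsub>quot_mod M N\<^esub> y)
        = quot_map L J f x \<oplus>\<^bsub>quot_mod L J\<^esub> quot_map L J f y"
      unfolding a(2) b(2) using a(1) b(1)
      by (simp only: quot_mod_add[OF M] quot_mod_add[OF L] c l M.a_closed)
  qed
qed

section \<open>Free modules and linear extension\<close>

context
  fixes K :: "('k, 'r) ring_scheme" and X :: "'x set"
  assumes K: "cring K"
begin

interpretation K: cring K by (fact K)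

lemma free_mod_carrier:
  "f \<in> carrier (free_mod K X) \<longleftrightarrow>
    (\<forall>x. f x \<in> carrier K) \<and> (\<forall>x. x \<notin> X \<longrightarrow> f x = \<zero>\<^bsub>K\<^esub>) \<and> finite {x. f x \<noteq> \<zero>\<^bsub>K\<^esub>}"
  by (simp add: free_mod_def)

lemma free_mod_ops:
  shows free_mod_add: "f \<oplus>\<^bsub>free_mod K X\<^esub> g = (\<lambda>x. f x \<oplus>\<^bsub>K\<^esub> g x)"
    and free_mod_smult: "c \<odot>\<^bsub>free_mod K X\<^esub> f = (\<lambda>x. c \<otimes>\<^bsub>K\<^esub> f x)"
    and free_mod_zero: "\<zero>\<^bsub>free_mod K X\<^esub> = (\<lambda>x. \<zero>\<^bsub>K\<^esub>)"
  by (simp_all add: free_mod_def)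

lemma free_mod_module: "module K (free_mod K X)"
proof (rule moduleI)
  have add: "(\<lambda>x. f x \<oplus>\<^bsub>K\<^esub> g x) \<in> carrier (free_mod K X)"
    if "f \<in> carrier (free_mod K X)" "g \<in> carrier (free_mod K X)" for f g
  proof -
    have "{x. f x \<oplus>\<^bsub>K\<^esub> g x \<noteq> \<zero>\<^bsub>K\<^esub>} \<subseteq> {x. f x \<noteq> \<zero>\<^bsub>K\<^esub>} \<union> {x. g x \<noteq> \<zero>\<^bsub>K\<^esub>}"
      using that by (auto simp: free_mod_carrier)
    then have "finite {x. f x \<oplus>\<^bsub>K\<^esub> g x \<noteq> \<zero>\<^bsub>K\<^esub>}"
      by (rule finite_subset) (use that in \<open>simp add: free_mod_carrier\<close>)
    then show ?thesis
      using that by (simp add: free_mod_carrier)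
  qed
  have smult: "(\<lambda>x. c \<otimes>\<^bsub>K\<^esub> f x) \<in> carrier (free_mod K X)"
    if "c \<in> carrier K" "f \<in> carrier (free_mod K X)" for c f
  proof -
    have "{x. c \<otimes>\<^bsub>K\<^esub> f x \<noteq> \<zero>\<^bsub>K\<^esub>} \<subseteq> {x. f x \<noteq> \<zero>\<^bsub>K\<^esub>}"
      using that by (auto simp: free_mod_carrier)
    then have "finite {x. c \<otimes>\<^bsub>K\<^esub> f x \<noteq> \<zero>\<^bsub>K\<^esub>}"
      by (rule finite_subset) (use that in \<open>simp add: free_mod_carrier\<close>)
    then show ?thesis
      using that by (simp add: free_mod_carrier)
  qed
  show "cring K" by (fact K)
  show "abelian_group (free_mod K X)"
  proof (rule abelian_groupI)
    fix f assume f: "f \<in> carrier (free_mod K X)"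
    then have f': "f x \<in> carrier K" for x by (simp add: free_mod_carrier)
    have "(\<lambda>x. (\<ominus>\<^bsub>K\<^esub> \<one>\<^bsub>K\<^esub>) \<otimes>\<^bsub>K\<^esub> f x) \<in> carrier (free_mod K X)"
      by (rule smult) (use f in simp_all)
    moreover have "(\<lambda>x. (\<ominus>\<^bsub>K\<^esub> \<one>\<^bsub>K\<^esub>) \<otimes>\<^bsub>K\<^esub> f x) \<oplus>\<^bsub>free_mod K X\<^esub> f = \<zero>\<^bsub>free_mod K X\<^esub>"
      using f' by (simp add: free_mod_ops K.l_minus K.l_neg)
    ultimately show "\<exists>g\<in>carrier (free_mod K X). g \<oplus>\<^bsub>free_mod K X\<^esub> f = \<zero>\<^bsub>free_mod K X\<^esub>"
      by (intro bexI[of _ "\<lambda>x. (\<ominus>\<^bsub>K\<^esub> \<one>\<^bsub>K\<^esub>) \<otimes>\<^bsub>K\<^esub> f x"])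
    show "\<zero>\<^bsub>free_mod K X\<^esub> \<oplus>\<^bsub>free_mod K X\<^esub> f = f"
      using f' by (simp add: free_mod_ops)
  next
    fix f g h
    assume fgh: "f \<in> carrier (free_mod K X)" "g \<in> carrier (free_mod K X)" "h \<in> carrier (free_mod K X)"
    then show "f \<oplus>\<^bsub>free_mod K X\<^esub> g \<oplus>\<^bsub>free_mod K X\<^esub> h = f \<oplus>\<^bsub>free_mod K X\<^esub> (g \<oplus>\<^bsub>free_mod K X\<^esub> h)"
      by (simp add: free_mod_ops free_mod_carrier K.a_assoc)
  next
    fix f g
    assume fg: "f \<in> carrier (free_mod K X)" "g \<in> carrier (free_mod K X)"
    show "f \<oplus>\<^bsub>free_mod K X\<^esub> g \<in> carrier (free_mod K X)"
      unfolding free_mod_ops by (rule add[OF fg])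
    show "f \<oplus>\<^bsub>free_mod K X\<^esub> g = g \<oplus>\<^bsub>free_mod K X\<^esub> f"
      using fg by (simp add: free_mod_ops free_mod_carrier K.a_comm)
  next
    show "\<zero>\<^bsub>free_mod K X\<^esub> \<in> carrier (free_mod K X)"
      by (simp add: free_mod_ops free_mod_carrier)
  qed
  fix c f assume cf: "c \<in> carrier K" "f \<in> carrier (free_mod K X)"
  show "c \<odot>\<^bsub>free_mod K X\<^esub> f \<in> carrier (free_mod K X)"
    unfolding free_mod_ops by (rule smult[OF cf])
  show "c \<odot>\<^bsub>free_mod K X\<^esub> (f \<oplus>\<^bsub>free_mod K X\<^esub> g)
      = c \<odot>\<^bsub>free_mod K X\<^esub> f \<oplus>\<^bsub>free_mod K X\<^esub> c \<odot>\<^bsub>free_mod K X\<^esub> g"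
    if "g \<in> carrier (free_mod K X)" for g
    using cf that by (simp add: free_mod_ops free_mod_carrier K.r_distr)
  fix d assume d: "d \<in> carrier K"
  show "(c \<oplus>\<^bsub>K\<^esub> d) \<odot>\<^bsub>free_mod K X\<^esub> f = c \<odot>\<^bsub>free_mod K X\<^esub> f \<oplus>\<^bsub>free_mod K X\<^esub> d \<odot>\<^bsub>free_mod K X\<^esub> f"
    "(c \<otimes>\<^bsub>K\<^esub> d) \<odot>\<^bsub>free_mod K X\<^esub> f = c \<odot>\<^bsub>free_mod K X\<^esub> (d \<odot>\<^bsub>free_mod K X\<^esub> f)"
    using cf d by (simp_all add: free_mod_ops free_mod_carrier K.l_distr K.m_assoc)
next
  fix f assume "f \<in> carrier (free_mod K X)"
  then show "\<one>\<^bsub>K\<^esub> \<odot>\<^bsub>free_mod K X\<^esub> f = f"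
    by (simp add: free_mod_ops free_mod_carrier)
qed

lemma basis_vec_closed: "x \<in> X \<Longrightarrow> basis_vec K x \<in> carrier (free_mod K X)"
  by (auto simp: free_mod_carrier basis_vec_def)

interpretation F: module K "free_mod K X" by (fact free_mod_module)

text \<open>Used as an induction principle: a property whose solutions form a submodule holds on the
  whole free module once it holds for basis vectors.\<close>

lemma free_mod_span:
  assumes N: "submodule N K (free_mod K X)" and b: "\<And>x. x \<in> X \<Longrightarrow> basis_vec K x \<in> N"
    and f: "f \<in> carrier (free_mod K X)"
  shows "f \<in> N"
proof -
  \<comment> \<open>The induction is over a finite set containing the support, not over the support
    itself: setting the coordinate \<open>a\<close> to zero gives a function supported in
    \<open>A\<close> whether or not \<open>f a\<close> was zero before.\<close>
  have "f \<in> N" if "finite A" "{x. f x \<noteq> \<zero>\<^bsub>K\<^esub>} \<subseteq> A" "f \<in> carrier (free_mod K X)" for A f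
    using that
  proof (induction A arbitrary: f rule: finite_induct)
    case empty
    then have "f = \<zero>\<^bsub>free_mod K X\<^esub>" by (auto simp: free_mod_ops)
    then show ?case using submodule_zero[OF free_mod_module N] by simp
  next
    case (insert a A)
    have f: "f x \<in> carrier K" for x using insert.prems by (simp add: free_mod_carrier)
    let ?g = "f(a := \<zero>\<^bsub>K\<^esub>)"
    have "{x. ?g x \<noteq> \<zero>\<^bsub>K\<^esub>} \<subseteq> {x. f x \<noteq> \<zero>\<^bsub>K\<^esub>}" by auto
    then have "finite {x. ?g x \<noteq> \<zero>\<^bsub>K\<^esub>}"
      by (rule finite_subset) (use insert.prems(2) in \<open>simp add: free_mod_carrier\<close>)
    then have "?g \<in> carrier (free_mod K X)"
      using insert.prems(2) by (simp add: free_mod_carrier)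
    moreover have "{x. ?g x \<noteq> \<zero>\<^bsub>K\<^esub>} \<subseteq> A" using insert.prems(1) by auto
    ultimately have g: "?g \<in> N" by (rule insert.IH[rotated])
    show ?case
    proof (cases "a \<in> X")
      case True
      have "f = (f a \<odot>\<^bsub>free_mod K X\<^esub> basis_vec K a) \<oplus>\<^bsub>free_mod K X\<^esub> ?g"
        using f by (auto simp: free_mod_ops basis_vec_def fun_eq_iff)
      moreover have "\<dots> \<in> N"
        by (intro submodule_add[OF free_mod_module N] submodule_smult[OF free_mod_module N] b True f g)
      ultimately show ?thesis by simp
    next
      \<comment> \<open>Outside \<open>X\<close> the coordinate is zero already, so deleting it
        changes nothing.\<close>
      case False
      then have "?g = f" using insert.prems(2) by (auto simp: free_mod_carrier fun_eq_iff)
      then show ?thesis using g by simp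
    qed
  qed
  then show ?thesis using f by (auto simp: free_mod_carrier)
qed

lemma free_mod_ext:
  assumes "module K M" "linear_map K (free_mod K X) M g" "linear_map K (free_mod K X) M h"
    and "\<And>x. x \<in> X \<Longrightarrow> g (basis_vec K x) = h (basis_vec K x)" "f \<in> carrier (free_mod K X)"
  shows "g f = h f"
  using free_mod_span[OF submodule_equalizer[OF free_mod_module assms(1-3)]]
    basis_vec_closed assms(4,5) by simp

text \<open>\<open>lin_ext\<close> sums over the support, which varies with \<open>f\<close>. Sums
  for different functions can be compared only over a common finite index set.\<close>

lemma lin_ext_finsum:
  assumes M: "module K M" and h: "\<And>x. x \<in> X \<Longrightarrow> h x \<in> carrier M"
    and f: "f \<in> carrier (free_mod K X)"
    and A: "finite A" "{x. f x \<noteq> \<zero>\<^bsub>K\<^esub>} \<subseteq> A" "A \<subseteq> X"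
  shows "lin_ext K M h f = (\<Oplus>\<^bsub>M\<^esub>x\<in>A. f x \<odot>\<^bsub>M\<^esub> h x)"
proof -
  interpret M: module K M by (fact M)
  show ?thesis
    unfolding lin_ext_def
    by (rule M.add.finprod_mono_neutral_cong_left)
      (use assms f in \<open>auto simp: free_mod_carrier subset_iff\<close>)
qed

lemma lin_ext_linear:
  assumes M: "module K M" and h: "\<And>x. x \<in> X \<Longrightarrow> h x \<in> carrier M"
  shows "linear_map K (free_mod K X) M (lin_ext K M h)"
proof -
  interpret M: module K M by (fact M)
  have supp: "finite {x. f x \<noteq> \<zero>\<^bsub>K\<^esub>}" "{x. f x \<noteq> \<zero>\<^bsub>K\<^esub>} \<subseteq> X" "\<And>x. f x \<in> carrier K"
    if "f \<in> carrier (free_mod K X)" for f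
    using that by (auto simp: free_mod_carrier)
  note E = lin_ext_finsum[OF M h]
  show ?thesis
  proof (rule linear_mapI)
    fix f assume f: "f \<in> carrier (free_mod K X)"
    note s = supp[OF f]
    show "lin_ext K M h f \<in> carrier M"
      unfolding lin_ext_def using s h by (intro M.M.finsum_closed) (auto simp: subset_iff)
    fix g assume g: "g \<in> carrier (free_mod K X)"
    note t = supp[OF g]
    \<comment> \<open>Cancellation may make the support of the sum smaller than this union, but
      never larger.\<close>
    let ?A = "{x. f x \<noteq> \<zero>\<^bsub>K\<^esub>} \<union> {x. g x \<noteq> \<zero>\<^bsub>K\<^esub>}"
    have A: "finite ?A" "?A \<subseteq> X" using s t by auto
    have hA: "h x \<in> carrier M" if "x \<in> ?A" for x using that A(2) h by blast
    have fg: "(\<lambda>x. f x \<oplus>\<^bsub>K\<^esub> g x) \<in> carrier (free_mod K X)"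
      using F.M.a_closed[OF f g] by (simp add: free_mod_ops)
    have sub: "{x. f x \<oplus>\<^bsub>K\<^esub> g x \<noteq> \<zero>\<^bsub>K\<^esub>} \<subseteq> ?A" using s(3) t(3) by auto
    have "lin_ext K M h (f \<oplus>\<^bsub>free_mod K X\<^esub> g) = (\<Oplus>\<^bsub>M\<^esub>x\<in>?A. (f x \<oplus>\<^bsub>K\<^esub> g x) \<odot>\<^bsub>M\<^esub> h x)"
      unfolding free_mod_ops by (rule E[OF _ fg A(1) sub A(2)])
    also have "\<dots> = (\<Oplus>\<^bsub>M\<^esub>x\<in>?A. (f x \<odot>\<^bsub>M\<^esub> h x) \<oplus>\<^bsub>M\<^esub> (g x \<odot>\<^bsub>M\<^esub> h x))"
      using hA s(3) t(3) by (intro M.M.finsum_cong') (simp_all add: M.smult_l_distr)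
    also have "\<dots> = (\<Oplus>\<^bsub>M\<^esub>x\<in>?A. f x \<odot>\<^bsub>M\<^esub> h x) \<oplus>\<^bsub>M\<^esub> (\<Oplus>\<^bsub>M\<^esub>x\<in>?A. g x \<odot>\<^bsub>M\<^esub> h x)"
      using hA s(3) t(3) by (intro M.M.finsum_addf) simp_all
    also have "(\<Oplus>\<^bsub>M\<^esub>x\<in>?A. f x \<odot>\<^bsub>M\<^esub> h x) = lin_ext K M h f"
      by (rule E[OF _ f A(1) _ A(2), symmetric]) auto
    also have "(\<Oplus>\<^bsub>M\<^esub>x\<in>?A. g x \<odot>\<^bsub>M\<^esub> h x) = lin_ext K M h g"
      by (rule E[OF _ g A(1) _ A(2), symmetric]) auto
    finally show "lin_ext K M h (f \<oplus>\<^bsub>free_mod K X\<^esub> g) = lin_ext K M h f \<oplus>\<^bsub>M\<^esub> lin_ext K M h g" .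
  next
    fix c f assume c: "c \<in> carrier K" and f: "f \<in> carrier (free_mod K X)"
    note s = supp[OF f]
    have cf: "(\<lambda>x. c \<otimes>\<^bsub>K\<^esub> f x) \<in> carrier (free_mod K X)"
      using F.smult_closed[OF c f] by (simp add: free_mod_ops)
    have sub: "{x. c \<otimes>\<^bsub>K\<^esub> f x \<noteq> \<zero>\<^bsub>K\<^esub>} \<subseteq> {x. f x \<noteq> \<zero>\<^bsub>K\<^esub>}" using c by auto
    have hA: "h x \<in> carrier M" if "x \<in> {x. f x \<noteq> \<zero>\<^bsub>K\<^esub>}" for x using that s(2) h by blast
    have "lin_ext K M h (c \<odot>\<^bsub>free_mod K X\<^esub> f) = (\<Oplus>\<^bsub>M\<^esub>x\<in>{x. f x \<noteq> \<zero>\<^bsub>K\<^esub>}. (c \<otimes>\<^bsub>K\<^esub> f x) \<odot>\<^bsub>M\<^esub> h x)"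
      unfolding free_mod_ops by (rule E[OF _ cf s(1) sub s(2)])
    also have "\<dots> = (\<Oplus>\<^bsub>M\<^esub>x\<in>{x. f x \<noteq> \<zero>\<^bsub>K\<^esub>}. c \<odot>\<^bsub>M\<^esub> (f x \<odot>\<^bsub>M\<^esub> h x))"
      using hA s(3) c by (intro M.M.finsum_cong') (simp_all add: M.smult_assoc1)
    also have "\<dots> = c \<odot>\<^bsub>M\<^esub> lin_ext K M h f"
      unfolding lin_ext_def using hA s(1,3) c by (intro M.finsum_smult_ldistr[symmetric]) simp_all
    finally show "lin_ext K M h (c \<odot>\<^bsub>free_mod K X\<^esub> f) = c \<odot>\<^bsub>M\<^esub> lin_ext K M h f" .
  qed
qed

lemma lin_ext_basis_vec:
  assumes M: "module K M" and h: "\<And>x. x \<in> X \<Longrightarrow> h x \<in> carrier M" and x: "x \<in> X"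
  shows "lin_ext K M h (basis_vec K x) = h x"
proof -
  interpret M: module K M by (fact M)
  \<comment> \<open>Summing over \<open>{x}\<close> avoids deciding whether the support of the basis
    vector is all of \<open>{x}\<close>, that is, whether one differs from zero.\<close>
  have "lin_ext K M h (basis_vec K x) = (\<Oplus>\<^bsub>M\<^esub>y\<in>{x}. basis_vec K x y \<odot>\<^bsub>M\<^esub> h y)"
    by (rule lin_ext_finsum[OF M h basis_vec_closed[OF x]])
      (use x in \<open>auto simp: basis_vec_def\<close>)
  also have "\<dots> = h x" using h[OF x] by (simp add: basis_vec_def)
  finally show ?thesis .
qed

end

section \<open>Ideals, quotients and morphisms of operads\<close>

declare One_nat_def [simp del] \<comment> \<open>keeps arities in the form \<open>m + n - 1\<close> of the operad axioms\<close>

definition ns_hom ::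
  "('k, 'r) ring_scheme \<Rightarrow> ('k, 'a) ns_op \<Rightarrow> ('k, 'b) ns_op \<Rightarrow> (nat \<Rightarrow> 'a \<Rightarrow> 'b) \<Rightarrow> bool" where
  "ns_hom K P Q \<phi> \<longleftrightarrow>
    (\<forall>n. linear_map K (component P n) (component Q n) (\<phi> n))
    \<and> \<phi> 1 (idop P) = idop Q
    \<and> (\<forall>m n i. 1 \<le> i \<and> i \<le> m \<longrightarrow>
        (\<forall>a\<in>carrier (component P m). \<forall>b\<in>carrier (component P n).
           \<phi> (m + n - 1) (pcomp P m n i a b) = pcomp Q m n i (\<phi> m a) (\<phi> n b)))"

lemma ns_homD:
  assumes "ns_hom K P Q \<phi>"
  shows ns_hom_linear: "linear_map K (component P n) (component Q n) (\<phi> n)"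
    and ns_hom_idop: "\<phi> 1 (idop P) = idop Q"
    and ns_hom_pcomp: "1 \<le> i \<Longrightarrow> i \<le> m \<Longrightarrow> a \<in> carrier (component P m)
      \<Longrightarrow> b \<in> carrier (component P n)
      \<Longrightarrow> \<phi> (m + n - 1) (pcomp P m n i a b) = pcomp Q m n i (\<phi> m a) (\<phi> n b)"
  using assms by (auto simp: ns_hom_def)

text \<open>A pair of mutually inverse morphisms passes to quotients without an argument about
  bijectivity on cosets, and the inverse is at hand when relations have to be carried back.\<close>

definition ns_iso_pair ::
  "('k, 'r) ring_scheme \<Rightarrow> ('k, 'a) ns_op \<Rightarrow> ('k, 'b) ns_op \<Rightarrow> (nat \<Rightarrow> 'a \<Rightarrow> 'b)
    \<Rightarrow> (nat \<Rightarrow> 'b \<Rightarrow> 'a) \<Rightarrow> bool" where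
  "ns_iso_pair K P Q \<phi> \<psi> \<longleftrightarrow> ns_hom K P Q \<phi> \<and> ns_hom K Q P \<psi>
    \<and> (\<forall>n. \<forall>a\<in>carrier (component P n). \<psi> n (\<phi> n a) = a)
    \<and> (\<forall>n. \<forall>b\<in>carrier (component Q n). \<phi> n (\<psi> n b) = b)"

lemma ns_iso_pair_isos:
  assumes "ns_iso_pair K P Q \<phi> \<psi>"
  shows "\<phi> \<in> ns_isos K P Q"
proof -
  have h: "ns_hom K P Q \<phi>" "ns_hom K Q P \<psi>"
    and inv: "\<And>n a. a \<in> carrier (component P n) \<Longrightarrow> \<psi> n (\<phi> n a) = a"
      "\<And>n b. b \<in> carrier (component Q n) \<Longrightarrow> \<phi> n (\<psi> n b) = b"
    using assms by (auto simp: ns_iso_pair_def)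
  have "bij_betw (\<phi> n) (carrier (component P n)) (carrier (component Q n))" for n
    by (rule bij_betw_byWitness[where f' = "\<psi> n"])
      (use inv linear_map_closed[OF ns_hom_linear[OF h(1)]]
        linear_map_closed[OF ns_hom_linear[OF h(2)]] in auto)
  then have "\<phi> n \<in> iso (add_monoid (component P n)) (add_monoid (component Q n))" for n
    using linear_mapD[OF ns_hom_linear[OF h(1)]] by (auto simp: iso_def hom_def)
  then show ?thesis
    using h(1) by (auto simp: ns_isos_def ns_hom_def intro: linear_map_smult)
qed

section \<open>Operadic ideals\<close>

lemma ns_ideal_submodule: "ns_ideal K P I \<Longrightarrow> submodule (I n) K (component P n)"
  by (simp add: ns_ideal_def)

lemma ns_ideal_pcomp_left:
  "\<lbrakk>ns_ideal K P I; 1 \<le> i; i \<le> m; a \<in> I m; b \<in> carrier (component P n)\<rbrakk>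
    \<Longrightarrow> pcomp P m n i a b \<in> I (m + n - 1)"
  by (simp add: ns_ideal_def)

lemma ns_ideal_pcomp_right:
  "\<lbrakk>ns_ideal K P I; 1 \<le> i; i \<le> m; a \<in> carrier (component P m); b \<in> I n\<rbrakk>
    \<Longrightarrow> pcomp P m n i a b \<in> I (m + n - 1)"
  by (simp add: ns_ideal_def)

context ns_operad
begin

lemma linear_map_pcomp_left:
  assumes "1 \<le> i" "i \<le> m" "b \<in> carrier (component P n)"
  shows "linear_map K (component P m) (component P (m + n - 1)) (\<lambda>a. pcomp P m n i a b)"
  using assms by (intro linear_mapI) (simp_all add: pcomp_closed pcomp_add_left pcomp_smult_left)

lemma linear_map_pcomp_right:
  assumes "1 \<le> i" "i \<le> m" "a \<in> carrier (component P m)"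
  shows "linear_map K (component P n) (component P (m + n - 1)) (pcomp P m n i a)"
  using assms by (intro linear_mapI) (simp_all add: pcomp_closed pcomp_add_right pcomp_smult_right)

lemma ns_ideal_carrier: "ns_ideal K P (\<lambda>n. carrier (component P n))"
  by (simp add: ns_ideal_def pcomp_closed module.carrier_is_submodule component_module)

text \<open>The whole operad is an ideal containing \<open>S\<close>, so the intersection is over a
  nonempty family; each closure property then passes from the members to the intersection.\<close>

lemma gen_ideal_ideal:
  assumes S: "S \<subseteq> carrier (component P r)"
  shows "ns_ideal K P (gen_ideal K P r S)"
  unfolding ns_ideal_def
proof (intro conjI allI impI)
  have mem: "a \<in> gen_ideal K P r S n \<longleftrightarrow> (\<forall>I. ns_ideal K P I \<and> S \<subseteq> I r \<longrightarrow> a \<in> I n)" for a n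
    by (auto simp: gen_ideal_def)
  show "submodule (gen_ideal K P r S n) K (component P n)" for n
    unfolding gen_ideal_def
    by (rule submodule_Inter[OF component_module])
      (use S ns_ideal_carrier in \<open>auto intro: ns_ideal_submodule\<close>)
  show "pcomp P m n i a b \<in> gen_ideal K P r S (m + n - 1)"
    if "1 \<le> i \<and> i \<le> m \<and> a \<in> gen_ideal K P r S m \<and> b \<in> carrier (component P n)" for m n i a b
    using that unfolding mem by (auto intro: ns_ideal_pcomp_left)
  show "pcomp P m n i a b \<in> gen_ideal K P r S (m + n - 1)"
    if "1 \<le> i \<and> i \<le> m \<and> a \<in> carrier (component P m) \<and> b \<in> gen_ideal K P r S n" for m n i a b
    using that unfolding mem by (auto intro: ns_ideal_pcomp_right)
qed

end

lemma gen_ideal_incl: "S \<subseteq> gen_ideal K P r S r"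
  by (auto simp: gen_ideal_def)

lemma gen_ideal_least: "ns_ideal K P I \<Longrightarrow> S \<subseteq> I r \<Longrightarrow> gen_ideal K P r S n \<subseteq> I n"
  by (auto simp: gen_ideal_def)

text \<open>Makes it enough to test a morphism on the generators of an ideal: the preimage of the
  target ideal is an ideal containing them, hence contains everything they generate, in all arities.
  \<open>gen_ideal_image\<close> is this conclusion.\<close>

lemma ns_ideal_vimage:
  assumes P: "ns_operad K P" and Q: "ns_operad K Q" and \<phi>: "ns_hom K P Q \<phi>" and J: "ns_ideal K Q J"
  shows "ns_ideal K P (\<lambda>n. {a \<in> carrier (component P n). \<phi> n a \<in> J n})"
  unfolding ns_ideal_def
proof (intro conjI allI impI)
  note closed = linear_map_closed[OF ns_hom_linear[OF \<phi>]]
  show "submodule {a \<in> carrier (component P n). \<phi> n a \<in> J n} K (component P n)" for n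
    using ns_operad.component_module[OF P] ns_operad.component_module[OF Q]
      ns_hom_linear[OF \<phi>] ns_ideal_submodule[OF J]
    by (rule submodule_vimage)
  show "pcomp P m n i a b \<in> {a \<in> carrier (component P (m + n - 1)). \<phi> (m + n - 1) a \<in> J (m + n - 1)}"
    if "1 \<le> i \<and> i \<le> m \<and> a \<in> {a \<in> carrier (component P m). \<phi> m a \<in> J m}
      \<and> b \<in> carrier (component P n)" for m n i a b
    using that
    by (simp add: ns_operad.pcomp_closed[OF P] ns_hom_pcomp[OF \<phi>] ns_ideal_pcomp_left[OF J] closed)
  show "pcomp P m n i a b \<in> {a \<in> carrier (component P (m + n - 1)). \<phi> (m + n - 1) a \<in> J (m + n - 1)}"
    if "1 \<le> i \<and> i \<le> m \<and> a \<in> carrier (component P m)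
      \<and> b \<in> {a \<in> carrier (component P n). \<phi> n a \<in> J n}" for m n i a b
    using that
    by (simp add: ns_operad.pcomp_closed[OF P] ns_hom_pcomp[OF \<phi>] ns_ideal_pcomp_right[OF J] closed)
qed

lemma gen_ideal_image:
  assumes P: "ns_operad K P" and Q: "ns_operad K Q" and \<phi>: "ns_hom K P Q \<phi>" and J: "ns_ideal K Q J"
    and S: "S \<subseteq> carrier (component P r)" "\<And>s. s \<in> S \<Longrightarrow> \<phi> r s \<in> J r"
    and a: "a \<in> gen_ideal K P r S n"
  shows "\<phi> n a \<in> J n"
  using gen_ideal_least[OF ns_ideal_vimage[OF P Q \<phi> J], of S r n] S a by auto

section \<open>The quotient of an operad by an ideal\<close>

context
  fixes K :: "('k, 'r) ring_scheme" and P :: "('k, 'a) ns_op" and I :: "nat \<Rightarrow> 'a set"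
  assumes P: "ns_operad K P" and I: "ns_ideal K P I"
begin

interpretation P: ns_operad K P by (fact P)

private lemma comp_ideal:
  "module K (component P n)" "submodule (I n) K (component P n)"
  by (fact P.component_module, fact ns_ideal_submodule[OF I])

lemma quot_op_component: "component (quot_op P I) n = quot_mod (component P n) (I n)"
  by (simp add: quot_op_def)

lemma quot_op_pcomp:
  assumes i: "1 \<le> i" "i \<le> m"
    and a: "a \<in> carrier (component P m)" and b: "b \<in> carrier (component P n)"
  shows "pcomp (quot_op P I) m n i (I m +>\<^bsub>component P m\<^esub> a) (I n +>\<^bsub>component P n\<^esub> b)
    = I (m + n - 1) +>\<^bsub>component P (m + n - 1)\<^esub> pcomp P m n i a b"
proof -
  let ?q = "\<lambda>a b. I (m + n - 1) +>\<^bsub>component P (m + n - 1)\<^esub> pcomp P m n i a b"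
  \<comment> \<open>Only one representative changes at a time. By linearity in that slot the
    difference of the two composites is a composite with a factor in the ideal.\<close>
  have eq: "?q a' b' = ?q a b" if ab: "a \<in> carrier (component P m)" "b \<in> carrier (component P n)"
    "a' \<in> carrier (component P m)" "b' \<in> carrier (component P n)"
    "a' \<ominus>\<^bsub>component P m\<^esub> a \<in> I m \<and> b' = b \<or> b' \<ominus>\<^bsub>component P n\<^esub> b \<in> I n \<and> a' = a" for a b a' b'
  proof -
    have "pcomp P m n i a' b' \<ominus>\<^bsub>component P (m + n - 1)\<^esub> pcomp P m n i a b \<in> I (m + n - 1)"
      using ab(5)
    proof (elim disjE conjE)
      assume *: "a' \<ominus>\<^bsub>component P m\<^esub> a \<in> I m" "b' = b"
      have "pcomp P m n i (a' \<ominus>\<^bsub>component P m\<^esub> a) b \<in> I (m + n - 1)"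
        by (rule ns_ideal_pcomp_left[OF I i *(1) ab(2)])
      then show ?thesis
        unfolding *(2) linear_map_minus[OF comp_ideal(1) comp_ideal(1)
          P.linear_map_pcomp_left[OF i ab(2)] ab(3,1)] .
    next
      assume *: "b' \<ominus>\<^bsub>component P n\<^esub> b \<in> I n" "a' = a"
      have "pcomp P m n i a (b' \<ominus>\<^bsub>component P n\<^esub> b) \<in> I (m + n - 1)"
        by (rule ns_ideal_pcomp_right[OF I i ab(1) *(1)])
      then show ?thesis
        unfolding *(2) linear_map_minus[OF comp_ideal(1) comp_ideal(1)
          P.linear_map_pcomp_right[OF i ab(1)] ab(4,2)] .
    qed
    then show ?thesis
      using coset_eq_iff[OF comp_ideal] P.pcomp_closed[OF i] ab by simp
  qed
  have inner: "(\<Union>b\<in>I n +>\<^bsub>component P n\<^esub> b. ?q a' b) = ?q a' b"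
    if "a' \<in> carrier (component P m)" for a'
    by (rule coset_UN[OF comp_ideal b]) (rule eq, use that b in simp_all)
  \<comment> \<open>The inner union is collapsed for every representative of the outer coset first,
    so that the outer one again has the form required by \<open>coset_UN\<close>.\<close>
  have "(\<Union>a\<in>I m +>\<^bsub>component P m\<^esub> a. \<Union>b\<in>I n +>\<^bsub>component P n\<^esub> b. ?q a b)
      = (\<Union>b\<in>I n +>\<^bsub>component P n\<^esub> b. ?q a b)"
    by (rule coset_UN[OF comp_ideal a]) (simp only: inner a, rule eq, use a b in simp_all)
  then show ?thesis by (simp only: quot_op_def ns_op.simps inner[OF a])
qed

lemma quot_op_idop: "idop (quot_op P I) = I 1 +>\<^bsub>component P 1\<^esub> idop P"
  by (simp add: quot_op_def)

lemma quot_opE: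
  assumes "A \<in> carrier (component (quot_op P I) n)"
  obtains a where "a \<in> carrier (component P n)" "A = I n +>\<^bsub>component P n\<^esub> a"
  using assms quot_modE[OF comp_ideal] unfolding quot_op_component by blast

lemma quot_op_closed:
  "a \<in> carrier (component P n) \<Longrightarrow> I n +>\<^bsub>component P n\<^esub> a \<in> carrier (component (quot_op P I) n)"
  unfolding quot_op_component by (rule quot_mod_closed[OF comp_ideal])

lemma quot_op_add:
  "a \<in> carrier (component P n) \<Longrightarrow> b \<in> carrier (component P n)
    \<Longrightarrow> (I n +>\<^bsub>component P n\<^esub> a) \<oplus>\<^bsub>component (quot_op P I) n\<^esub> (I n +>\<^bsub>component P n\<^esub> b)
      = I n +>\<^bsub>component P n\<^esub> (a \<oplus>\<^bsub>component P n\<^esub> b)"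
  unfolding quot_op_component by (rule quot_mod_add[OF comp_ideal])

lemma quot_op_smult:
  "c \<in> carrier K \<Longrightarrow> a \<in> carrier (component P n)
    \<Longrightarrow> c \<odot>\<^bsub>component (quot_op P I) n\<^esub> (I n +>\<^bsub>component P n\<^esub> a)
      = I n +>\<^bsub>component P n\<^esub> (c \<odot>\<^bsub>component P n\<^esub> a)"
  unfolding quot_op_component by (rule quot_mod_smult[OF comp_ideal])

lemma quot_op_operad: "ns_operad K (quot_op P I)"
proof (rule ns_operad.intro)
  note pc = P.pcomp_closed and ops = quot_op_pcomp quot_op_add quot_op_smult
  interpret M: module K "component P n" for n by (fact comp_ideal)
  show "module K (component (quot_op P I) n)" for n
    unfolding quot_op_component by (rule quot_mod_module[OF comp_ideal])
  show "idop (quot_op P I) \<in> carrier (component (quot_op P I) 1)"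
    unfolding quot_op_idop by (rule quot_op_closed[OF P.idop_closed])
  {
    fix m n i :: nat and A B
    assume i: "1 \<le> i" "i \<le> m" and A: "A \<in> carrier (component (quot_op P I) m)"
      and B: "B \<in> carrier (component (quot_op P I) n)"
    obtain a where a: "a \<in> carrier (component P m)" "A = I m +>\<^bsub>component P m\<^esub> a"
      using A by (rule quot_opE)
    obtain b where b: "b \<in> carrier (component P n)" "B = I n +>\<^bsub>component P n\<^esub> b"
      using B by (rule quot_opE)
    show "pcomp (quot_op P I) m n i A B \<in> carrier (component (quot_op P I) (m + n - 1))"
      unfolding a(2) b(2) quot_op_pcomp[OF i a(1) b(1)]
      by (rule quot_op_closed[OF pc[OF i a(1) b(1)]])
    {
      fix c assume c: "c \<in> carrier K"
      show "pcomp (quot_op P I) m n i (c \<odot>\<^bsub>component (quot_op P I) m\<^esub> A) B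
          = c \<odot>\<^bsub>component (quot_op P I) (m + n - 1)\<^esub> pcomp (quot_op P I) m n i A B"
        unfolding a(2) b(2) using i a(1) b(1) c
        by (simp only: ops pc M.smult_closed P.pcomp_smult_left)
      show "pcomp (quot_op P I) m n i A (c \<odot>\<^bsub>component (quot_op P I) n\<^esub> B)
          = c \<odot>\<^bsub>component (quot_op P I) (m + n - 1)\<^esub> pcomp (quot_op P I) m n i A B"
        unfolding a(2) b(2) using i a(1) b(1) c
        by (simp only: ops pc M.smult_closed P.pcomp_smult_right)
    next
      fix A' assume "A' \<in> carrier (component (quot_op P I) m)"
      then obtain a' where a': "a' \<in> carrier (component P m)" "A' = I m +>\<^bsub>component P m\<^esub> a'"
        by (rule quot_opE)
      show "pcomp (quot_op P I) m n i (A \<oplus>\<^bsub>component (quot_op P I) m\<^esub> A') B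
          = pcomp (quot_op P I) m n i A B \<oplus>\<^bsub>component (quot_op P I) (m + n - 1)\<^esub>
            pcomp (quot_op P I) m n i A' B"
        unfolding a(2) b(2) a'(2) using i a(1) b(1) a'(1)
        by (simp only: ops pc M.M.a_closed P.pcomp_add_left)
    next
      fix B' assume "B' \<in> carrier (component (quot_op P I) n)"
      then obtain b' where b': "b' \<in> carrier (component P n)" "B' = I n +>\<^bsub>component P n\<^esub> b'"
        by (rule quot_opE)
      show "pcomp (quot_op P I) m n i A (B \<oplus>\<^bsub>component (quot_op P I) n\<^esub> B')
          = pcomp (quot_op P I) m n i A B \<oplus>\<^bsub>component (quot_op P I) (m + n - 1)\<^esub>
            pcomp (quot_op P I) m n i A B'"
        unfolding a(2) b(2) b'(2) using i a(1) b(1) b'(1)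
        by (simp only: ops pc M.M.a_closed P.pcomp_add_right)
    }
  }
  {
    fix n B assume "B \<in> carrier (component (quot_op P I) n)"
    then obtain b where b: "b \<in> carrier (component P n)" "B = I n +>\<^bsub>component P n\<^esub> b"
      by (rule quot_opE)
    show "pcomp (quot_op P I) 1 n 1 (idop (quot_op P I)) B = B"
      unfolding b(2) quot_op_idop quot_op_pcomp[OF order_refl order_refl P.idop_closed b(1)]
        P.idop_left[OF b(1)] by simp
    fix i assume i: "1 \<le> i" "i \<le> n"
    show "pcomp (quot_op P I) n 1 i B (idop (quot_op P I)) = B"
      unfolding b(2) quot_op_idop quot_op_pcomp[OF i b(1) P.idop_closed]
        P.idop_right[OF i b(1)] by simp
  }
  {
    fix l m n i :: nat and A B C
    assume i: "1 \<le> i" and A: "A \<in> carrier (component (quot_op P I) l)"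
      and B: "B \<in> carrier (component (quot_op P I) m)" and C: "C \<in> carrier (component (quot_op P I) n)"
    obtain a where a: "a \<in> carrier (component P l)" "A = I l +>\<^bsub>component P l\<^esub> a"
      using A by (rule quot_opE)
    obtain b where b: "b \<in> carrier (component P m)" "B = I m +>\<^bsub>component P m\<^esub> b"
      using B by (rule quot_opE)
    obtain c where c: "c \<in> carrier (component P n)" "C = I n +>\<^bsub>component P n\<^esub> c"
      using C by (rule quot_opE)
    {
      fix j assume j: "i \<le> l" "1 \<le> j" "j \<le> m"
      \<comment> \<open>The two sides of the axiom carry differently written arities. They agree
        because \<open>l\<close> and \<open>m\<close> are positive, which keeps the truncated
        subtractions exact.\<close>
      have r: "1 \<le> i - 1 + j" "i - 1 + j \<le> l + m - 1" "i \<le> l"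
        "l + m - 1 + n - 1 = l + (m + n - 1) - 1"
        using i j by auto
      show "pcomp (quot_op P I) (l + m - 1) n (i - 1 + j) (pcomp (quot_op P I) l m i A B) C
          = pcomp (quot_op P I) l (m + n - 1) i A (pcomp (quot_op P I) m n j B C)"
        unfolding a(2) b(2) c(2) quot_op_pcomp[OF i r(3) a(1) b(1)] quot_op_pcomp[OF j(2,3) b(1) c(1)]
          quot_op_pcomp[OF r(1,2) pc[OF i r(3) a(1) b(1)] c(1)]
          quot_op_pcomp[OF i r(3) a(1) pc[OF j(2,3) b(1) c(1)]]
          P.sequential[OF i j a(1) b(1) c(1)] r(4) ..
    next
      fix k assume k: "i < k" "k \<le> l"
      have r: "1 \<le> k - 1 + m" "k - 1 + m \<le> l + m - 1" "1 \<le> k" "i \<le> l" "i \<le> l + n - 1"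
        "l + m - 1 + n - 1 = l + n - 1 + m - 1"
        using i k by auto
      show "pcomp (quot_op P I) (l + m - 1) n (k - 1 + m) (pcomp (quot_op P I) l m i A B) C
          = pcomp (quot_op P I) (l + n - 1) m i (pcomp (quot_op P I) l n k A C) B"
        unfolding a(2) b(2) c(2) quot_op_pcomp[OF i r(4) a(1) b(1)] quot_op_pcomp[OF r(3) k(2) a(1) c(1)]
          quot_op_pcomp[OF r(1,2) pc[OF i r(4) a(1) b(1)] c(1)]
          quot_op_pcomp[OF i r(5) pc[OF r(3) k(2) a(1) c(1)] b(1)]
          P.parallel[OF i k a(1) b(1) c(1)] r(6) ..
    }
  }
qed

end

text \<open>Each morphism has to map its ideal into the other one; the two inclusions together make
  the induced maps mutually inverse on cosets.\<close>

lemma ns_iso_pair_quot: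
  assumes P: "ns_operad K P" "ns_ideal K P I" and Q: "ns_operad K Q" "ns_ideal K Q J"
    and iso: "ns_iso_pair K P Q \<phi> \<psi>"
    and \<phi>: "\<And>n a. a \<in> I n \<Longrightarrow> \<phi> n a \<in> J n" and \<psi>: "\<And>n a. a \<in> J n \<Longrightarrow> \<psi> n a \<in> I n"
  shows "ns_iso_pair K (quot_op P I) (quot_op Q J)
    (\<lambda>n. quot_map (component Q n) (J n) (\<phi> n)) (\<lambda>n. quot_map (component P n) (I n) (\<psi> n))"
proof -
  \<comment> \<open>Stated for arbitrary operads, ideals and morphisms, and polymorphic in the
    element types, so that it serves \<phi> and \<psi> alike.\<close>
  have hom: "ns_hom K (quot_op P I) (quot_op Q J) (\<lambda>n. quot_map (component Q n) (J n) (\<phi> n))"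
    and coset: "\<And>n a. a \<in> carrier (component P n) \<Longrightarrow>
      quot_map (component Q n) (J n) (\<phi> n) (I n +>\<^bsub>component P n\<^esub> a) = J n +>\<^bsub>component Q n\<^esub> \<phi> n a"
    if P: "ns_operad K P" "ns_ideal K P I" and Q: "ns_operad K Q" "ns_ideal K Q J"
      and h: "ns_hom K P Q \<phi>" and \<phi>: "\<And>n a. a \<in> I n \<Longrightarrow> \<phi> n a \<in> J n"
    for P :: "('a, 'x) ns_op" and Q :: "('a, 'y) ns_op" and I J \<phi>
  proof -
    note l = ns_hom_linear[OF h]
    note pm = ns_operad.component_module[OF P(1)] ns_ideal_submodule[OF P(2)]
    note qm = ns_operad.component_module[OF Q(1)] ns_ideal_submodule[OF Q(2)]
    show coset: "quot_map (component Q n) (J n) (\<phi> n) (I n +>\<^bsub>component P n\<^esub> a)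
        = J n +>\<^bsub>component Q n\<^esub> \<phi> n a" if "a \<in> carrier (component P n)" for n a
      using pm qm l \<phi> that by (rule quot_map_coset)
    show "ns_hom K (quot_op P I) (quot_op Q J) (\<lambda>n. quot_map (component Q n) (J n) (\<phi> n))"
      unfolding ns_hom_def
    proof (intro conjI allI impI ballI)
      show "linear_map K (component (quot_op P I) n) (component (quot_op Q J) n)
          (quot_map (component Q n) (J n) (\<phi> n))" for n
        unfolding quot_op_component[OF P] quot_op_component[OF Q]
        using pm qm l \<phi> by (rule linear_map_quot_map)
      show "quot_map (component Q 1) (J 1) (\<phi> 1) (idop (quot_op P I)) = idop (quot_op Q J)"
        unfolding quot_op_idop[OF P] quot_op_idop[OF Q] coset[OF ns_operad.idop_closed[OF P(1)]]
          ns_hom_idop[OF h] ..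
      fix m n i A B
      assume "1 \<le> i \<and> i \<le> m" and A: "A \<in> carrier (component (quot_op P I) m)"
        and B: "B \<in> carrier (component (quot_op P I) n)"
      then have i: "1 \<le> i" "i \<le> m" by auto
      obtain a where a: "a \<in> carrier (component P m)" "A = I m +>\<^bsub>component P m\<^esub> a"
        using A by (rule quot_opE[OF P])
      obtain b where b: "b \<in> carrier (component P n)" "B = I n +>\<^bsub>component P n\<^esub> b"
        using B by (rule quot_opE[OF P])
      show "quot_map (component Q (m + n - 1)) (J (m + n - 1)) (\<phi> (m + n - 1))
            (pcomp (quot_op P I) m n i A B)
          = pcomp (quot_op Q J) m n i (quot_map (component Q m) (J m) (\<phi> m) A)
              (quot_map (component Q n) (J n) (\<phi> n) B)"
        unfolding a(2) b(2) quot_op_pcomp[OF P i a(1) b(1)] coset[OF a(1)] coset[OF b(1)]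
          coset[OF ns_operad.pcomp_closed[OF P(1) i a(1) b(1)]]
          quot_op_pcomp[OF Q i linear_map_closed[OF l a(1)] linear_map_closed[OF l b(1)]]
          ns_hom_pcomp[OF h i a(1) b(1)] ..
    qed
  qed
  have h: "ns_hom K P Q \<phi>" "ns_hom K Q P \<psi>"
    and inv: "\<And>n a. a \<in> carrier (component P n) \<Longrightarrow> \<psi> n (\<phi> n a) = a"
      "\<And>n b. b \<in> carrier (component Q n) \<Longrightarrow> \<phi> n (\<psi> n b) = b"
    using iso by (auto simp: ns_iso_pair_def)
  note closed = linear_map_closed[OF ns_hom_linear[OF h(1)]]
    linear_map_closed[OF ns_hom_linear[OF h(2)]]
  show ?thesis
    unfolding ns_iso_pair_def
  proof (intro conjI allI ballI)
    show "ns_hom K (quot_op P I) (quot_op Q J) (\<lambda>n. quot_map (component Q n) (J n) (\<phi> n))"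
      using P Q h(1) \<phi> by (rule hom)
    show "ns_hom K (quot_op Q J) (quot_op P I) (\<lambda>n. quot_map (component P n) (I n) (\<psi> n))"
      using Q P h(2) \<psi> by (rule hom)
    show "quot_map (component P n) (I n) (\<psi> n) (quot_map (component Q n) (J n) (\<phi> n) A) = A"
      if "A \<in> carrier (component (quot_op P I) n)" for n A
      using that by (rule quot_opE[OF P])
        (simp add: coset[OF P Q h(1) \<phi>] coset[OF Q P h(2) \<psi>] closed inv)
    show "quot_map (component Q n) (J n) (\<phi> n) (quot_map (component P n) (I n) (\<psi> n) A) = A"
      if "A \<in> carrier (component (quot_op Q J) n)" for n A
      using that by (rule quot_opE[OF Q])
        (simp add: coset[OF P Q h(1) \<phi>] coset[OF Q P h(2) \<psi>] closed inv)
  qed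
qed

section \<open>Multilinear maps on free modules\<close>

lemma linear_map_plus:
  assumes "module K N" "linear_map K M N f" "linear_map K M N g"
  shows "linear_map K M N (\<lambda>x. f x \<oplus>\<^bsub>N\<^esub> g x)"
proof -
  interpret N: module K N by fact
  show ?thesis
    by (rule linear_mapI)
      (simp_all add: linear_mapD[OF assms(2)] linear_mapD[OF assms(3)] N.smult_r_distr N.M.a_ac)
qed

lemma linear_map_scale:
  assumes "module K N" "linear_map K M N f" "c \<in> carrier K"
  shows "linear_map K M N (\<lambda>x. c \<odot>\<^bsub>N\<^esub> f x)"
proof -
  interpret N: module K N by fact
  have "c \<odot>\<^bsub>N\<^esub> (d \<odot>\<^bsub>N\<^esub> y) = d \<odot>\<^bsub>N\<^esub> (c \<odot>\<^bsub>N\<^esub> y)" if "d \<in> carrier K" "y \<in> carrier N" for d y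
    using that assms(3) by (simp add: N.smult_assoc1[symmetric] N.R.m_comm)
  then show ?thesis
    using assms(3) by (intro linear_mapI) (simp_all add: linear_mapD[OF assms(2)] N.smult_r_distr)
qed

context
  fixes K :: "('k, 'r) ring_scheme" and X :: "'x set" and Y :: "'y set"
    and M :: "('k, 'a, 'm) module_scheme" and h :: "'x \<Rightarrow> 'y \<Rightarrow> 'a"
  assumes M: "module K M" and h: "\<And>x y. x \<in> X \<Longrightarrow> y \<in> Y \<Longrightarrow> h x y \<in> carrier M"
begin

private lemma lin_ext_closed:
  "x \<in> X \<Longrightarrow> g \<in> carrier (free_mod K Y) \<Longrightarrow> lin_ext K M (h x) g \<in> carrier M"
  by (rule linear_map_closed[OF lin_ext_linear[OF module.axioms(1)[OF M] M h]])

lemma bilin_ext_linear_left: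
  assumes "g \<in> carrier (free_mod K Y)"
  shows "linear_map K (free_mod K X) M (\<lambda>f. lin_ext K M (\<lambda>x. lin_ext K M (h x) g) f)"
  by (rule lin_ext_linear[OF module.axioms(1)[OF M] M lin_ext_closed[OF _ assms]])

text \<open>The right argument sits inside the nested extension, so its linearity is not an instance
  of \<open>lin_ext_linear\<close>. With the right arguments fixed, both sides of each law are
  linear in \<open>f\<close>, so they need to agree only on basis vectors, where the outer extension
  disappears.\<close>

lemma bilin_ext_linear_right:
  assumes f: "f \<in> carrier (free_mod K X)"
  shows "linear_map K (free_mod K Y) M (\<lambda>g. lin_ext K M (\<lambda>x. lin_ext K M (h x) g) f)"
proof (rule linear_mapI)
  interpret Y: module K "free_mod K Y" by (rule free_mod_module[OF module.axioms(1)[OF M]])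
  fix g assume g: "g \<in> carrier (free_mod K Y)"
  show "lin_ext K M (\<lambda>x. lin_ext K M (h x) g) f \<in> carrier M"
    by (rule linear_map_closed[OF bilin_ext_linear_left[OF g] f])
  show "lin_ext K M (\<lambda>x. lin_ext K M (h x) (g \<oplus>\<^bsub>free_mod K Y\<^esub> g')) f
      = lin_ext K M (\<lambda>x. lin_ext K M (h x) g) f \<oplus>\<^bsub>M\<^esub> lin_ext K M (\<lambda>x. lin_ext K M (h x) g') f"
    if g': "g' \<in> carrier (free_mod K Y)" for g'
  proof (rule free_mod_ext[OF module.axioms(1)[OF M] M _ _ _ f])
    have gg: "g \<oplus>\<^bsub>free_mod K Y\<^esub> g' \<in> carrier (free_mod K Y)" using g g' by simp
    show "linear_map K (free_mod K X) M
        (\<lambda>f. lin_ext K M (\<lambda>x. lin_ext K M (h x) (g \<oplus>\<^bsub>free_mod K Y\<^esub> g')) f)"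
      by (rule bilin_ext_linear_left[OF gg])
    show "linear_map K (free_mod K X) M (\<lambda>f. lin_ext K M (\<lambda>x. lin_ext K M (h x) g) f
        \<oplus>\<^bsub>M\<^esub> lin_ext K M (\<lambda>x. lin_ext K M (h x) g') f)"
      by (rule linear_map_plus[OF M bilin_ext_linear_left[OF g] bilin_ext_linear_left[OF g']])
    fix x assume x: "x \<in> X"
    show "lin_ext K M (\<lambda>x. lin_ext K M (h x) (g \<oplus>\<^bsub>free_mod K Y\<^esub> g')) (basis_vec K x)
      = lin_ext K M (\<lambda>x. lin_ext K M (h x) g) (basis_vec K x)
        \<oplus>\<^bsub>M\<^esub> lin_ext K M (\<lambda>x. lin_ext K M (h x) g') (basis_vec K x)"
      by (simp only: lin_ext_basis_vec[OF module.axioms(1)[OF M] M lin_ext_closed x] g g' gg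
          linear_map_add[OF lin_ext_linear[OF module.axioms(1)[OF M] M h[OF x]]])
  qed
  show "lin_ext K M (\<lambda>x. lin_ext K M (h x) (c \<odot>\<^bsub>free_mod K Y\<^esub> g)) f
      = c \<odot>\<^bsub>M\<^esub> lin_ext K M (\<lambda>x. lin_ext K M (h x) g) f"
    if c: "c \<in> carrier K" for c
  proof (rule free_mod_ext[OF module.axioms(1)[OF M] M _ _ _ f])
    have cg: "c \<odot>\<^bsub>free_mod K Y\<^esub> g \<in> carrier (free_mod K Y)" using c g by simp
    show "linear_map K (free_mod K X) M
        (\<lambda>f. lin_ext K M (\<lambda>x. lin_ext K M (h x) (c \<odot>\<^bsub>free_mod K Y\<^esub> g)) f)"
      by (rule bilin_ext_linear_left[OF cg])
    show "linear_map K (free_mod K X) M (\<lambda>f. c \<odot>\<^bsub>M\<^esub> lin_ext K M (\<lambda>x. lin_ext K M (h x) g) f)"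
      by (rule linear_map_scale[OF M bilin_ext_linear_left[OF g] c])
    fix x assume x: "x \<in> X"
    show "lin_ext K M (\<lambda>x. lin_ext K M (h x) (c \<odot>\<^bsub>free_mod K Y\<^esub> g)) (basis_vec K x)
      = c \<odot>\<^bsub>M\<^esub> lin_ext K M (\<lambda>x. lin_ext K M (h x) g) (basis_vec K x)"
      by (simp only: lin_ext_basis_vec[OF module.axioms(1)[OF M] M lin_ext_closed x] g cg c
          linear_map_smult[OF lin_ext_linear[OF module.axioms(1)[OF M] M h[OF x]]])
  qed
qed

lemma bilin_ext_basis_vec:
  assumes "x \<in> X" "y \<in> Y"
  shows "lin_ext K M (\<lambda>x. lin_ext K M (h x) (basis_vec K y)) (basis_vec K x) = h x y"
  by (simp only: lin_ext_basis_vec[OF module.axioms(1)[OF M] M lin_ext_closed assms(1)] basis_vec_closed[OF module.axioms(1)[OF M]] assms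
      lin_ext_basis_vec[OF module.axioms(1)[OF M] M h[OF assms(1)] assms(2)])

end

text \<open>Trilinear extensionality, for the sequential and parallel axioms: with it they become
  identities about grafting three trees.\<close>

lemma free_mod_ext3:
  assumes K: "cring K" and N: "module K N"
    and a: "a \<in> carrier (free_mod K X)" and b: "b \<in> carrier (free_mod K Y)"
    and c: "c \<in> carrier (free_mod K Z)"
    and L: "\<And>b c. b \<in> carrier (free_mod K Y) \<Longrightarrow> c \<in> carrier (free_mod K Z)
        \<Longrightarrow> linear_map K (free_mod K X) N (\<lambda>a. f a b c)"
      "\<And>a c. a \<in> carrier (free_mod K X) \<Longrightarrow> c \<in> carrier (free_mod K Z)
        \<Longrightarrow> linear_map K (free_mod K Y) N (\<lambda>b. f a b c)"
      "\<And>a b. a \<in> carrier (free_mod K X) \<Longrightarrow> b \<in> carrier (free_mod K Y)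
        \<Longrightarrow> linear_map K (free_mod K Z) N (\<lambda>c. f a b c)"
    and R: "\<And>b c. b \<in> carrier (free_mod K Y) \<Longrightarrow> c \<in> carrier (free_mod K Z)
        \<Longrightarrow> linear_map K (free_mod K X) N (\<lambda>a. g a b c)"
      "\<And>a c. a \<in> carrier (free_mod K X) \<Longrightarrow> c \<in> carrier (free_mod K Z)
        \<Longrightarrow> linear_map K (free_mod K Y) N (\<lambda>b. g a b c)"
      "\<And>a b. a \<in> carrier (free_mod K X) \<Longrightarrow> b \<in> carrier (free_mod K Y)
        \<Longrightarrow> linear_map K (free_mod K Z) N (\<lambda>c. g a b c)"
    and eq: "\<And>x y z. x \<in> X \<Longrightarrow> y \<in> Y \<Longrightarrow> z \<in> Z
      \<Longrightarrow> f (basis_vec K x) (basis_vec K y) (basis_vec K z)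
        = g (basis_vec K x) (basis_vec K y) (basis_vec K z)"
  shows "f a b c = g a b c"
proof (rule free_mod_ext[OF K N L(1)[OF b c] R(1)[OF b c] _ a])
  fix x assume x: "x \<in> X"
  note x' = basis_vec_closed[OF K x]
  show "f (basis_vec K x) b c = g (basis_vec K x) b c"
  proof (rule free_mod_ext[OF K N L(2)[OF x' c] R(2)[OF x' c] _ b])
    fix y assume y: "y \<in> Y"
    note y' = basis_vec_closed[OF K y]
    show "f (basis_vec K x) (basis_vec K y) c = g (basis_vec K x) (basis_vec K y) c"
      by (rule free_mod_ext[OF K N L(3)[OF x' y'] R(3)[OF x' y'] eq[OF x y] c])
  qed
qed

section \<open>Trees\<close>

lemma size1_pos: "1 \<le> size1 t"
  by (induction t) auto

text \<open>In additive form, which leaves no truncated subtraction to the arithmetic of leaf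
  numbers below.\<close>

lemma size1_graft:
  "1 \<le> i \<Longrightarrow> i \<le> size1 s \<Longrightarrow> size1 (graft s i t) + 1 = size1 s + size1 t"
proof (induction s arbitrary: i)
  case (Node l a r)
  then show ?case using size1_pos[of l] size1_pos[of r]
    by (cases "i \<le> size1 l") (auto simp: not_le)
qed auto

lemma set_tree_graft: "set_tree (graft s i t) \<subseteq> set_tree s \<union> set_tree t"
  by (induction s arbitrary: i) auto

lemma graft_trees:
  assumes "s \<in> trees X m" "t \<in> trees X n" "1 \<le> i" "i \<le> m"
  shows "graft s i t \<in> trees X (m + n - 1)"
  using assms size1_graft[of i s t] set_tree_graft[of s i t] by (auto simp: trees_def)

lemma graft_Leaf [simp]: "1 \<le> i \<Longrightarrow> i \<le> size1 s \<Longrightarrow> graft s i Leaf = s"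
  by (induction s arbitrary: i) auto

lemma graft_sequential:
  "\<lbrakk>1 \<le> i; i \<le> size1 a; 1 \<le> j; j \<le> size1 b\<rbrakk>
    \<Longrightarrow> graft (graft a i b) (i - 1 + j) c = graft a i (graft b j c)"
proof (induction a arbitrary: i)
  case (Node l x r)
  show ?case
  proof (cases "i \<le> size1 l")
    case True
    \<comment> \<open>Grafting replaces leaf \<open>i\<close> of the left subtree by a copy of
      \<open>b\<close>, so leaf \<open>j\<close> of that copy still lies to the left of the
      vertex.\<close>
    moreover have "i - 1 + j \<le> size1 (graft l i b)"
      using size1_graft[of i l b] Node.prems True by linarith
    ultimately show ?thesis using Node by simp
  next
    case False
    then have "\<not> i - 1 + j \<le> size1 l" "i - 1 + j - size1 l = i - size1 l - 1 + j"
      using Node.prems by auto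
    then show ?thesis
      using Node.IH(2)[of "i - size1 l"] Node.prems False by simp
  qed
qed auto

text \<open>Induction on the tree holding both leaves. While they lie in the same subtree the
  induction hypothesis applies; at the vertex that separates them the two graftings act on different
  subtrees, and only the shift of the right leaf number by \<open>size1 b - 1\<close> has to be
  accounted for.\<close>

lemma graft_parallel:
  "\<lbrakk>1 \<le> i; i < k; k \<le> size1 a\<rbrakk>
    \<Longrightarrow> graft (graft a i b) (k - 1 + size1 b) c = graft (graft a k c) i b"
proof (induction a arbitrary: i k)
  case (Node l x r)
  consider "k \<le> size1 l" | "i \<le> size1 l" "size1 l < k" | "size1 l < i" by linarith
  then show ?case
  proof cases
    case 1
    then have "i \<le> size1 (graft l k c)" "k - 1 + size1 b \<le> size1 (graft l i b)"
      using size1_graft[of k l c] size1_graft[of i l b] Node.prems size1_pos[of c] by linarith+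
    then show ?thesis using Node 1 by simp
  next
    case 2
    have s: "size1 (graft l i b) + 1 = size1 l + size1 b" using 2 Node.prems by (intro size1_graft)
    then have "\<not> k - 1 + size1 b \<le> size1 (graft l i b)"
      "k - 1 + size1 b - size1 (graft l i b) = k - size1 l"
      using 2 Node.prems by auto
    then show ?thesis using 2 by simp
  next
    case 3
    then have "k - 1 + size1 b - size1 l = k - size1 l - 1 + size1 b" "\<not> k - 1 + size1 b \<le> size1 l"
      using Node.prems size1_pos[of b] by auto
    then show ?thesis
      using Node.IH(2)[of "i - size1 l" "k - size1 l"] Node.prems 3 by simp
  qed
qed auto

section \<open>Trees with a distinguished vertex under grafting and relabelling\<close>

lemma vertex_ctx_set_tree: "C \<in> vertex_ctx \<Longrightarrow> \<exists>S. \<forall>x. set_tree (C x) = insert x S"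
proof (induction rule: vertex_ctx.induct)
  case (here l r)
  show ?case by (rule exI[of _ "set_tree l \<union> set_tree r"]) auto
next
  case (left C a r)
  then obtain S where "\<forall>x. set_tree (C x) = insert x S" by blast
  then show ?case by (intro exI[of _ "insert a (S \<union> set_tree r)"]) auto
next
  case (right C l a)
  then obtain S where "\<forall>x. set_tree (C x) = insert x S" by blast
  then show ?case by (intro exI[of _ "insert a (S \<union> set_tree l)"]) auto
qed

lemma vertex_ctx_size1: "C \<in> vertex_ctx \<Longrightarrow> size1 (C x) = size1 (C y)"
  by (induction rule: vertex_ctx.induct) auto

text \<open>The remaining labels form one set independent of the distinguished label, and the number
  of leaves does not depend on it either. Membership at one label therefore gives membership at
  every admissible label.\<close>

lemma vertex_ctx_trees:
  assumes "C \<in> vertex_ctx" "C x \<in> trees X n"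
  shows "x \<in> X" "y \<in> X \<Longrightarrow> C y \<in> trees X n"
  using vertex_ctx_set_tree[OF assms(1)] vertex_ctx_size1[OF assms(1), of x y] assms(2)
  by (auto simp: trees_def)

text \<open>Stability of contexts under grafting is what makes the multilinearity relations an
  operadic ideal.\<close>

lemma vertex_ctx_graft_left: "C \<in> vertex_ctx \<Longrightarrow> (\<lambda>x. graft (C x) i t) \<in> vertex_ctx"
proof (induction arbitrary: i rule: vertex_ctx.induct)
  case (here l r)
  show ?case by (cases "i \<le> size1 l") (simp_all add: vertex_ctx.here)
next
  case (left C a r)
  \<comment> \<open>\<open>graft\<close> branches on the size of the subtree with the distinguished
    vertex. The branch must be the same for all labels; \<open>undefined\<close> only serves as a
    sample label at which to read off the constant size.\<close>
  have s: "size1 (C x) = size1 (C undefined)" for x by (rule vertex_ctx_size1[OF left.hyps])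
  show ?case
  proof (cases "i \<le> size1 (C undefined)")
    case True
    then have "i \<le> size1 (C x)" for x using s[of x] by simp
    then show ?thesis using vertex_ctx.left[OF left.IH] by simp
  next
    case False
    then have "\<not> i \<le> size1 (C x)" for x using s[of x] by simp
    then have "(\<lambda>x. graft (Node (C x) a r) i t)
        = (\<lambda>x. Node (C x) a (graft r (i - size1 (C undefined)) t))"
      using s by (simp add: fun_eq_iff) metis
    then show ?thesis using vertex_ctx.left[OF left.hyps] by simp
  qed
next
  case (right C l a)
  show ?case
    by (cases "i \<le> size1 l") (simp_all add: vertex_ctx.right[OF right.hyps] vertex_ctx.right[OF right.IH])
qed

lemma vertex_ctx_graft_right: "C \<in> vertex_ctx \<Longrightarrow> (\<lambda>x. graft s i (C x)) \<in> vertex_ctx"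
proof (induction s arbitrary: i)
  case (Node l a r)
  show ?case
    by (cases "i \<le> size1 l")
      (simp_all add: vertex_ctx.left[OF Node.IH(1)[OF Node.prems]]
        vertex_ctx.right[OF Node.IH(2)[OF Node.prems]])
qed simp

lemma vertex_ctx_map_tree:
  "C \<in> vertex_ctx \<Longrightarrow> \<exists>C'\<in>vertex_ctx. \<forall>x. map_tree f (C x) = C' (f x)"
proof (induction rule: vertex_ctx.induct)
  case (here l r)
  show ?case by (rule bexI[OF _ vertex_ctx.here]) simp
next
  case (left C a r)
  then obtain C' where "C' \<in> vertex_ctx" "\<forall>x. map_tree f (C x) = C' (f x)" by blast
  then show ?case by (intro bexI[OF _ vertex_ctx.left[of C']]) auto
next
  case (right C l a)
  then obtain C' where "C' \<in> vertex_ctx" "\<forall>x. map_tree f (C x) = C' (f x)" by blast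
  then show ?case by (intro bexI[OF _ vertex_ctx.right[of C']]) auto
qed

section \<open>The operad of labelled trees\<close>

context
  fixes K :: "('k, 'r) ring_scheme" and X :: "'v set"
  assumes K: "cring K"
begin

lemma tree_op_simps:
  "component (tree_op K X) n = free_mod K (trees X n)"
  "idop (tree_op K X) = basis_vec K Leaf"
  "pcomp (tree_op K X) m n i f g =
    lin_ext K (free_mod K (trees X (m + n - 1)))
      (\<lambda>s. lin_ext K (free_mod K (trees X (m + n - 1))) (\<lambda>t. basis_vec K (graft s i t)) g) f"
  by (simp_all add: tree_op_def Let_def)

lemma tree_pcomp:
  assumes i: "1 \<le> i" "i \<le> m"
  shows tree_pcomp_linear_left: "g \<in> carrier (free_mod K (trees X n)) \<Longrightarrow>
      linear_map K (free_mod K (trees X m)) (free_mod K (trees X (m + n - 1)))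
        (\<lambda>f. pcomp (tree_op K X) m n i f g)"
    and tree_pcomp_linear_right: "f \<in> carrier (free_mod K (trees X m)) \<Longrightarrow>
      linear_map K (free_mod K (trees X n)) (free_mod K (trees X (m + n - 1)))
        (pcomp (tree_op K X) m n i f)"
    and tree_pcomp_basis: "s \<in> trees X m \<Longrightarrow> t \<in> trees X n \<Longrightarrow>
      pcomp (tree_op K X) m n i (basis_vec K s) (basis_vec K t) = basis_vec K (graft s i t)"
    and tree_pcomp_closed: "f \<in> carrier (free_mod K (trees X m)) \<Longrightarrow> g \<in> carrier (free_mod K (trees X n))
      \<Longrightarrow> pcomp (tree_op K X) m n i f g \<in> carrier (free_mod K (trees X (m + n - 1)))"
proof -
  have M: "module K (free_mod K (trees X (m + n - 1)))" by (rule free_mod_module[OF K])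
  have h: "basis_vec K (graft s i t) \<in> carrier (free_mod K (trees X (m + n - 1)))"
    if "s \<in> trees X m" "t \<in> trees X n" for s t
    using that i by (intro basis_vec_closed[OF K] graft_trees)
  show left: "linear_map K (free_mod K (trees X m)) (free_mod K (trees X (m + n - 1)))
      (\<lambda>f. pcomp (tree_op K X) m n i f g)" if "g \<in> carrier (free_mod K (trees X n))" for g
    unfolding tree_op_simps using M h that by (rule bilin_ext_linear_left)
  show "linear_map K (free_mod K (trees X n)) (free_mod K (trees X (m + n - 1)))
        (pcomp (tree_op K X) m n i f)" if "f \<in> carrier (free_mod K (trees X m))" for f
    unfolding tree_op_simps using M h that by (rule bilin_ext_linear_right)
  show "pcomp (tree_op K X) m n i (basis_vec K s) (basis_vec K t) = basis_vec K (graft s i t)"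
    if "s \<in> trees X m" "t \<in> trees X n" for s t
    unfolding tree_op_simps using M h that by (rule bilin_ext_basis_vec)
  show "pcomp (tree_op K X) m n i f g \<in> carrier (free_mod K (trees X (m + n - 1)))"
    if "f \<in> carrier (free_mod K (trees X m))" "g \<in> carrier (free_mod K (trees X n))" for f g
    by (rule linear_map_closed[OF left[OF that(2)] that(1)])
qed

lemma Leaf_trees: "Leaf \<in> trees X 1"
  by (simp add: trees_def)

text \<open>Both sides of each axiom are linear in every argument, so single trees decide, and for
  these the axiom is the corresponding fact about \<open>graft\<close>.\<close>

lemma tree_op_operad: "ns_operad K (tree_op K X)"
proof (rule ns_operad.intro, unfold tree_op_simps(1,2))
  let ?F = "\<lambda>n. free_mod K (trees X n)" and ?p = "pcomp (tree_op K X)"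
  note M = free_mod_module[OF K]
  have leaf: "basis_vec K Leaf \<in> carrier (?F 1)"
    by (rule basis_vec_closed[OF K Leaf_trees])
  then show "basis_vec K Leaf \<in> carrier (?F 1)" .
  show "module K (?F n)" for n by (rule M)
  {
    fix m n i :: nat and a b
    assume i: "1 \<le> i" "i \<le> m" and a: "a \<in> carrier (?F m)" and b: "b \<in> carrier (?F n)"
    show "?p m n i a b \<in> carrier (?F (m + n - 1))"
      by (rule tree_pcomp_closed[OF i a b])
    show "?p m n i (a \<oplus>\<^bsub>?F m\<^esub> a') b = ?p m n i a b \<oplus>\<^bsub>?F (m + n - 1)\<^esub> ?p m n i a' b"
      if "a' \<in> carrier (?F m)" for a'
      by (rule linear_map_add[OF tree_pcomp_linear_left[OF i b] a that])
    show "?p m n i a (b \<oplus>\<^bsub>?F n\<^esub> b') = ?p m n i a b \<oplus>\<^bsub>?F (m + n - 1)\<^esub> ?p m n i a b'"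
      if "b' \<in> carrier (?F n)" for b'
      by (rule linear_map_add[OF tree_pcomp_linear_right[OF i a] b that])
    fix c assume c: "c \<in> carrier K"
    show "?p m n i (c \<odot>\<^bsub>?F m\<^esub> a) b = c \<odot>\<^bsub>?F (m + n - 1)\<^esub> ?p m n i a b"
      by (rule linear_map_smult[OF tree_pcomp_linear_left[OF i b] c a])
    show "?p m n i a (c \<odot>\<^bsub>?F n\<^esub> b) = c \<odot>\<^bsub>?F (m + n - 1)\<^esub> ?p m n i a b"
      by (rule linear_map_smult[OF tree_pcomp_linear_right[OF i a] c b])
  }
  {
    fix n b assume b: "b \<in> carrier (?F n)"
    show "?p 1 n 1 (basis_vec K Leaf) b = b"
    proof (rule free_mod_ext[OF K M _ linear_map_id _ b])
      show "linear_map K (?F n) (?F n) (?p 1 n 1 (basis_vec K Leaf))"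
        using tree_pcomp_linear_right[OF order_refl order_refl leaf, of n] by simp
      show "?p 1 n 1 (basis_vec K Leaf) (basis_vec K t) = basis_vec K t" if "t \<in> trees X n" for t
        using tree_pcomp_basis[OF order_refl order_refl Leaf_trees that] by simp
    qed
    fix i assume i: "1 \<le> i" "i \<le> n"
    show "?p n 1 i b (basis_vec K Leaf) = b"
    proof (rule free_mod_ext[OF K M _ linear_map_id _ b])
      show "linear_map K (?F n) (?F n) (\<lambda>b. ?p n 1 i b (basis_vec K Leaf))"
        using tree_pcomp_linear_left[OF i leaf] by simp
      show "?p n 1 i (basis_vec K t) (basis_vec K Leaf) = basis_vec K t" if "t \<in> trees X n" for t
        using tree_pcomp_basis[OF i that Leaf_trees] i that by (simp add: trees_def)
    qed
  }
  {
    fix l m n i j :: nat and a b c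
    assume i: "1 \<le> i" "i \<le> l" and j: "1 \<le> j" "j \<le> m"
      and abc: "a \<in> carrier (?F l)" "b \<in> carrier (?F m)" "c \<in> carrier (?F n)"
    \<comment> \<open>\<open>e\<close> equates the arities of the two bracketings, so that linearity
      in each of the three arguments can be stated in one common component.\<close>
    have r: "1 \<le> i - 1 + j" "i - 1 + j \<le> l + m - 1" and
      e: "l + m - 1 + n - 1 = l + (m + n - 1) - 1"
      using i j by auto
    note lc = linear_map_comp tree_pcomp_linear_left tree_pcomp_linear_right tree_pcomp_closed
    show "?p (l + m - 1) n (i - 1 + j) (?p l m i a b) c = ?p l (m + n - 1) i a (?p m n j b c)"
    proof (rule free_mod_ext3[OF K M[of "trees X (l + (m + n - 1) - 1)"] abc, where
          f = "\<lambda>a b c. ?p (l + m - 1) n (i - 1 + j) (?p l m i a b) c" and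
          g = "\<lambda>a b c. ?p l (m + n - 1) i a (?p m n j b c)"], unfold e[symmetric])
      fix a b c assume a: "a \<in> carrier (?F l)" and b: "b \<in> carrier (?F m)"
      show "linear_map K (?F n) (?F (l + m - 1 + n - 1))
          (?p (l + m - 1) n (i - 1 + j) (?p l m i a b))"
        using i r a b by (intro lc)
      show "linear_map K (?F n) (?F (l + m - 1 + n - 1)) (\<lambda>c. ?p l (m + n - 1) i a (?p m n j b c))"
        unfolding e using i j a b
        by (intro linear_map_comp[OF tree_pcomp_linear_right tree_pcomp_linear_right])
    next
      fix a c assume a: "a \<in> carrier (?F l)" and c: "c \<in> carrier (?F n)"
      show "linear_map K (?F m) (?F (l + m - 1 + n - 1))
          (\<lambda>b. ?p (l + m - 1) n (i - 1 + j) (?p l m i a b) c)"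
        using i r a c by (intro linear_map_comp[OF tree_pcomp_linear_right tree_pcomp_linear_left])
      show "linear_map K (?F m) (?F (l + m - 1 + n - 1)) (\<lambda>b. ?p l (m + n - 1) i a (?p m n j b c))"
        unfolding e using i j a c
        by (intro linear_map_comp[OF tree_pcomp_linear_left tree_pcomp_linear_right])
    next
      fix b c assume b: "b \<in> carrier (?F m)" and c: "c \<in> carrier (?F n)"
      show "linear_map K (?F l) (?F (l + m - 1 + n - 1))
          (\<lambda>a. ?p (l + m - 1) n (i - 1 + j) (?p l m i a b) c)"
        using i r b c by (intro linear_map_comp[OF tree_pcomp_linear_left tree_pcomp_linear_left])
      show "linear_map K (?F l) (?F (l + m - 1 + n - 1)) (\<lambda>a. ?p l (m + n - 1) i a (?p m n j b c))"
        unfolding e using i j b c by (intro tree_pcomp_linear_left tree_pcomp_closed)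
    next
      fix s t u assume t: "s \<in> trees X l" "t \<in> trees X m" "u \<in> trees X n"
      then have "graft (graft s i t) (i - 1 + j) u = graft s i (graft t j u)"
        using i j by (intro graft_sequential) (simp_all add: trees_def)
      then show "?p (l + m - 1) n (i - 1 + j) (?p l m i (basis_vec K s) (basis_vec K t)) (basis_vec K u)
          = ?p l (m + n - 1) i (basis_vec K s) (?p m n j (basis_vec K t) (basis_vec K u))"
        using t by (simp only: tree_pcomp_basis[OF i] tree_pcomp_basis[OF j] tree_pcomp_basis[OF r]
            graft_trees i j)
    qed
  }
  {
    fix l m n i k :: nat and a b c
    assume ik: "1 \<le> i" "i < k" "k \<le> l"
      and abc: "a \<in> carrier (?F l)" "b \<in> carrier (?F m)" "c \<in> carrier (?F n)"
    have r: "1 \<le> k - 1 + m" "k - 1 + m \<le> l + m - 1" and k: "1 \<le> k" "k \<le> l"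
      and i: "1 \<le> i" "i \<le> l" and i': "i \<le> l + n - 1"
      and e: "l + m - 1 + n - 1 = l + n - 1 + m - 1"
      using ik by auto
    show "?p (l + m - 1) n (k - 1 + m) (?p l m i a b) c = ?p (l + n - 1) m i (?p l n k a c) b"
    proof (rule free_mod_ext3[OF K M[of "trees X (l + n - 1 + m - 1)"] abc, where
          f = "\<lambda>a b c. ?p (l + m - 1) n (k - 1 + m) (?p l m i a b) c" and
          g = "\<lambda>a b c. ?p (l + n - 1) m i (?p l n k a c) b"], unfold e[symmetric])
      fix a b c assume a: "a \<in> carrier (?F l)" and b: "b \<in> carrier (?F m)"
      show "linear_map K (?F n) (?F (l + m - 1 + n - 1))
          (?p (l + m - 1) n (k - 1 + m) (?p l m i a b))"
        using i r a b by (intro tree_pcomp_linear_right tree_pcomp_closed)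
      show "linear_map K (?F n) (?F (l + m - 1 + n - 1)) (\<lambda>c. ?p (l + n - 1) m i (?p l n k a c) b)"
        unfolding e using i(1) i' k a b
        by (intro linear_map_comp[OF tree_pcomp_linear_right tree_pcomp_linear_left])
    next
      fix a c assume a: "a \<in> carrier (?F l)" and c: "c \<in> carrier (?F n)"
      show "linear_map K (?F m) (?F (l + m - 1 + n - 1))
          (\<lambda>b. ?p (l + m - 1) n (k - 1 + m) (?p l m i a b) c)"
        using i r a c by (intro linear_map_comp[OF tree_pcomp_linear_right tree_pcomp_linear_left])
      show "linear_map K (?F m) (?F (l + m - 1 + n - 1)) (?p (l + n - 1) m i (?p l n k a c))"
        unfolding e using i(1) i' k a c by (intro tree_pcomp_linear_right tree_pcomp_closed)
    next
      fix b c assume b: "b \<in> carrier (?F m)" and c: "c \<in> carrier (?F n)"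
      show "linear_map K (?F l) (?F (l + m - 1 + n - 1))
          (\<lambda>a. ?p (l + m - 1) n (k - 1 + m) (?p l m i a b) c)"
        using i r b c by (intro linear_map_comp[OF tree_pcomp_linear_left tree_pcomp_linear_left])
      show "linear_map K (?F l) (?F (l + m - 1 + n - 1)) (\<lambda>a. ?p (l + n - 1) m i (?p l n k a c) b)"
        unfolding e using i(1) i' k b c
        by (intro linear_map_comp[OF tree_pcomp_linear_left tree_pcomp_linear_left])
    next
      fix s t u assume t: "s \<in> trees X l" "t \<in> trees X m" "u \<in> trees X n"
      then have "graft (graft s i t) (k - 1 + m) u = graft (graft s k u) i t"
        using ik graft_parallel[of i k s t u] by (simp add: trees_def)
      then show "?p (l + m - 1) n (k - 1 + m) (?p l m i (basis_vec K s) (basis_vec K t)) (basis_vec K u)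
          = ?p (l + n - 1) m i (?p l n k (basis_vec K s) (basis_vec K u)) (basis_vec K t)"
        using t by (simp only: tree_pcomp_basis[OF i] tree_pcomp_basis[OF k] tree_pcomp_basis[OF r]
            tree_pcomp_basis[OF i(1) i'] graft_trees i k)
    qed
  }
qed

end

section \<open>Multilinearity relations\<close>

text \<open>The generating set inside \<open>multilinear_rels\<close>, named so that linear maps can
  be tested on it.\<close>

definition multilinear_gens ::
  "('k, 'r) ring_scheme \<Rightarrow> ('k, 'v, 'm) module_scheme \<Rightarrow> nat \<Rightarrow> ('v tree \<Rightarrow> 'k) set" where
  "multilinear_gens K V n =
    (let F = free_mod K (trees (carrier V) n); \<delta> = basis_vec K in
      {\<delta> (C (\<omega> \<oplus>\<^bsub>V\<^esub> \<nu>)) \<ominus>\<^bsub>F\<^esub> (\<delta> (C \<omega>) \<oplus>\<^bsub>F\<^esub> \<delta> (C \<nu>)) | C \<omega> \<nu>.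
          C \<in> vertex_ctx \<and> C \<omega> \<in> trees (carrier V) n \<and> C \<nu> \<in> trees (carrier V) n}
     \<union> {\<delta> (C (c \<odot>\<^bsub>V\<^esub> \<omega>)) \<ominus>\<^bsub>F\<^esub> c \<odot>\<^bsub>F\<^esub> \<delta> (C \<omega>) | C c \<omega>.
          C \<in> vertex_ctx \<and> c \<in> carrier K \<and> C \<omega> \<in> trees (carrier V) n})"

lemma multilinear_rels_gens:
  "multilinear_rels K V n = gen_submodule K (free_mod K (trees (carrier V) n)) (multilinear_gens K V n)"
  by (simp add: multilinear_rels_def multilinear_gens_def Let_def)

context
  fixes K :: "('k, 'r) ring_scheme" and V :: "('k, 'v, 'm) module_scheme"
  assumes V: "module K V"
begin

interpretation V: module K V by (fact V)

lemma multilinear_gens_subset: "multilinear_gens K V n \<subseteq> carrier (free_mod K (trees (carrier V) n))"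
proof -
  interpret F: module K "free_mod K (trees (carrier V) n)" by (rule free_mod_module[OF V.R.cring_axioms])
  have "basis_vec K (C x) \<in> carrier (free_mod K (trees (carrier V) n))"
    if "C \<in> vertex_ctx" "C \<omega> \<in> trees (carrier V) n" "x \<in> carrier V" for C \<omega> x
    using that by (intro basis_vec_closed[OF V.R.cring_axioms] vertex_ctx_trees(2))
  moreover have "\<omega> \<in> carrier V" if "C \<in> vertex_ctx" "C \<omega> \<in> trees (carrier V) n" for C \<omega>
    using that by (rule vertex_ctx_trees(1))
  ultimately show ?thesis
    unfolding multilinear_gens_def Let_def
    by (intro Un_least subsetI; elim CollectE exE conjE; hypsubst)
      (rule F.M.minus_closed; (intro F.M.a_closed F.smult_closed)?; blast)+
qed

lemma multilinear_rels_submodule: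
  "submodule (multilinear_rels K V n) K (free_mod K (trees (carrier V) n))"
  unfolding multilinear_rels_gens
  by (rule gen_submodule_submodule[OF free_mod_module[OF V.R.cring_axioms] multilinear_gens_subset])

lemma multilinear_rels_add:
  assumes "C \<in> vertex_ctx" "C \<omega> \<in> trees (carrier V) n" "\<nu> \<in> carrier V"
  shows "basis_vec K (C (\<omega> \<oplus>\<^bsub>V\<^esub> \<nu>)) \<ominus>\<^bsub>free_mod K (trees (carrier V) n)\<^esub>
    (basis_vec K (C \<omega>) \<oplus>\<^bsub>free_mod K (trees (carrier V) n)\<^esub> basis_vec K (C \<nu>)) \<in> multilinear_rels K V n"
  unfolding multilinear_rels_gens
  using assms vertex_ctx_trees(2)[OF assms(1,2,3)]
  by (intro subsetD[OF gen_submodule_incl]) (auto simp: multilinear_gens_def Let_def)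

lemma multilinear_rels_smult:
  assumes "C \<in> vertex_ctx" "C \<omega> \<in> trees (carrier V) n" "c \<in> carrier K"
  shows "basis_vec K (C (c \<odot>\<^bsub>V\<^esub> \<omega>)) \<ominus>\<^bsub>free_mod K (trees (carrier V) n)\<^esub>
    c \<odot>\<^bsub>free_mod K (trees (carrier V) n)\<^esub> basis_vec K (C \<omega>) \<in> multilinear_rels K V n"
  unfolding multilinear_rels_gens
  using assms
  by (intro subsetD[OF gen_submodule_incl]) (auto simp: multilinear_gens_def Let_def)

end

text \<open>The criterion behind all maps of tree modules here. Seen as a function of one vertex
  label, the map must be a scalar multiple of a tree in which one vertex carries a linear image of
  that label; then it sends the generators to multiples of generators. The scalar \<open>e\<close>
  accommodates the sign and the zeros of \<Psi>, the map \<sigma> the labels of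
  \<open>TSu\<^sub>J\<close> and the relabellings, and \<open>m\<close> may differ from
  \<open>n\<close> because composition changes the arity.\<close>

lemma multilinear_rels_image:
  assumes V: "module K V" and W: "module K W"
    and f: "linear_map K (free_mod K (trees (carrier V) n)) (free_mod K (trees (carrier W) m)) f"
    and ctx: "\<And>C \<omega>. C \<in> vertex_ctx \<Longrightarrow> C \<omega> \<in> trees (carrier V) n \<Longrightarrow>
      \<exists>C'\<in>vertex_ctx. \<exists>\<sigma>. \<exists>e\<in>carrier K. linear_map K V W \<sigma> \<and>
        (\<forall>x\<in>carrier V. C' (\<sigma> x) \<in> trees (carrier W) m
          \<and> f (basis_vec K (C x)) = e \<odot>\<^bsub>free_mod K (trees (carrier W) m)\<^esub> basis_vec K (C' (\<sigma> x)))"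
    and a: "a \<in> multilinear_rels K V n"
  shows "f a \<in> multilinear_rels K W m"
proof -
  interpret V: module K V by (fact V)
  interpret W: module K W by (fact W)
  note K = V.R.cring_axioms
  let ?F = "free_mod K (trees (carrier V) n)" and ?G = "free_mod K (trees (carrier W) m)"
  note F = free_mod_module[OF K, of "trees (carrier V) n"]
  note G = free_mod_module[OF K, of "trees (carrier W) m"]
  interpret F: module K ?F by (rule F)
  interpret G: module K ?G by (rule G)
  note \<delta>F = basis_vec_closed[OF K, where X = "trees (carrier V) n"]
  note \<delta>G = basis_vec_closed[OF K, where X = "trees (carrier W) m"]
  have "f y \<in> multilinear_rels K W m" if "y \<in> multilinear_gens K V n" for y
    using that unfolding multilinear_gens_def Let_def
  proof (elim UnE CollectE exE conjE)
    fix C \<omega> \<nu>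
    assume y: "y = basis_vec K (C (\<omega> \<oplus>\<^bsub>V\<^esub> \<nu>)) \<ominus>\<^bsub>?F\<^esub> (basis_vec K (C \<omega>) \<oplus>\<^bsub>?F\<^esub> basis_vec K (C \<nu>))"
      and C: "C \<in> vertex_ctx" "C \<omega> \<in> trees (carrier V) n" "C \<nu> \<in> trees (carrier V) n"
    note c = vertex_ctx_trees(1)[OF C(1,2)] vertex_ctx_trees(1)[OF C(1,3)]
    have C': "C (\<omega> \<oplus>\<^bsub>V\<^esub> \<nu>) \<in> trees (carrier V) n"
      using vertex_ctx_trees(2)[OF C(1,2)] c by simp
    obtain D \<sigma> e where D: "D \<in> vertex_ctx" "linear_map K V W \<sigma>" "e \<in> carrier K"
      "\<And>x. x \<in> carrier V \<Longrightarrow> D (\<sigma> x) \<in> trees (carrier W) m"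
      "\<And>x. x \<in> carrier V \<Longrightarrow> f (basis_vec K (C x)) = e \<odot>\<^bsub>?G\<^esub> basis_vec K (D (\<sigma> x))"
      using ctx[OF C(1,2)] by blast
    note t = D(4)[OF c(1)] D(4)[OF c(2)] D(4)[of "\<omega> \<oplus>\<^bsub>V\<^esub> \<nu>"]
    have "f y = e \<odot>\<^bsub>?G\<^esub> (basis_vec K (D (\<sigma> \<omega> \<oplus>\<^bsub>W\<^esub> \<sigma> \<nu>))
        \<ominus>\<^bsub>?G\<^esub> (basis_vec K (D (\<sigma> \<omega>)) \<oplus>\<^bsub>?G\<^esub> basis_vec K (D (\<sigma> \<nu>))))"
      unfolding y using c C C' D(3) t \<delta>G
      by (simp add: linear_map_neg[OF F G f] linear_map_add[OF f] linear_map_add[OF D(2)] \<delta>F D(5)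
          G.smult_r_distr G.smult_r_minus a_minus_def)
    moreover have "\<dots> \<in> multilinear_rels K W m"
      by (intro submodule_smult[OF G multilinear_rels_submodule[OF W]] D(3)
          multilinear_rels_add[OF W D(1) t(1)] linear_map_closed[OF D(2)] c)
    ultimately show ?thesis by simp
  next
    fix C c \<omega>
    assume y: "y = basis_vec K (C (c \<odot>\<^bsub>V\<^esub> \<omega>)) \<ominus>\<^bsub>?F\<^esub> c \<odot>\<^bsub>?F\<^esub> basis_vec K (C \<omega>)"
      and C: "C \<in> vertex_ctx" "c \<in> carrier K" "C \<omega> \<in> trees (carrier V) n"
    note x = vertex_ctx_trees(1)[OF C(1,3)]
    have C': "C (c \<odot>\<^bsub>V\<^esub> \<omega>) \<in> trees (carrier V) n"
      using vertex_ctx_trees(2)[OF C(1,3)] x C(2) by simp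
    obtain D \<sigma> e where D: "D \<in> vertex_ctx" "linear_map K V W \<sigma>" "e \<in> carrier K"
      "\<And>x. x \<in> carrier V \<Longrightarrow> D (\<sigma> x) \<in> trees (carrier W) m"
      "\<And>x. x \<in> carrier V \<Longrightarrow> f (basis_vec K (C x)) = e \<odot>\<^bsub>?G\<^esub> basis_vec K (D (\<sigma> x))"
      using ctx[OF C(1,3)] by blast
    note t = D(4)[OF x] D(4)[of "c \<odot>\<^bsub>V\<^esub> \<omega>"]
    have ce: "c \<odot>\<^bsub>?G\<^esub> (e \<odot>\<^bsub>?G\<^esub> z) = e \<odot>\<^bsub>?G\<^esub> (c \<odot>\<^bsub>?G\<^esub> z)" if "z \<in> carrier ?G" for z
      using that C(2) D(3) by (simp add: G.smult_assoc1[symmetric] V.R.m_comm)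
    have "f y = e \<odot>\<^bsub>?G\<^esub> (basis_vec K (D (c \<odot>\<^bsub>W\<^esub> \<sigma> \<omega>)) \<ominus>\<^bsub>?G\<^esub> c \<odot>\<^bsub>?G\<^esub> basis_vec K (D (\<sigma> \<omega>)))"
      unfolding y using x C C' D(3) t \<delta>G
      by (simp add: linear_map_neg[OF F G f] linear_map_add[OF f] linear_map_smult[OF f] linear_map_smult[OF D(2)] \<delta>F D(5)
          G.smult_r_distr G.smult_r_minus a_minus_def ce)
    moreover have "\<dots> \<in> multilinear_rels K W m"
      by (intro submodule_smult[OF G multilinear_rels_submodule[OF W]] D(3)
          multilinear_rels_smult[OF W D(1) t(1)] C(2))
    ultimately show ?thesis by simp
  qed
  then show ?thesis
    using gen_submodule_image[OF F G f multilinear_rels_submodule[OF W] multilinear_gens_subset[OF V]] a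
    unfolding multilinear_rels_gens[of K V] by blast
qed

text \<open>For a single tree as the other factor, composition is grafting, which keeps contexts and
  leaves the label alone, so the criterion applies with \<sigma> the identity and scalar
  one.\<close>

lemma multilinear_rels_ideal:
  assumes V: "module K V"
  shows "ns_ideal K (tree_op K (carrier V)) (multilinear_rels K V)"
proof -
  interpret V: module K V by (fact V)
  note K = V.R.cring_axioms
  note M = free_mod_module[OF K] and L = multilinear_rels_submodule[OF V]
  note simps = tree_op_simps(1)[OF K]
  let ?T = "trees (carrier V)" and ?p = "pcomp (tree_op K (carrier V))"
  note pl = tree_pcomp_linear_left[OF K, where X = "carrier V"]
    and pr = tree_pcomp_linear_right[OF K, where X = "carrier V"]
    and pb = tree_pcomp_basis[OF K, where X = "carrier V"]
  show ?thesis
    unfolding ns_ideal_def simps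
  proof (intro conjI allI impI)
    show "submodule (multilinear_rels K V n) K (free_mod K (?T n))" for n by (rule L)
    fix m n i :: nat and a b
    {
      assume "1 \<le> i \<and> i \<le> m \<and> a \<in> multilinear_rels K V m \<and> b \<in> carrier (free_mod K (?T n))"
      then have i: "1 \<le> i" "i \<le> m" and a: "a \<in> multilinear_rels K V m"
        and b: "b \<in> carrier (free_mod K (?T n))" by auto
      have "?p m n i a (basis_vec K t) \<in> multilinear_rels K V (m + n - 1)" if t: "t \<in> ?T n" for t
      proof (rule multilinear_rels_image[OF V V pl[OF i basis_vec_closed[OF K t]] _ a])
        fix C \<omega> assume C: "C \<in> vertex_ctx" "C \<omega> \<in> ?T m"
        show "\<exists>C'\<in>vertex_ctx. \<exists>\<sigma>. \<exists>e\<in>carrier K. linear_map K V V \<sigma> \<and>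
          (\<forall>x\<in>carrier V. C' (\<sigma> x) \<in> ?T (m + n - 1) \<and>
            ?p m n i (basis_vec K (C x)) (basis_vec K t)
            = e \<odot>\<^bsub>free_mod K (?T (m + n - 1))\<^esub> basis_vec K (C' (\<sigma> x)))"
        proof (intro bexI[OF _ vertex_ctx_graft_left[OF C(1), of i t]] exI[of _ "\<lambda>x. x"]
            bexI[OF _ V.R.one_closed] conjI ballI linear_map_id)
          fix x assume "x \<in> carrier V"
          then have x: "C x \<in> ?T m" by (rule vertex_ctx_trees(2)[OF C])
          show g: "graft (C x) i t \<in> ?T (m + n - 1)" by (rule graft_trees[OF x t i])
          show "?p m n i (basis_vec K (C x)) (basis_vec K t)
              = \<one>\<^bsub>K\<^esub> \<odot>\<^bsub>free_mod K (?T (m + n - 1))\<^esub> basis_vec K (graft (C x) i t)"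
            by (simp only: pb[OF i x t] module.smult_one[OF M basis_vec_closed[OF K g]])
        qed
      qed
      \<comment> \<open>From trees to arbitrary \<open>b\<close>: the elements whose composite with
        \<open>a\<close> is a relation form a submodule containing the basis.\<close>
      then have "b \<in> {b \<in> carrier (free_mod K (?T n)). ?p m n i a b \<in> multilinear_rels K V (m + n - 1)}"
        using pr[OF i submodule_carrier[OF M L a], of n] b
        by (intro free_mod_span[OF K submodule_vimage[OF M M _ L] _ b])
          (auto intro: basis_vec_closed[OF K])
      then show "?p m n i a b \<in> multilinear_rels K V (m + n - 1)" by simp
    next
      assume "1 \<le> i \<and> i \<le> m \<and> a \<in> carrier (free_mod K (?T m)) \<and> b \<in> multilinear_rels K V n"
      then have i: "1 \<le> i" "i \<le> m" and b: "b \<in> multilinear_rels K V n"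
        and a: "a \<in> carrier (free_mod K (?T m))" by auto
      have "?p m n i (basis_vec K t) b \<in> multilinear_rels K V (m + n - 1)" if t: "t \<in> ?T m" for t
      proof (rule multilinear_rels_image[OF V V pr[OF i basis_vec_closed[OF K t]] _ b])
        fix C \<omega> assume C: "C \<in> vertex_ctx" "C \<omega> \<in> ?T n"
        show "\<exists>C'\<in>vertex_ctx. \<exists>\<sigma>. \<exists>e\<in>carrier K. linear_map K V V \<sigma> \<and>
          (\<forall>x\<in>carrier V. C' (\<sigma> x) \<in> ?T (m + n - 1) \<and>
            ?p m n i (basis_vec K t) (basis_vec K (C x))
            = e \<odot>\<^bsub>free_mod K (?T (m + n - 1))\<^esub> basis_vec K (C' (\<sigma> x)))"
        proof (intro bexI[OF _ vertex_ctx_graft_right[OF C(1), of t i]] exI[of _ "\<lambda>x. x"]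
            bexI[OF _ V.R.one_closed] conjI ballI linear_map_id)
          fix x assume "x \<in> carrier V"
          then have x: "C x \<in> ?T n" by (rule vertex_ctx_trees(2)[OF C])
          show g: "graft t i (C x) \<in> ?T (m + n - 1)" by (rule graft_trees[OF t x i])
          show "?p m n i (basis_vec K t) (basis_vec K (C x))
              = \<one>\<^bsub>K\<^esub> \<odot>\<^bsub>free_mod K (?T (m + n - 1))\<^esub> basis_vec K (graft t i (C x))"
            by (simp only: pb[OF i t x] module.smult_one[OF M basis_vec_closed[OF K g]])
        qed
      qed
      then have "a \<in> {a \<in> carrier (free_mod K (?T m)). ?p m n i a b \<in> multilinear_rels K V (m + n - 1)}"
        using pl[OF i submodule_carrier[OF M L b]] a
        by (intro free_mod_span[OF K submodule_vimage[OF M M _ L] _ a])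
          (auto intro: basis_vec_closed[OF K])
      then show "?p m n i a b \<in> multilinear_rels K V (m + n - 1)" by simp
    }
  qed
qed

lemma free_op_operad:
  assumes V: "module K V"
  shows "ns_operad K (free_op K V)"
proof -
  interpret V: module K V by (fact V)
  show ?thesis
    unfolding free_op_def
    by (rule quot_op_operad[OF tree_op_operad[OF V.R.cring_axioms] multilinear_rels_ideal[OF V]])
qed

lemma quadratic_op_operad:
  assumes "module K V" "R \<subseteq> carrier (component (free_op K V) 3)"
  shows "ns_operad K (quadratic_op K V R)"
  unfolding quadratic_op_def
  using free_op_operad[OF assms(1)] ns_operad.gen_ideal_ideal[OF free_op_operad[OF assms(1)] assms(2)]
  by (rule quot_op_operad)

section \<open>Relabelling\<close>

definition relabel ::
  "('k, 'r) ring_scheme \<Rightarrow> 'w set \<Rightarrow> ('v \<Rightarrow> 'w) \<Rightarrow> nat \<Rightarrow> ('v tree \<Rightarrow> 'k) \<Rightarrow> 'w tree \<Rightarrow> 'k" where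
  "relabel K Y \<sigma> n = lin_ext K (free_mod K (trees Y n)) (\<lambda>t. basis_vec K (map_tree \<sigma> t))"

lemma map_tree_trees:
  "t \<in> trees X n \<Longrightarrow> (\<And>x. x \<in> X \<Longrightarrow> \<sigma> x \<in> Y) \<Longrightarrow> map_tree \<sigma> t \<in> trees Y n"
  by (auto simp: trees_def tree.set_map)

lemma map_tree_graft: "map_tree f (graft s i t) = graft (map_tree f s) i (map_tree f t)"
  by (induction s arbitrary: i) auto

context
  fixes K :: "('k, 'r) ring_scheme" and X :: "'v set" and Y :: "'w set" and \<sigma> :: "'v \<Rightarrow> 'w"
  assumes K: "cring K" and \<sigma>: "\<And>x. x \<in> X \<Longrightarrow> \<sigma> x \<in> Y"
begin

lemma relabel_linear:
  "linear_map K (free_mod K (trees X n)) (free_mod K (trees Y n)) (relabel K Y \<sigma> n)"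
  unfolding relabel_def
  by (intro lin_ext_linear[OF K free_mod_module[OF K]] basis_vec_closed[OF K])
    (rule map_tree_trees[OF _ \<sigma>])

lemma relabel_basis_vec:
  "t \<in> trees X n \<Longrightarrow> relabel K Y \<sigma> n (basis_vec K t) = basis_vec K (map_tree \<sigma> t)"
  unfolding relabel_def
  by (rule lin_ext_basis_vec[OF K free_mod_module[OF K] basis_vec_closed[OF K map_tree_trees[OF _ \<sigma>]]])

text \<open>By bilinearity of composition everything comes down to
  \<open>map_tree_graft\<close>.\<close>

lemma relabel_hom: "ns_hom K (tree_op K X) (tree_op K Y) (relabel K Y \<sigma>)"
  unfolding ns_hom_def tree_op_simps(1,2)[OF K]
proof (intro conjI allI impI ballI)
  let ?F = "\<lambda>n. free_mod K (trees X n)" and ?G = "\<lambda>n. free_mod K (trees Y n)"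
  note M = free_mod_module[OF K]
  note pl = tree_pcomp_linear_left[OF K] and pr = tree_pcomp_linear_right[OF K]
  note cl = linear_map_closed[OF relabel_linear]
  show "linear_map K (?F n) (?G n) (relabel K Y \<sigma> n)" for n by (rule relabel_linear)
  show "relabel K Y \<sigma> 1 (basis_vec K Leaf) = basis_vec K Leaf"
    by (simp add: relabel_basis_vec[OF Leaf_trees[OF K]])
  fix m n i :: nat and a b
  assume "1 \<le> i \<and> i \<le> m" and a: "a \<in> carrier (?F m)" and b: "b \<in> carrier (?F n)"
  then have i: "1 \<le> i" "i \<le> m" by auto
  show "relabel K Y \<sigma> (m + n - 1) (pcomp (tree_op K X) m n i a b)
      = pcomp (tree_op K Y) m n i (relabel K Y \<sigma> m a) (relabel K Y \<sigma> n b)"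
  proof (rule free_mod_ext[OF K M _ _ _ a])
    show "linear_map K (?F m) (?G (m + n - 1))
        (\<lambda>a. relabel K Y \<sigma> (m + n - 1) (pcomp (tree_op K X) m n i a b))"
      by (rule linear_map_comp[OF pl[OF i b] relabel_linear])
    show "linear_map K (?F m) (?G (m + n - 1))
        (\<lambda>a. pcomp (tree_op K Y) m n i (relabel K Y \<sigma> m a) (relabel K Y \<sigma> n b))"
      by (rule linear_map_comp[OF relabel_linear pl[OF i cl[OF b]]])
    fix s assume s: "s \<in> trees X m"
    note s' = basis_vec_closed[OF K s]
    show "relabel K Y \<sigma> (m + n - 1) (pcomp (tree_op K X) m n i (basis_vec K s) b)
        = pcomp (tree_op K Y) m n i (relabel K Y \<sigma> m (basis_vec K s)) (relabel K Y \<sigma> n b)"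
    proof (rule free_mod_ext[OF K M _ _ _ b])
      show "linear_map K (?F n) (?G (m + n - 1))
          (\<lambda>b. relabel K Y \<sigma> (m + n - 1) (pcomp (tree_op K X) m n i (basis_vec K s) b))"
        by (rule linear_map_comp[OF pr[OF i s'] relabel_linear])
      show "linear_map K (?F n) (?G (m + n - 1))
          (\<lambda>b. pcomp (tree_op K Y) m n i (relabel K Y \<sigma> m (basis_vec K s)) (relabel K Y \<sigma> n b))"
        by (rule linear_map_comp[OF relabel_linear pr[OF i cl[OF s']]])
      fix t assume t: "t \<in> trees X n"
      show "relabel K Y \<sigma> (m + n - 1) (pcomp (tree_op K X) m n i (basis_vec K s) (basis_vec K t))
          = pcomp (tree_op K Y) m n i (relabel K Y \<sigma> m (basis_vec K s)) (relabel K Y \<sigma> n (basis_vec K t))"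
        by (simp only: tree_pcomp_basis[OF K i s t] relabel_basis_vec[OF s] relabel_basis_vec[OF t]
            relabel_basis_vec[OF graft_trees[OF s t i]] map_tree_graft
            tree_pcomp_basis[OF K i map_tree_trees[OF s \<sigma>] map_tree_trees[OF t \<sigma>]])
    qed
  qed
qed

end

lemma relabel_inverse:
  assumes K: "cring K" and \<sigma>: "\<And>x. x \<in> X \<Longrightarrow> \<sigma> x \<in> Y" and \<tau>: "\<And>y. y \<in> Y \<Longrightarrow> \<tau> y \<in> X"
    and inv: "\<And>x. x \<in> X \<Longrightarrow> \<tau> (\<sigma> x) = x" and a: "a \<in> carrier (free_mod K (trees X n))"
  shows "relabel K X \<tau> n (relabel K Y \<sigma> n a) = a"
proof (rule free_mod_ext[OF K free_mod_module[OF K] _ linear_map_id _ a])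
  show "linear_map K (free_mod K (trees X n)) (free_mod K (trees X n))
      (\<lambda>a. relabel K X \<tau> n (relabel K Y \<sigma> n a))"
    by (rule linear_map_comp[OF relabel_linear[OF K \<sigma>] relabel_linear[OF K \<tau>]])
  fix t assume t: "t \<in> trees X n"
  have "map_tree \<tau> (map_tree \<sigma> t) = map_tree (\<lambda>x. x) t"
    unfolding tree.map_comp using t inv by (intro tree.map_cong refl) (auto simp: trees_def)
  then have "map_tree \<tau> (map_tree \<sigma> t) = t" by (simp add: tree.map_ident)
  then show "relabel K X \<tau> n (relabel K Y \<sigma> n (basis_vec K t)) = basis_vec K t"
    by (simp add: relabel_basis_vec[OF K \<sigma>] relabel_basis_vec[OF K \<tau>] t map_tree_trees[OF t \<sigma>])
qed

lemma relabel_multilinear_rels: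
  assumes V: "module K V" and W: "module K W" and \<sigma>: "linear_map K V W \<sigma>"
    and a: "a \<in> multilinear_rels K V n"
  shows "relabel K (carrier W) \<sigma> n a \<in> multilinear_rels K W n"
proof -
  interpret V: module K V by (fact V)
  note K = V.R.cring_axioms and \<sigma>' = linear_map_closed[OF \<sigma>]
  show ?thesis
  proof (rule multilinear_rels_image[OF V W relabel_linear[OF K \<sigma>'] _ a])
    fix C \<omega> assume C: "C \<in> vertex_ctx" "C \<omega> \<in> trees (carrier V) n"
    obtain D where D: "D \<in> vertex_ctx" "\<And>x. map_tree \<sigma> (C x) = D (\<sigma> x)"
      using vertex_ctx_map_tree[OF C(1)] by blast
    show "\<exists>C'\<in>vertex_ctx. \<exists>\<sigma>'. \<exists>e\<in>carrier K. linear_map K V W \<sigma>' \<and>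
      (\<forall>x\<in>carrier V. C' (\<sigma>' x) \<in> trees (carrier W) n \<and>
        relabel K (carrier W) \<sigma> n (basis_vec K (C x))
          = e \<odot>\<^bsub>free_mod K (trees (carrier W) n)\<^esub> basis_vec K (C' (\<sigma>' x)))"
    proof (intro bexI[OF _ D(1)] exI[of _ \<sigma>] bexI[OF _ V.R.one_closed] conjI ballI \<sigma>)
      fix x assume "x \<in> carrier V"
      then have x: "C x \<in> trees (carrier V) n" by (rule vertex_ctx_trees(2)[OF C])
      have "map_tree \<sigma> (C x) \<in> trees (carrier W) n" by (rule map_tree_trees[OF x \<sigma>'])
      then show t: "D (\<sigma> x) \<in> trees (carrier W) n" by (simp add: D(2))
      show "relabel K (carrier W) \<sigma> n (basis_vec K (C x))
          = \<one>\<^bsub>K\<^esub> \<odot>\<^bsub>free_mod K (trees (carrier W) n)\<^esub> basis_vec K (D (\<sigma> x))"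
        by (simp only: relabel_basis_vec[OF K \<sigma>' x] D(2)
            module.smult_one[OF free_mod_module[OF K] basis_vec_closed[OF K t]])
    qed
  qed
qed

definition free_relabel ::
  "('k, 'r) ring_scheme \<Rightarrow> ('k, 'w, 'm) module_scheme \<Rightarrow> ('v \<Rightarrow> 'w) \<Rightarrow> nat
    \<Rightarrow> ('v tree \<Rightarrow> 'k) set \<Rightarrow> ('w tree \<Rightarrow> 'k) set" where
  "free_relabel K W \<sigma> n =
    quot_map (free_mod K (trees (carrier W) n)) (multilinear_rels K W n) (relabel K (carrier W) \<sigma> n)"

lemma free_op_component:
  "component (free_op K V) n
    = quot_mod (free_mod K (trees (carrier V) n)) (multilinear_rels K V n)"
  by (simp add: free_op_def quot_op_def tree_op_def)

text \<open>Functoriality of the free operad in its space of operations, for a pair of inverse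
  linear maps.\<close>

lemma free_relabel_iso:
  assumes V: "module K V" and W: "module K W"
    and \<sigma>: "linear_map K V W \<sigma>" and \<tau>: "linear_map K W V \<tau>"
    and inv: "\<And>x. x \<in> carrier V \<Longrightarrow> \<tau> (\<sigma> x) = x" "\<And>y. y \<in> carrier W \<Longrightarrow> \<sigma> (\<tau> y) = y"
  shows "ns_iso_pair K (free_op K V) (free_op K W) (free_relabel K W \<sigma>) (free_relabel K V \<tau>)"
proof -
  interpret V: module K V by (fact V)
  note K = V.R.cring_axioms and cl = linear_map_closed[OF \<sigma>] linear_map_closed[OF \<tau>]
  have "ns_iso_pair K (tree_op K (carrier V)) (tree_op K (carrier W))
      (relabel K (carrier W) \<sigma>) (relabel K (carrier V) \<tau>)"
    unfolding ns_iso_pair_def tree_op_simps(1)[OF K]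
    using cl inv by (intro conjI allI ballI relabel_hom[OF K] relabel_inverse[OF K])
  then show ?thesis
    unfolding free_op_def free_relabel_def tree_op_simps(1)[OF K, symmetric]
    using relabel_multilinear_rels[OF V W \<sigma>] relabel_multilinear_rels[OF W V \<tau>]
    by (intro ns_iso_pair_quot tree_op_operad[OF K] multilinear_rels_ideal V W)
qed

text \<open>Both ideals are generated in arity 3, so arity 3 decides. A relator only has to land in
  the ideal generated by the other side, not among its relators; this absorbs the difference between
  a set of relators and its span.\<close>

lemma quadratic_op_iso:
  assumes V: "module K V" and W: "module K W"
    and iso: "ns_iso_pair K (free_op K V) (free_op K W) \<phi> \<psi>"
    and R: "R \<subseteq> carrier (component (free_op K V) 3)" and S: "S \<subseteq> carrier (component (free_op K W) 3)"
    and RS: "\<And>r. r \<in> R \<Longrightarrow> \<phi> 3 r \<in> gen_ideal K (free_op K W) 3 S 3"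
    and SR: "\<And>s. s \<in> S \<Longrightarrow> \<psi> 3 s \<in> gen_ideal K (free_op K V) 3 R 3"
  shows "ns_isomorphic K (quadratic_op K V R) (quadratic_op K W S)"
proof -
  note ops = free_op_operad[OF V] free_op_operad[OF W]
  note ids = ns_operad.gen_ideal_ideal[OF ops(1) R] ns_operad.gen_ideal_ideal[OF ops(2) S]
  from iso have homs: "ns_hom K (free_op K V) (free_op K W) \<phi>"
    "ns_hom K (free_op K W) (free_op K V) \<psi>"
    by (auto simp: ns_iso_pair_def)
  from iso have "ns_iso_pair K (quadratic_op K V R) (quadratic_op K W S)
      (\<lambda>n. quot_map (component (free_op K W) n) (gen_ideal K (free_op K W) 3 S n) (\<phi> n))
      (\<lambda>n. quot_map (component (free_op K V) n) (gen_ideal K (free_op K V) 3 R n) (\<psi> n))"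
    unfolding quadratic_op_def
    using gen_ideal_image[OF ops homs(1) ids(2) R RS] gen_ideal_image[OF ops(2,1) homs(2) ids(1) S SR]
    by (intro ns_iso_pair_quot ops ids)
  then show ?thesis
    unfolding ns_isomorphic_def
    using quadratic_op_operad[OF V R] quadratic_op_operad[OF W S] ns_iso_pair_isos by blast
qed

section \<open>Tensor products\<close>

text \<open>The four families of generators inside \<open>bilinear_rels\<close>, as an inductive set
  so that membership can be split by cases and proved by introduction rules.\<close>

inductive_set bilinear_gens ::
  "('k, 'r) ring_scheme \<Rightarrow> ('k, 'v, 'm) module_scheme \<Rightarrow> ('k, 'w, 'n) module_scheme
    \<Rightarrow> ('v \<times> 'w \<Rightarrow> 'k) set" for K V W where
  add1: "v \<in> carrier V \<Longrightarrow> w \<in> carrier W \<Longrightarrow> v' \<in> carrier V \<Longrightarrow>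
    basis_vec K (v \<oplus>\<^bsub>V\<^esub> v', w) \<ominus>\<^bsub>free_mod K (carrier V \<times> carrier W)\<^esub>
      (basis_vec K (v, w) \<oplus>\<^bsub>free_mod K (carrier V \<times> carrier W)\<^esub> basis_vec K (v', w))
    \<in> bilinear_gens K V W"
| add2: "v \<in> carrier V \<Longrightarrow> w \<in> carrier W \<Longrightarrow> w' \<in> carrier W \<Longrightarrow>
    basis_vec K (v, w \<oplus>\<^bsub>W\<^esub> w') \<ominus>\<^bsub>free_mod K (carrier V \<times> carrier W)\<^esub>
      (basis_vec K (v, w) \<oplus>\<^bsub>free_mod K (carrier V \<times> carrier W)\<^esub> basis_vec K (v, w'))
    \<in> bilinear_gens K V W"
| smult1: "v \<in> carrier V \<Longrightarrow> w \<in> carrier W \<Longrightarrow> c \<in> carrier K \<Longrightarrow>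
    basis_vec K (c \<odot>\<^bsub>V\<^esub> v, w) \<ominus>\<^bsub>free_mod K (carrier V \<times> carrier W)\<^esub>
      c \<odot>\<^bsub>free_mod K (carrier V \<times> carrier W)\<^esub> basis_vec K (v, w)
    \<in> bilinear_gens K V W"
| smult2: "v \<in> carrier V \<Longrightarrow> w \<in> carrier W \<Longrightarrow> c \<in> carrier K \<Longrightarrow>
    basis_vec K (v, c \<odot>\<^bsub>W\<^esub> w) \<ominus>\<^bsub>free_mod K (carrier V \<times> carrier W)\<^esub>
      c \<odot>\<^bsub>free_mod K (carrier V \<times> carrier W)\<^esub> basis_vec K (v, w)
    \<in> bilinear_gens K V W"

lemma bilinear_rels_gens:
  "bilinear_rels K V W
    = gen_submodule K (free_mod K (carrier V \<times> carrier W)) (bilinear_gens K V W)"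
  unfolding bilinear_rels_def Let_def
proof (rule arg_cong[where f = "gen_submodule K _"], intro equalityI subsetI, goal_cases)
  case (1 x)
  then show ?case
    by (elim UnE CollectE exE conjE) (hypsubst, rule bilinear_gens.intros, assumption+)+
next
  case (2 x)
  then show ?case
  proof cases
    case (add1 v w v')
    then show ?thesis
      by - (rule UnI1, rule UnI1, rule UnI1,
        intro CollectI exI[of _ v] exI[of _ v'] exI[of _ w] conjI)
  next
    case (add2 v w w')
    then show ?thesis
      by - (rule UnI1, rule UnI1, rule UnI2,
        intro CollectI exI[of _ v] exI[of _ w] exI[of _ w'] conjI)
  next
    case (smult1 v w c)
    then show ?thesis
      by - (rule UnI1, rule UnI2, intro CollectI exI[of _ c] exI[of _ v] exI[of _ w] conjI)
  next
    case (smult2 v w c)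
    then show ?thesis
      by - (rule UnI2, intro CollectI exI[of _ c] exI[of _ v] exI[of _ w] conjI)
  qed
qed

section \<open>The exchange of tensor factors\<close>

definition swap_pairs ::
  "('k, 'r) ring_scheme \<Rightarrow> ('k, 'v, 'm) module_scheme \<Rightarrow> ('k, 'w, 'n) module_scheme
    \<Rightarrow> ('v \<times> 'w \<Rightarrow> 'k) \<Rightarrow> 'w \<times> 'v \<Rightarrow> 'k" where
  "swap_pairs K V W = lin_ext K (free_mod K (carrier W \<times> carrier V)) (\<lambda>p. basis_vec K (prod.swap p))"

definition tensor_swap ::
  "('k, 'r) ring_scheme \<Rightarrow> ('k, 'v, 'm) module_scheme \<Rightarrow> ('k, 'w, 'n) module_scheme
    \<Rightarrow> ('v \<times> 'w \<Rightarrow> 'k) set \<Rightarrow> ('w \<times> 'v \<Rightarrow> 'k) set" where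
  "tensor_swap K V W =
    quot_map (free_mod K (carrier W \<times> carrier V)) (bilinear_rels K W V) (swap_pairs K V W)"

context
  fixes K :: "('k, 'r) ring_scheme"
    and V :: "('k, 'v, 'm) module_scheme" and W :: "('k, 'w, 'n) module_scheme"
  assumes V: "module K V" and W: "module K W"
begin

interpretation V: module K V by (fact V)
interpretation W: module K W by (fact W)

interpretation F: module K "free_mod K (carrier V \<times> carrier W)"
  by (rule free_mod_module[OF V.R.cring_axioms])

private lemma basis_pair_closed: "v \<in> carrier V \<Longrightarrow> w \<in> carrier W
    \<Longrightarrow> basis_vec K (v, w) \<in> carrier (free_mod K (carrier V \<times> carrier W))"
  by (rule basis_vec_closed[OF V.R.cring_axioms]) simp

lemma bilinear_gens_subset: "bilinear_gens K V W \<subseteq> carrier (free_mod K (carrier V \<times> carrier W))"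
proof
  fix x assume "x \<in> bilinear_gens K V W"
  then show "x \<in> carrier (free_mod K (carrier V \<times> carrier W))"
    by cases (simp_all only: F.M.minus_closed F.M.a_closed F.smult_closed basis_pair_closed
        V.M.a_closed W.M.a_closed V.smult_closed W.smult_closed)
qed

lemma bilinear_rels_submodule:
  "submodule (bilinear_rels K V W) K (free_mod K (carrier V \<times> carrier W))"
  unfolding bilinear_rels_gens by (rule gen_submodule_submodule[OF F.module_axioms bilinear_gens_subset])

private lemma bilinear_relsI: "x \<in> bilinear_gens K V W \<Longrightarrow> x \<in> bilinear_rels K V W"
  unfolding bilinear_rels_gens by (rule subsetD[OF gen_submodule_incl])

lemma tensor_module: "module K (tensor K V W)"
  unfolding tensor_def by (rule quot_mod_module[OF F.module_axioms bilinear_rels_submodule])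

lemma pure_tensor_closed:
  "v \<in> carrier V \<Longrightarrow> w \<in> carrier W \<Longrightarrow> pure_tensor K V W v w \<in> carrier (tensor K V W)"
  unfolding tensor_def pure_tensor_def by (rule quot_mod_closed[OF F.module_axioms bilinear_rels_submodule basis_pair_closed])

text \<open>Cosets are equal when their difference is a relation, and the differences arising here
  are generators themselves.\<close>

lemma pure_tensor_linear_left:
  assumes w: "w \<in> carrier W"
  shows "linear_map K V (tensor K V W) (\<lambda>v. pure_tensor K V W v w)"
proof (rule linear_mapI)
  note c = coset_eq_iff[OF F.module_axioms bilinear_rels_submodule] and g = bilinear_gens.intros
  fix v assume v: "v \<in> carrier V"
  show "pure_tensor K V W v w \<in> carrier (tensor K V W)" by (rule pure_tensor_closed[OF v w])
  show "pure_tensor K V W (v \<oplus>\<^bsub>V\<^esub> v') w = pure_tensor K V W v w \<oplus>\<^bsub>tensor K V W\<^esub> pure_tensor K V W v' w"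
    if v': "v' \<in> carrier V" for v'
    unfolding pure_tensor_def tensor_def quot_mod_add[OF F.module_axioms bilinear_rels_submodule basis_pair_closed[OF v w] basis_pair_closed[OF v' w]]
    by (subst c) (use v v' w in \<open>simp_all add: basis_pair_closed bilinear_relsI[OF g(1)[OF v w v']]\<close>)
  show "pure_tensor K V W (c \<odot>\<^bsub>V\<^esub> v) w = c \<odot>\<^bsub>tensor K V W\<^esub> pure_tensor K V W v w"
    if k: "c \<in> carrier K" for c
    unfolding pure_tensor_def tensor_def quot_mod_smult[OF F.module_axioms bilinear_rels_submodule k basis_pair_closed[OF v w]]
    by (subst c) (use v k w in \<open>simp_all add: basis_pair_closed bilinear_relsI[OF g(3)[OF v w k]]\<close>)
qed

lemma pure_tensor_linear_right:
  assumes v: "v \<in> carrier V"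
  shows "linear_map K W (tensor K V W) (pure_tensor K V W v)"
proof (rule linear_mapI)
  note c = coset_eq_iff[OF F.module_axioms bilinear_rels_submodule] and g = bilinear_gens.intros
  fix w assume w: "w \<in> carrier W"
  show "pure_tensor K V W v w \<in> carrier (tensor K V W)" by (rule pure_tensor_closed[OF v w])
  show "pure_tensor K V W v (w \<oplus>\<^bsub>W\<^esub> w') = pure_tensor K V W v w \<oplus>\<^bsub>tensor K V W\<^esub> pure_tensor K V W v w'"
    if w': "w' \<in> carrier W" for w'
    unfolding pure_tensor_def tensor_def quot_mod_add[OF F.module_axioms bilinear_rels_submodule basis_pair_closed[OF v w] basis_pair_closed[OF v w']]
    by (subst c) (use v w' w in \<open>simp_all add: basis_pair_closed bilinear_relsI[OF g(2)[OF v w w']]\<close>)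
  show "pure_tensor K V W v (c \<odot>\<^bsub>W\<^esub> w) = c \<odot>\<^bsub>tensor K V W\<^esub> pure_tensor K V W v w"
    if k: "c \<in> carrier K" for c
    unfolding pure_tensor_def tensor_def quot_mod_smult[OF F.module_axioms bilinear_rels_submodule k basis_pair_closed[OF v w]]
    by (subst c) (use v k w in \<open>simp_all add: basis_pair_closed bilinear_relsI[OF g(4)[OF v w k]]\<close>)
qed

lemma swap_pairs_linear:
  "linear_map K (free_mod K (carrier V \<times> carrier W)) (free_mod K (carrier W \<times> carrier V)) (swap_pairs K V W)"
  unfolding swap_pairs_def
proof (rule lin_ext_linear[OF V.R.cring_axioms free_mod_module[OF V.R.cring_axioms]])
  fix p assume "p \<in> carrier V \<times> carrier W"
  then show "basis_vec K (prod.swap p) \<in> carrier (free_mod K (carrier W \<times> carrier V))"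
    by (intro basis_vec_closed[OF V.R.cring_axioms]) (cases p, simp)
qed

lemma swap_pairs_basis_vec:
  assumes "v \<in> carrier V" "w \<in> carrier W"
  shows "swap_pairs K V W (basis_vec K (v, w)) = basis_vec K (w, v)"
proof -
  have "basis_vec K (prod.swap p) \<in> carrier (free_mod K (carrier W \<times> carrier V))"
    if "p \<in> carrier V \<times> carrier W" for p
    by (rule basis_vec_closed[OF V.R.cring_axioms]) (use that in \<open>cases p, simp\<close>)
  moreover have "(v, w) \<in> carrier V \<times> carrier W" using assms by simp
  ultimately have "swap_pairs K V W (basis_vec K (v, w)) = basis_vec K (prod.swap (v, w))"
    unfolding swap_pairs_def
    by (rule lin_ext_basis_vec[OF V.R.cring_axioms free_mod_module[OF V.R.cring_axioms]])
  then show ?thesis by simp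
qed

end

context
  fixes K :: "('k, 'r) ring_scheme"
    and V :: "('k, 'v, 'm) module_scheme" and W :: "('k, 'w, 'n) module_scheme"
  assumes V: "module K V" and W: "module K W"
begin

interpretation V: module K V by (fact V)
interpretation W: module K W by (fact W)

interpretation F: module K "free_mod K (carrier V \<times> carrier W)" by (rule free_mod_module[OF V.R.cring_axioms])
interpretation G: module K "free_mod K (carrier W \<times> carrier V)" by (rule free_mod_module[OF V.R.cring_axioms])

text \<open>The exchange turns the additivity and scaling generators of one factor into those of the
  other, so it even maps generators to generators.\<close>

lemma swap_pairs_bilinear_rels:
  assumes "x \<in> bilinear_rels K V W"
  shows "swap_pairs K V W x \<in> bilinear_rels K W V"
proof (rule gen_submodule_image[OF F.module_axioms G.module_axioms swap_pairs_linear[OF V W] bilinear_rels_submodule[OF W V]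
      bilinear_gens_subset[OF V W] _ assms[unfolded bilinear_rels_gens]])
  have \<delta>: "basis_vec K (v, w) \<in> carrier (free_mod K (carrier V \<times> carrier W))"
    "basis_vec K (w, v) \<in> carrier (free_mod K (carrier W \<times> carrier V))"
    if "v \<in> carrier V" "w \<in> carrier W" for v w
    using that by (auto intro: basis_vec_closed[OF V.R.cring_axioms])
  fix x assume "x \<in> bilinear_gens K V W"
  then have "swap_pairs K V W x \<in> bilinear_gens K W V"
    by (cases rule: bilinear_gens.cases)
      (simp_all add: linear_map_minus[OF F.module_axioms G.module_axioms swap_pairs_linear[OF V W]]
        linear_mapD[OF swap_pairs_linear[OF V W]] swap_pairs_basis_vec[OF V W] \<delta> bilinear_gens.intros)
  then show "swap_pairs K V W x \<in> bilinear_rels K W V"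
    unfolding bilinear_rels_gens by (rule subsetD[OF gen_submodule_incl])
qed

lemma tensor_swap_linear: "linear_map K (tensor K V W) (tensor K W V) (tensor_swap K V W)"
  unfolding tensor_def tensor_swap_def
  by (rule linear_map_quot_map[OF F.module_axioms bilinear_rels_submodule[OF V W] G.module_axioms
        bilinear_rels_submodule[OF W V] swap_pairs_linear[OF V W] swap_pairs_bilinear_rels])

lemma tensor_swap_coset:
  assumes "a \<in> carrier (free_mod K (carrier V \<times> carrier W))"
  shows "tensor_swap K V W (bilinear_rels K V W +>\<^bsub>free_mod K (carrier V \<times> carrier W)\<^esub> a)
    = bilinear_rels K W V +>\<^bsub>free_mod K (carrier W \<times> carrier V)\<^esub> swap_pairs K V W a"
  unfolding tensor_swap_def
  by (rule quot_map_coset[OF F.module_axioms bilinear_rels_submodule[OF V W] G.module_axioms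
        bilinear_rels_submodule[OF W V] swap_pairs_linear[OF V W] swap_pairs_bilinear_rels assms])

lemma tensor_swap_pure:
  assumes "v \<in> carrier V" "w \<in> carrier W"
  shows "tensor_swap K V W (pure_tensor K V W v w) = pure_tensor K W V w v"
  unfolding pure_tensor_def using assms
  by (simp add: tensor_swap_coset basis_vec_closed[OF V.R.cring_axioms] swap_pairs_basis_vec[OF V W])

end

lemma tensor_swap_swap:
  assumes V: "module K V" and W: "module K W" and x: "x \<in> carrier (tensor K V W)"
  shows "tensor_swap K W V (tensor_swap K V W x) = x"
proof -
  interpret V: module K V by (fact V)
  note K = V.R.cring_axioms
  note F = free_mod_module[OF K]
  obtain a where a: "a \<in> carrier (free_mod K (carrier V \<times> carrier W))"
    "x = bilinear_rels K V W +>\<^bsub>free_mod K (carrier V \<times> carrier W)\<^esub> a"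
    using x unfolding tensor_def by (rule quot_modE[OF F bilinear_rels_submodule[OF V W]])
  have "swap_pairs K W V (swap_pairs K V W a) = a"
  proof (rule free_mod_ext[OF K F _ linear_map_id _ a(1)])
    show "linear_map K (free_mod K (carrier V \<times> carrier W)) (free_mod K (carrier V \<times> carrier W))
        (\<lambda>a. swap_pairs K W V (swap_pairs K V W a))"
      by (rule linear_map_comp[OF swap_pairs_linear[OF V W] swap_pairs_linear[OF W V]])
    show "swap_pairs K W V (swap_pairs K V W (basis_vec K p)) = basis_vec K p"
      if "p \<in> carrier V \<times> carrier W" for p
      using that by (cases p) (simp add: swap_pairs_basis_vec[OF V W] swap_pairs_basis_vec[OF W V])
  qed
  then show ?thesis
    unfolding a(2) tensor_swap_coset[OF V W a(1)]
    by (simp add: tensor_swap_coset[OF W V] linear_map_closed[OF swap_pairs_linear[OF V W] a(1)])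
qed

section \<open>Trisuccessors of trees\<close>

lemma trees_3_cases:
  assumes "t \<in> trees X 3"
  obtains \<omega> \<nu> where "\<omega> \<in> X" "\<nu> \<in> X" "t = tree1 \<omega> \<nu>"
    | \<omega> \<nu> where "\<omega> \<in> X" "\<nu> \<in> X" "t = tree2 \<omega> \<nu>"
proof -
  have leaf: "u = Leaf" if "size1 u = 1" for u :: "'a tree"
  proof (cases u)
    case (Node l a r)
    then show ?thesis using that size1_pos[of l] size1_pos[of r] by simp
  qed
  have two: "\<exists>\<nu>. u = Node Leaf \<nu> Leaf" if "size1 u = 2" for u :: "'a tree"
  proof (cases u)
    case (Node l a r)
    then have "size1 l = 1" "size1 r = 1" using that size1_pos[of l] size1_pos[of r] by auto
    then show ?thesis using Node leaf by blast
  qed (use that in simp)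
  from assms have t: "size1 t = 3" "set_tree t \<subseteq> X" by (auto simp: trees_def)
  show thesis
  proof (cases t)
    case Leaf
    then show thesis using t by simp
  next
    case (Node l \<omega> r)
    then consider "size1 l = 2" "size1 r = 1" | "size1 l = 1" "size1 r = 2"
      using t size1_pos[of l] size1_pos[of r] by fastforce
    then show thesis
    proof cases
      case 1
      then obtain \<nu> where "l = Node Leaf \<nu> Leaf" "r = Leaf" using leaf two by blast
      then show thesis using that(1)[of \<omega> \<nu>] Node t by simp
    next
      case 2
      then obtain \<nu> where "l = Leaf" "r = Node Leaf \<nu> Leaf" using leaf two by blast
      then show thesis using that(2)[of \<omega> \<nu>] Node t by simp
    qed
  qed
qed

lemma trees_3_intros:
  "\<omega> \<in> X \<Longrightarrow> \<nu> \<in> X \<Longrightarrow> tree1 \<omega> \<nu> \<in> trees X 3"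
  "\<omega> \<in> X \<Longrightarrow> \<nu> \<in> X \<Longrightarrow> tree2 \<omega> \<nu> \<in> trees X 3"
  by (simp_all add: trees_def)

lemma vertex_ctx_Leaf: "C \<in> vertex_ctx \<Longrightarrow> C x \<noteq> Leaf"
  by (induction rule: vertex_ctx.induct) auto

lemma vertex_ctx_single:
  assumes "C \<in> vertex_ctx" "C x = Node Leaf \<nu> Leaf"
  shows "C = (\<lambda>x. Node Leaf x Leaf)"
  using assms
proof cases
  case (here l r)
  then show ?thesis using assms(2) by simp
next
  case (left C' a r)
  then show ?thesis using assms(2) vertex_ctx_Leaf[OF left(2), of x] by simp
next
  case (right C' l a)
  then show ?thesis using assms(2) vertex_ctx_Leaf[OF right(2), of x] by simp
qed

text \<open>The distinguished vertex is the root or the inner vertex of one of the two combs. The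
  cases determine \<open>C\<close> as a function and not only its value at \<open>x\<close>, as
  needed when \<open>psi_tree\<close> is evaluated at a varying label.\<close>

lemma vertex_ctx_3_cases:
  assumes C: "C \<in> vertex_ctx" "C x \<in> trees X 3"
  obtains a where "a \<in> X" "C = (\<lambda>x. tree1 x a)" | a where "a \<in> X" "C = (\<lambda>x. tree1 a x)"
    | a where "a \<in> X" "C = (\<lambda>x. tree2 x a)" | a where "a \<in> X" "C = (\<lambda>x. tree2 a x)"
  using C(1)
proof cases
  case (here l r)
  show thesis
    using C(2) by (rule trees_3_cases) (use here that(1,3) in auto)
next
  case (left C' a r)
  show thesis
    using C(2)
  proof (rule trees_3_cases)
    fix \<omega> \<nu> assume "\<omega> \<in> X" "\<nu> \<in> X" "C x = tree1 \<omega> \<nu>"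
    then have a: "a \<in> X" "r = Leaf" "C' x = Node Leaf \<nu> Leaf" using left by auto
    show thesis
      by (rule that(2)[OF a(1)]) (simp only: left(1) a(2) vertex_ctx_single[OF left(2) a(3)])
  next
    fix \<omega> \<nu> assume "C x = tree2 \<omega> \<nu>"
    then show thesis using left(1) vertex_ctx_Leaf[OF left(2), of x] by simp
  qed
next
  case (right C' l a)
  show thesis
    using C(2)
  proof (rule trees_3_cases)
    fix \<omega> \<nu> assume "\<omega> \<in> X" "\<nu> \<in> X" "C x = tree2 \<omega> \<nu>"
    then have a: "a \<in> X" "l = Leaf" "C' x = Node Leaf \<nu> Leaf" using right by auto
    show thesis
      by (rule that(4)[OF a(1)]) (simp only: right(1) a(2) vertex_ctx_single[OF right(2) a(3)])
  next
    fix \<omega> \<nu> assume "C x = tree1 \<omega> \<nu>"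
    then show thesis using right(1) vertex_ctx_Leaf[OF right(2), of x] by simp
  qed
qed

section \<open>Labels of the trisuccessor\<close>

lemma tri_space_module: "cring K \<Longrightarrow> module K (tri_space K)"
  unfolding tri_space_def by (rule free_mod_module)

lemma tri_basis_closed: "cring K \<Longrightarrow> basis_vec K d \<in> carrier (tri_space K)"
  unfolding tri_space_def by (rule basis_vec_closed) auto

lemma tri_star_closed:
  assumes "cring K"
  shows "tri_star K \<in> carrier (tri_space K)"
proof -
  interpret T: module K "tri_space K" by (rule tri_space_module[OF assms])
  show ?thesis unfolding tri_star_def by (simp add: tri_basis_closed[OF assms])
qed

text \<open>The label of a vertex through which paths of \<open>J\<close> turn left iff \<open>p\<close> and turn right iff \<open>q\<close>.\<close>

definition tsu_label ::
  "('k, 'r) ring_scheme \<Rightarrow> ('k, 'v, 'm) module_scheme \<Rightarrow> bool \<Rightarrow> bool \<Rightarrow> 'v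
    \<Rightarrow> ('v \<times> (tri \<Rightarrow> 'k) \<Rightarrow> 'k) set" where
  "tsu_label K V p q =
    (if p \<and> \<not> q then tri_label K V Prec else if \<not> p \<and> q then tri_label K V Succ
     else if p \<and> q then tri_label K V Dot else star_label K V)"

text \<open>The \<open>TriDend\<close> half of \<open>tsu_label\<close>: by
  \<open>tsu_label_eq\<close> the label is the tensor of \<omega> with this vector, which separates
  the dependence on \<open>J\<close> from the dependence on \<omega>.\<close>

definition tsu_vec :: "('k, 'r) ring_scheme \<Rightarrow> bool \<Rightarrow> bool \<Rightarrow> tri \<Rightarrow> 'k" where
  "tsu_vec K p q =
    (if p \<and> \<not> q then basis_vec K Prec else if \<not> p \<and> q then basis_vec K Succ
     else if p \<and> q then basis_vec K Dot else tri_star K)"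

text \<open>Condenses the case distinction of the defining equation into two truth values, so that
  linearity in \<omega> can be proved for all labels at once.\<close>

lemma tsu_tree_Node:
  "tsu_tree K V J (Node l \<omega> r) =
    Node (tsu_tree K V {j \<in> J. j \<le> size1 l} l)
      (tsu_label K V (\<exists>j\<in>J. j \<le> size1 l) (\<exists>j\<in>J. size1 l < j) \<omega>)
      (tsu_tree K V {j - size1 l | j. j \<in> J \<and> size1 l < j} r)"
  by (auto simp: Let_def tsu_label_def)

lemma size1_tsu_tree: "size1 (tsu_tree K V J t) = size1 t"
  by (induction t arbitrary: J) (simp_all add: tsu_tree_Node del: tsu_tree.simps(2))

text \<open>In the left comb the root separates leaves 1 and 2 from 3 and the inner vertex separates
  1 from 2; in the right comb the root separates 1 from 2 and 3, and the inner vertex 2 from 3. The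
  bound on \<open>J\<close> excludes numbers that are not leaves.\<close>

lemma tsu_tree_3:
  assumes "J \<subseteq> {1, 2, 3}"
  shows tsu_tree_tree1: "tsu_tree K V J (tree1 \<omega> \<nu>)
    = tree1 (tsu_label K V (1 \<in> J \<or> 2 \<in> J) (3 \<in> J) \<omega>) (tsu_label K V (1 \<in> J) (2 \<in> J) \<nu>)"
    and tsu_tree_tree2: "tsu_tree K V J (tree2 \<omega> \<nu>)
    = tree2 (tsu_label K V (1 \<in> J) (2 \<in> J \<or> 3 \<in> J) \<omega>) (tsu_label K V (2 \<in> J) (3 \<in> J) \<nu>)"
proof -
  have J: "(\<exists>j\<in>J. Q j) \<longleftrightarrow> 1 \<in> J \<and> Q 1 \<or> 2 \<in> J \<and> Q 2 \<or> 3 \<in> J \<and> Q 3" for Q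
    using assms by blast
  have JL: "(\<exists>j\<in>{j \<in> J. P j}. Q j) \<longleftrightarrow> (\<exists>j\<in>J. P j \<and> Q j)" for P Q by blast
  have JR: "(\<exists>j\<in>{j - k | j. j \<in> J \<and> k < j}. Q j) \<longleftrightarrow> (\<exists>j\<in>J. k < j \<and> Q (j - k))" for k Q
    by blast
  show "tsu_tree K V J (tree1 \<omega> \<nu>)
    = tree1 (tsu_label K V (1 \<in> J \<or> 2 \<in> J) (3 \<in> J) \<omega>) (tsu_label K V (1 \<in> J) (2 \<in> J) \<nu>)"
    "tsu_tree K V J (tree2 \<omega> \<nu>)
    = tree2 (tsu_label K V (1 \<in> J) (2 \<in> J \<or> 3 \<in> J) \<omega>) (tsu_label K V (2 \<in> J) (3 \<in> J) \<nu>)"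
    by (simp_all only: tsu_tree_Node tsu_tree.simps(1) JL JR J) simp_all
qed

definition tsu_lin ::
  "('k, 'r) ring_scheme \<Rightarrow> ('k, 'v, 'm) module_scheme \<Rightarrow> nat \<Rightarrow> nat set \<Rightarrow> ('v tree \<Rightarrow> 'k)
    \<Rightarrow> ('v \<times> (tri \<Rightarrow> 'k) \<Rightarrow> 'k) set tree \<Rightarrow> 'k" where
  "tsu_lin K V n J = lin_ext K (free_mod K (trees (carrier (tri_hat K V)) n))
    (\<lambda>t. basis_vec K (tsu_tree K V J t))"

context
  fixes K :: "('k, 'r) ring_scheme" and V :: "('k, 'v, 'm) module_scheme"
  assumes V: "module K V"
begin

interpretation V: module K V by (fact V)

lemma tri_hat_module: "module K (tri_hat K V)"
  unfolding tri_hat_def by (rule tensor_module[OF V tri_space_module[OF V.R.cring_axioms]])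

text \<open>Linearity of the tensor in its second factor makes the sum of three labels a pure
  tensor, so star vertices need no separate treatment.\<close>

lemma star_label_eq:
  assumes "\<omega> \<in> carrier V"
  shows "star_label K V \<omega> = pure_tensor K V (tri_space K) \<omega> (tri_star K)"
proof -
  note K = V.R.cring_axioms
  interpret T: module K "tri_space K" by (rule tri_space_module[OF K])
  note r = pure_tensor_linear_right[OF V tri_space_module[OF K] assms]
  show ?thesis
    unfolding star_label_def tri_star_def tri_label_def tri_hat_def
    by (simp add: linear_map_add[OF r] tri_basis_closed[OF K])
qed

lemma tsu_label_eq:
  "\<omega> \<in> carrier V \<Longrightarrow> tsu_label K V p q \<omega> = pure_tensor K V (tri_space K) \<omega> (tsu_vec K p q)"
  by (simp add: tsu_label_def tsu_vec_def star_label_eq tri_label_def)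

lemma tsu_vec_closed: "tsu_vec K p q \<in> carrier (tri_space K)"
  by (simp add: tsu_vec_def tri_basis_closed tri_star_closed V.R.cring_axioms)

lemma tsu_label_linear: "linear_map K V (tri_hat K V) (tsu_label K V p q)"
  using pure_tensor_linear_left[OF V tri_space_module[OF V.R.cring_axioms] tsu_vec_closed, of p q]
  unfolding tri_hat_def linear_map_def by (simp add: tsu_label_eq)

lemma tsu_tree_trees:
  assumes "t \<in> trees (carrier V) n"
  shows "tsu_tree K V J t \<in> trees (carrier (tri_hat K V)) n"
proof -
  have "set_tree t \<subseteq> carrier V \<Longrightarrow> set_tree (tsu_tree K V J t) \<subseteq> carrier (tri_hat K V)"
    by (induction t arbitrary: J)
      (simp_all add: tsu_tree_Node linear_map_closed[OF tsu_label_linear] del: tsu_tree.simps(2))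
  then show ?thesis using assms by (simp add: trees_def size1_tsu_tree)
qed

text \<open>The truth values at a vertex are read off from \<open>J\<close> and the sizes of
  subtrees, which no label affects. Hence the distinguished label enters the result only through the
  linear map \<open>tsu_label\<close>.\<close>

lemma vertex_ctx_tsu_tree:
  assumes "C \<in> vertex_ctx"
  shows "\<exists>C'\<in>vertex_ctx. \<exists>p q. \<forall>x. tsu_tree K V J (C x) = C' (tsu_label K V p q x)"
  using assms
proof (induction arbitrary: J rule: vertex_ctx.induct)
  case (here l r)
  show ?case
    unfolding tsu_tree_Node
    by (rule bexI[OF _ vertex_ctx.here[of "tsu_tree K V {j \<in> J. j \<le> size1 l} l"
            "tsu_tree K V {j - size1 l | j. j \<in> J \<and> size1 l < j} r"]])
      (intro exI[of _ "\<exists>j\<in>J. j \<le> size1 l"] exI[of _ "\<exists>j\<in>J. size1 l < j"] allI refl)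
next
  case (left C a r)
  \<comment> \<open>The left subtree contains the distinguished vertex, yet its number of leaves, at
    which \<open>J\<close> is split, is the same for all labels.\<close>
  define k where "k = size1 (C undefined)"
  have k: "size1 (C x) = k" for x
    unfolding k_def by (rule vertex_ctx_size1[OF left.hyps])
  obtain C' p q where C': "C' \<in> vertex_ctx"
    "\<And>x. tsu_tree K V {j \<in> J. j \<le> k} (C x) = C' (tsu_label K V p q x)"
    using left.IH by blast
  show ?case
    unfolding tsu_tree_Node k C'(2)
    by (rule bexI[OF _ vertex_ctx.left[OF C'(1)]], rule exI[of _ p], rule exI[of _ q], rule allI) (rule refl)
next
  case (right C l a)
  obtain C' p q where C': "C' \<in> vertex_ctx"
    "\<And>x. tsu_tree K V {j - size1 l | j. j \<in> J \<and> size1 l < j} (C x) = C' (tsu_label K V p q x)"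
    using right.IH by blast
  show ?case
    unfolding tsu_tree_Node C'(2)
    by (rule bexI[OF _ vertex_ctx.right[OF C'(1)]], rule exI[of _ p], rule exI[of _ q], rule allI) (rule refl)
qed

lemma tsu_lin_linear:
  "linear_map K (free_mod K (trees (carrier V) n)) (free_mod K (trees (carrier (tri_hat K V)) n)) (tsu_lin K V n J)"
  unfolding tsu_lin_def
  by (intro lin_ext_linear free_mod_module basis_vec_closed tsu_tree_trees V.R.cring_axioms)

lemma tsu_lin_basis_vec:
  assumes "t \<in> trees (carrier V) n"
  shows "tsu_lin K V n J (basis_vec K t) = basis_vec K (tsu_tree K V J t)"
  unfolding tsu_lin_def
  by (rule lin_ext_basis_vec[OF V.R.cring_axioms free_mod_module[OF V.R.cring_axioms] _ assms])
    (intro basis_vec_closed tsu_tree_trees V.R.cring_axioms)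

lemma tsu_lin_multilinear_rels:
  assumes "a \<in> multilinear_rels K V n"
  shows "tsu_lin K V n J a \<in> multilinear_rels K (tri_hat K V) n"
proof (rule multilinear_rels_image[OF V tri_hat_module tsu_lin_linear _ assms])
  let ?W = "tri_hat K V"
  fix C \<omega> assume C: "C \<in> vertex_ctx" "C \<omega> \<in> trees (carrier V) n"
  obtain D p q where D: "D \<in> vertex_ctx" "\<And>x. tsu_tree K V J (C x) = D (tsu_label K V p q x)"
    using vertex_ctx_tsu_tree[OF C(1)] by blast
  show "\<exists>C'\<in>vertex_ctx. \<exists>\<sigma>. \<exists>e\<in>carrier K. linear_map K V ?W \<sigma> \<and>
    (\<forall>x\<in>carrier V. C' (\<sigma> x) \<in> trees (carrier ?W) n \<and>
      tsu_lin K V n J (basis_vec K (C x)) = e \<odot>\<^bsub>free_mod K (trees (carrier ?W) n)\<^esub> basis_vec K (C' (\<sigma> x)))"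
  proof (intro bexI[OF _ D(1)] exI[of _ "tsu_label K V p q"] bexI[OF _ V.R.one_closed] conjI ballI
      tsu_label_linear)
    fix x assume "x \<in> carrier V"
    then have x: "C x \<in> trees (carrier V) n" by (rule vertex_ctx_trees(2)[OF C])
    have "tsu_tree K V J (C x) \<in> trees (carrier ?W) n" by (rule tsu_tree_trees[OF x])
    then show t: "D (tsu_label K V p q x) \<in> trees (carrier ?W) n" by (simp only: D(2))
    show "tsu_lin K V n J (basis_vec K (C x))
        = \<one>\<^bsub>K\<^esub> \<odot>\<^bsub>free_mod K (trees (carrier ?W) n)\<^esub> basis_vec K (D (tsu_label K V p q x))"
      by (simp only: tsu_lin_basis_vec[OF x] D(2) module.smult_one[OF free_mod_module[OF V.R.cring_axioms]
            basis_vec_closed[OF V.R.cring_axioms t]])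
  qed
qed

lemma tsu_coset:
  assumes "a \<in> carrier (free_mod K (trees (carrier V) n))"
  shows "tsu K V n J (multilinear_rels K V n +>\<^bsub>free_mod K (trees (carrier V) n)\<^esub> a)
    = multilinear_rels K (tri_hat K V) n +>\<^bsub>free_mod K (trees (carrier (tri_hat K V)) n)\<^esub> tsu_lin K V n J a"
  using quot_map_coset[OF free_mod_module[OF V.R.cring_axioms] multilinear_rels_submodule[OF V]
      free_mod_module[OF V.R.cring_axioms] multilinear_rels_submodule[OF tri_hat_module]
      tsu_lin_linear tsu_lin_multilinear_rels assms]
  by (simp add: quot_map_def tsu_def Let_def tsu_lin_def)

end

section \<open>The map \<open>\<Psi>\<close>\<close>

lemma vertex_ctx_3_intros:
  "(\<lambda>x. tree1 x a) \<in> vertex_ctx" "(\<lambda>x. tree1 a x) \<in> vertex_ctx"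
  "(\<lambda>x. tree2 x a) \<in> vertex_ctx" "(\<lambda>x. tree2 a x) \<in> vertex_ctx"
  by (rule vertex_ctx.here, rule vertex_ctx.left[OF vertex_ctx.here], rule vertex_ctx.here,
      rule vertex_ctx.right[OF vertex_ctx.here])

definition psi_lin ::
  "('k, 'r) ring_scheme \<Rightarrow> ('k, 'v, 'm) module_scheme \<Rightarrow> ('k, 'w, 'n) module_scheme
    \<Rightarrow> ('v tree \<Rightarrow> 'k) \<Rightarrow> ('w tree \<Rightarrow> 'k) \<Rightarrow> ('v \<times> 'w \<Rightarrow> 'k) set tree \<Rightarrow> 'k" where
  "psi_lin K V W a b =
    (let F = free_mod K (trees (carrier (tensor K V W)) 3) in
     lin_ext K F (\<lambda>t. lin_ext K F (\<lambda>u. psi_tree K V W t u) b) a)"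

context
  fixes K :: "('k, 'r) ring_scheme"
    and V :: "('k, 'v, 'm) module_scheme" and W :: "('k, 'w, 'n) module_scheme"
  assumes V: "module K V" and W: "module K W"
begin

interpretation V: module K V by (fact V)
interpretation W: module K W by (fact W)
interpretation U: module K "tensor K V W" by (rule tensor_module[OF V W])
interpretation F: module K "free_mod K (trees (carrier (tensor K V W)) 3)"
  by (rule free_mod_module[OF V.R.cring_axioms])

private abbreviation (input) "F \<equiv> free_mod K (trees (carrier (tensor K V W)) 3)"

private lemma pure: "v \<in> carrier V \<Longrightarrow> w \<in> carrier W \<Longrightarrow> pure_tensor K V W v w \<in> carrier (tensor K V W)"
  by (rule pure_tensor_closed[OF V W])

text \<open>Writes the values of \<open>psi_tree\<close> as multiples of a basis vector by 1, -1 or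
  0, the form demanded by \<open>multilinear_rels_image\<close>.\<close>

private lemma scale:
  assumes "t \<in> trees (carrier (tensor K V W)) 3"
  shows "\<one>\<^bsub>K\<^esub> \<odot>\<^bsub>F\<^esub> basis_vec K t = basis_vec K t"
    and "(\<ominus>\<^bsub>K\<^esub> \<one>\<^bsub>K\<^esub>) \<odot>\<^bsub>F\<^esub> basis_vec K t = \<ominus>\<^bsub>F\<^esub> basis_vec K t"
    and "\<zero>\<^bsub>K\<^esub> \<odot>\<^bsub>F\<^esub> basis_vec K t = \<zero>\<^bsub>F\<^esub>"
    and "basis_vec K t \<in> carrier F"
proof -
  show t: "basis_vec K t \<in> carrier F" by (rule basis_vec_closed[OF V.R.cring_axioms assms])
  show "\<one>\<^bsub>K\<^esub> \<odot>\<^bsub>F\<^esub> basis_vec K t = basis_vec K t" by (rule F.smult_one[OF t])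
  show "\<zero>\<^bsub>K\<^esub> \<odot>\<^bsub>F\<^esub> basis_vec K t = \<zero>\<^bsub>F\<^esub>" by (rule F.smult_l_null[OF t])
  show "(\<ominus>\<^bsub>K\<^esub> \<one>\<^bsub>K\<^esub>) \<odot>\<^bsub>F\<^esub> basis_vec K t = \<ominus>\<^bsub>F\<^esub> basis_vec K t"
    by (simp only: F.smult_l_minus[OF V.R.one_closed t] F.smult_one[OF t])
qed

lemma psi_tree_closed:
  assumes t: "t \<in> trees (carrier V) 3" and u: "u \<in> trees (carrier W) 3"
  shows "psi_tree K V W t u \<in> carrier F"
  by (rule trees_3_cases[OF t]; rule trees_3_cases[OF u])
    (simp_all add: scale(4)[OF trees_3_intros(1)] scale(4)[OF trees_3_intros(2)] pure)

lemma psi_lin_linear_left: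
  "b \<in> carrier (free_mod K (trees (carrier W) 3))
    \<Longrightarrow> linear_map K (free_mod K (trees (carrier V) 3)) F (\<lambda>a. psi_lin K V W a b)"
  unfolding psi_lin_def Let_def by (rule bilin_ext_linear_left[OF F.module_axioms psi_tree_closed])

lemma psi_lin_linear_right:
  "a \<in> carrier (free_mod K (trees (carrier V) 3))
    \<Longrightarrow> linear_map K (free_mod K (trees (carrier W) 3)) F (psi_lin K V W a)"
  unfolding psi_lin_def Let_def by (rule bilin_ext_linear_right[OF F.module_axioms psi_tree_closed])

lemma psi_lin_basis_vec:
  "t \<in> trees (carrier V) 3 \<Longrightarrow> u \<in> trees (carrier W) 3
    \<Longrightarrow> psi_lin K V W (basis_vec K t) (basis_vec K u) = psi_tree K V W t u"
  unfolding psi_lin_def Let_def by (rule bilin_ext_basis_vec[OF F.module_axioms psi_tree_closed])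

text \<open>The hypothesis of \<open>multilinear_rels_image\<close> for \<Psi> with a fixed second
  tree: \<sigma> tensors the varying label with the label of the second tree at the corresponding
  vertex, and the scalar is 1 on left combs, -1 on right combs, 0 on mixed shapes.\<close>

lemma psi_tree_ctx_left:
  assumes C: "C \<in> vertex_ctx" "C \<omega> \<in> trees (carrier V) 3" and u: "u \<in> trees (carrier W) 3"
  shows "\<exists>C'\<in>vertex_ctx. \<exists>\<sigma>. \<exists>e\<in>carrier K. linear_map K V (tensor K V W) \<sigma> \<and>
    (\<forall>x\<in>carrier V. C' (\<sigma> x) \<in> trees (carrier (tensor K V W)) 3 \<and>
      psi_tree K V W (C x) u = e \<odot>\<^bsub>F\<^esub> basis_vec K (C' (\<sigma> x)))"
proof -
  let ?p = "pure_tensor K V W"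
  have thesisI: ?thesis if "C' \<in> vertex_ctx" "w \<in> carrier W" "e \<in> carrier K"
    "\<And>x. x \<in> carrier V \<Longrightarrow> C' (?p x w) \<in> trees (carrier (tensor K V W)) 3"
    "\<And>x. x \<in> carrier V \<Longrightarrow> psi_tree K V W (C x) u = e \<odot>\<^bsub>F\<^esub> basis_vec K (C' (?p x w))" for C' w e
    using that(1,3) pure_tensor_linear_left[OF V W that(2)] that(4,5) by blast
  note tr = trees_3_intros and sc = scale[OF trees_3_intros(1)] scale[OF trees_3_intros(2)]
  have e: "\<ominus>\<^bsub>K\<^esub> \<one>\<^bsub>K\<^esub> \<in> carrier K" by simp
  \<comment> \<open>For mixed shapes the scalar is zero, so any context will do as a witness; the
    one chosen has the zero tensor at its other vertex.\<close>
  note zero = thesisI[OF vertex_ctx_3_intros(1)[of "\<zero>\<^bsub>tensor K V W\<^esub>"] _ V.R.zero_closed]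
  show ?thesis
  proof (rule vertex_ctx_3_cases[OF C]; rule trees_3_cases[OF u])
    fix a \<omega>' \<nu>' assume a: "a \<in> carrier V" "\<omega>' \<in> carrier W" "\<nu>' \<in> carrier W"
    note pa = pure[OF a(1,2)] pure[OF a(1,3)]
    show ?thesis if "C = (\<lambda>x. tree1 x a)" "u = tree1 \<omega>' \<nu>'"
      unfolding that
      by (rule thesisI[OF vertex_ctx_3_intros(1)[of "?p a \<nu>'"] a(2) V.R.one_closed, unfolded that])
        (simp_all add: tr sc pure pa a)
    show ?thesis if "C = (\<lambda>x. tree1 a x)" "u = tree1 \<omega>' \<nu>'"
      unfolding that
      by (rule thesisI[OF vertex_ctx_3_intros(2)[of "?p a \<omega>'"] a(3) V.R.one_closed, unfolded that])
        (simp_all add: tr sc pure pa a)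
    show ?thesis if "C = (\<lambda>x. tree2 x a)" "u = tree2 \<omega>' \<nu>'"
      unfolding that
      by (rule thesisI[OF vertex_ctx_3_intros(3)[of "?p a \<nu>'"] a(2) e, unfolded that])
        (simp_all add: tr sc pure pa a)
    show ?thesis if "C = (\<lambda>x. tree2 a x)" "u = tree2 \<omega>' \<nu>'"
      unfolding that
      by (rule thesisI[OF vertex_ctx_3_intros(4)[of "?p a \<omega>'"] a(3) e, unfolded that])
        (simp_all add: tr sc pure pa a)
    show ?thesis if "C = (\<lambda>x. tree1 x a)" "u = tree2 \<omega>' \<nu>'"
      unfolding that by (rule zero[OF a(2), unfolded that]) (simp_all add: tr sc pure pa a)
    show ?thesis if "C = (\<lambda>x. tree1 a x)" "u = tree2 \<omega>' \<nu>'"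
      unfolding that by (rule zero[OF a(2), unfolded that]) (simp_all add: tr sc pure pa a)
    show ?thesis if "C = (\<lambda>x. tree2 x a)" "u = tree1 \<omega>' \<nu>'"
      unfolding that by (rule zero[OF a(2), unfolded that]) (simp_all add: tr sc pure pa a)
    show ?thesis if "C = (\<lambda>x. tree2 a x)" "u = tree1 \<omega>' \<nu>'"
      unfolding that by (rule zero[OF a(2), unfolded that]) (simp_all add: tr sc pure pa a)
  qed
qed

lemma psi_tree_ctx_right:
  assumes C: "C \<in> vertex_ctx" "C \<omega> \<in> trees (carrier W) 3" and t: "t \<in> trees (carrier V) 3"
  shows "\<exists>C'\<in>vertex_ctx. \<exists>\<sigma>. \<exists>e\<in>carrier K. linear_map K W (tensor K V W) \<sigma> \<and>
    (\<forall>x\<in>carrier W. C' (\<sigma> x) \<in> trees (carrier (tensor K V W)) 3 \<and>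
      psi_tree K V W t (C x) = e \<odot>\<^bsub>F\<^esub> basis_vec K (C' (\<sigma> x)))"
proof -
  let ?p = "pure_tensor K V W"
  have thesisI: ?thesis if "C' \<in> vertex_ctx" "v \<in> carrier V" "e \<in> carrier K"
    "\<And>x. x \<in> carrier W \<Longrightarrow> C' (?p v x) \<in> trees (carrier (tensor K V W)) 3"
    "\<And>x. x \<in> carrier W \<Longrightarrow> psi_tree K V W t (C x) = e \<odot>\<^bsub>F\<^esub> basis_vec K (C' (?p v x))" for C' v e
    using that(1,3) pure_tensor_linear_right[OF V W that(2)] that(4,5) by blast
  note tr = trees_3_intros and sc = scale[OF trees_3_intros(1)] scale[OF trees_3_intros(2)]
  have e: "\<ominus>\<^bsub>K\<^esub> \<one>\<^bsub>K\<^esub> \<in> carrier K" by simp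
  note zero = thesisI[OF vertex_ctx_3_intros(1)[of "\<zero>\<^bsub>tensor K V W\<^esub>"] _ V.R.zero_closed]
  show ?thesis
  proof (rule vertex_ctx_3_cases[OF C]; rule trees_3_cases[OF t])
    fix a \<omega>' \<nu>' assume a: "a \<in> carrier W" "\<omega>' \<in> carrier V" "\<nu>' \<in> carrier V"
    note pa = pure[OF a(2,1)] pure[OF a(3,1)]
    show ?thesis if "C = (\<lambda>x. tree1 x a)" "t = tree1 \<omega>' \<nu>'"
      unfolding that
      by (rule thesisI[OF vertex_ctx_3_intros(1)[of "?p \<nu>' a"] a(2) V.R.one_closed, unfolded that])
        (simp_all add: tr sc pure pa a)
    show ?thesis if "C = (\<lambda>x. tree1 a x)" "t = tree1 \<omega>' \<nu>'"
      unfolding that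
      by (rule thesisI[OF vertex_ctx_3_intros(2)[of "?p \<omega>' a"] a(3) V.R.one_closed, unfolded that])
        (simp_all add: tr sc pure pa a)
    show ?thesis if "C = (\<lambda>x. tree2 x a)" "t = tree2 \<omega>' \<nu>'"
      unfolding that
      by (rule thesisI[OF vertex_ctx_3_intros(3)[of "?p \<nu>' a"] a(2) e, unfolded that])
        (simp_all add: tr sc pure pa a)
    show ?thesis if "C = (\<lambda>x. tree2 a x)" "t = tree2 \<omega>' \<nu>'"
      unfolding that
      by (rule thesisI[OF vertex_ctx_3_intros(4)[of "?p \<omega>' a"] a(3) e, unfolded that])
        (simp_all add: tr sc pure pa a)
    show ?thesis if "C = (\<lambda>x. tree1 x a)" "t = tree2 \<omega>' \<nu>'"
      unfolding that by (rule zero[OF a(2), unfolded that]) (simp_all add: tr sc pure pa a)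
    show ?thesis if "C = (\<lambda>x. tree1 a x)" "t = tree2 \<omega>' \<nu>'"
      unfolding that by (rule zero[OF a(2), unfolded that]) (simp_all add: tr sc pure pa a)
    show ?thesis if "C = (\<lambda>x. tree2 x a)" "t = tree1 \<omega>' \<nu>'"
      unfolding that by (rule zero[OF a(2), unfolded that]) (simp_all add: tr sc pure pa a)
    show ?thesis if "C = (\<lambda>x. tree2 a x)" "t = tree1 \<omega>' \<nu>'"
      unfolding that by (rule zero[OF a(2), unfolded that]) (simp_all add: tr sc pure pa a)
  qed
qed

text \<open>The criterion needs a single tree as second argument; linearity in \<open>b\<close> then
  gives the general case through a submodule containing the basis.\<close>

lemma psi_lin_multilinear_left:
  assumes a: "a \<in> multilinear_rels K V 3" and b: "b \<in> carrier (free_mod K (trees (carrier W) 3))"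
  shows "psi_lin K V W a b \<in> multilinear_rels K (tensor K V W) 3"
proof -
  note K = V.R.cring_axioms
  note a' = submodule_carrier[OF free_mod_module[OF K] multilinear_rels_submodule[OF V] a]
  have "psi_lin K V W a (basis_vec K u) \<in> multilinear_rels K (tensor K V W) 3"
    if u: "u \<in> trees (carrier W) 3" for u
  proof (rule multilinear_rels_image[OF V U.module_axioms
        psi_lin_linear_left[OF basis_vec_closed[OF K u]] _ a])
    fix C \<omega> assume C: "C \<in> vertex_ctx" "C \<omega> \<in> trees (carrier V) 3"
    show "\<exists>C'\<in>vertex_ctx. \<exists>\<sigma>. \<exists>e\<in>carrier K. linear_map K V (tensor K V W) \<sigma> \<and>
      (\<forall>x\<in>carrier V. C' (\<sigma> x) \<in> trees (carrier (tensor K V W)) 3 \<and>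
        psi_lin K V W (basis_vec K (C x)) (basis_vec K u) = e \<odot>\<^bsub>F\<^esub> basis_vec K (C' (\<sigma> x)))"
      using psi_tree_ctx_left[OF C u] psi_lin_basis_vec[OF vertex_ctx_trees(2)[OF C] u]
      by (simp cong: ball_cong)
  qed
  then have "b \<in> {b \<in> carrier (free_mod K (trees (carrier W) 3)).
      psi_lin K V W a b \<in> multilinear_rels K (tensor K V W) 3}"
    by (intro free_mod_span[OF K submodule_vimage[OF free_mod_module[OF K] F.module_axioms
            psi_lin_linear_right[OF a'] multilinear_rels_submodule[OF U.module_axioms]] _ b])
      (simp add: basis_vec_closed[OF K])
  then show ?thesis by simp
qed

lemma psi_lin_multilinear_right:
  assumes b: "b \<in> multilinear_rels K W 3" and a: "a \<in> carrier (free_mod K (trees (carrier V) 3))"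
  shows "psi_lin K V W a b \<in> multilinear_rels K (tensor K V W) 3"
proof -
  note K = V.R.cring_axioms
  note b' = submodule_carrier[OF free_mod_module[OF K] multilinear_rels_submodule[OF W] b]
  have "psi_lin K V W (basis_vec K t) b \<in> multilinear_rels K (tensor K V W) 3"
    if t: "t \<in> trees (carrier V) 3" for t
  proof (rule multilinear_rels_image[OF W U.module_axioms
        psi_lin_linear_right[OF basis_vec_closed[OF K t]] _ b])
    fix C \<omega> assume C: "C \<in> vertex_ctx" "C \<omega> \<in> trees (carrier W) 3"
    show "\<exists>C'\<in>vertex_ctx. \<exists>\<sigma>. \<exists>e\<in>carrier K. linear_map K W (tensor K V W) \<sigma> \<and>
      (\<forall>x\<in>carrier W. C' (\<sigma> x) \<in> trees (carrier (tensor K V W)) 3 \<and>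
        psi_lin K V W (basis_vec K t) (basis_vec K (C x)) = e \<odot>\<^bsub>F\<^esub> basis_vec K (C' (\<sigma> x)))"
      using psi_tree_ctx_right[OF C t] psi_lin_basis_vec[OF t vertex_ctx_trees(2)[OF C]]
      by (simp cong: ball_cong)
  qed
  then have "a \<in> {a \<in> carrier (free_mod K (trees (carrier V) 3)).
      psi_lin K V W a b \<in> multilinear_rels K (tensor K V W) 3}"
    by (intro free_mod_span[OF K submodule_vimage[OF free_mod_module[OF K] F.module_axioms
            psi_lin_linear_left[OF b'] multilinear_rels_submodule[OF U.module_axioms]] _ a])
      (simp add: basis_vec_closed[OF K])
  then show ?thesis by simp
qed

text \<open>\<open>psi\<close> is a union over representatives of both arguments. Collapsing the
  inner union uses that relations are respected in the second argument, collapsing the outer one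
  that they are respected in the first.\<close>

lemma psi_coset:
  assumes a: "a \<in> carrier (free_mod K (trees (carrier V) 3))"
    and b: "b \<in> carrier (free_mod K (trees (carrier W) 3))"
  shows "psi K V W (multilinear_rels K V 3 +>\<^bsub>free_mod K (trees (carrier V) 3)\<^esub> a)
      (multilinear_rels K W 3 +>\<^bsub>free_mod K (trees (carrier W) 3)\<^esub> b)
    = multilinear_rels K (tensor K V W) 3 +>\<^bsub>F\<^esub> psi_lin K V W a b"
proof -
  note K = V.R.cring_axioms
  note M = free_mod_module[OF K]
  have inner: "quot_map F (multilinear_rels K (tensor K V W) 3) (psi_lin K V W a')
      (multilinear_rels K W 3 +>\<^bsub>free_mod K (trees (carrier W) 3)\<^esub> b)
    = multilinear_rels K (tensor K V W) 3 +>\<^bsub>F\<^esub> psi_lin K V W a' b"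
    if "a' \<in> carrier (free_mod K (trees (carrier V) 3))" for a'
    by (rule quot_map_coset[OF M multilinear_rels_submodule[OF W] F.module_axioms
          multilinear_rels_submodule[OF U.module_axioms] psi_lin_linear_right[OF that]
          psi_lin_multilinear_right[OF _ that] b])
  have outer: "quot_map F (multilinear_rels K (tensor K V W) 3) (\<lambda>a. psi_lin K V W a b)
      (multilinear_rels K V 3 +>\<^bsub>free_mod K (trees (carrier V) 3)\<^esub> a)
    = multilinear_rels K (tensor K V W) 3 +>\<^bsub>F\<^esub> psi_lin K V W a b"
    by (rule quot_map_coset[OF M multilinear_rels_submodule[OF V] F.module_axioms
          multilinear_rels_submodule[OF U.module_axioms] psi_lin_linear_left[OF b]
          psi_lin_multilinear_left[OF _ b] a])
  show ?thesis
    using inner coset_memD(1)[OF M multilinear_rels_submodule[OF V] a] outer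
    unfolding psi_def quot_map_def psi_lin_def Let_def by simp
qed

end

section \<open>The isomorphism\<close>

text \<open>This is what \<open>TSu\<^sub>J\<close> makes of the associativity relation, with the
  factor of the label dropped; hence one relator for each nonempty \<open>J\<close>.\<close>

definition tri_relator :: "('k, 'r) ring_scheme \<Rightarrow> nat set \<Rightarrow> ((tri \<Rightarrow> 'k) tree \<Rightarrow> 'k) set" where
  "tri_relator K J =
    tree_class K (tri_space K) (tree1 (tsu_vec K (1 \<in> J \<or> 2 \<in> J) (3 \<in> J)) (tsu_vec K (1 \<in> J) (2 \<in> J)))
    \<ominus>\<^bsub>component (free_op K (tri_space K)) 3\<^esub>
    tree_class K (tri_space K) (tree2 (tsu_vec K (1 \<in> J) (2 \<in> J \<or> 3 \<in> J)) (tsu_vec K (2 \<in> J) (3 \<in> J)))"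

lemma tridend_rels_eq:
  "tridend_rels K = gen_submodule K (component (free_op K (tri_space K)) 3)
    {tri_relator K J | J. J \<noteq> {} \<and> J \<subseteq> {1, 2, 3}}"
proof -
  have "{tri_relator K J | J. J \<noteq> {} \<and> J \<subseteq> {1, 2, 3}} = tri_relator K ` (Pow {1, 2, 3} - {{}})"
    by auto
  \<comment> \<open>The subsets follow the order of the relators in \<open>tridend_rels\<close>, so
    the two lists agree term by term; for instance \<open>{2, 3}\<close> gives
    \<open>(x \<succ> y) \<cdot> z = x \<succ> (y \<cdot> z)\<close>.\<close>
  also have "\<dots> = {tri_relator K {1}, tri_relator K {2}, tri_relator K {3}, tri_relator K {2, 3},
      tri_relator K {1, 3}, tri_relator K {1, 2}, tri_relator K {1, 2, 3}}"
    by (auto simp: Pow_insert)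
  finally show ?thesis
    unfolding tridend_rels_def Let_def by (simp add: tri_relator_def tsu_vec_def)
qed

context
  fixes K :: "('k, 'r) ring_scheme" and V :: "('k, 'v, 'm) module_scheme"
  assumes V: "module K V"
begin

interpretation V: module K V by (fact V)

private abbreviation (input) "T \<equiv> tri_space K"
private abbreviation (input) "U \<equiv> tensor K T V"
private abbreviation (input) "TF X n \<equiv> free_mod K (trees X n)"

private lemma T: "module K T" by (rule tri_space_module[OF V.R.cring_axioms])
private lemma U: "module K U" by (rule tensor_module[OF T V])
private lemma FM: "module K (TF X n)" by (rule free_mod_module[OF V.R.cring_axioms])

private lemma swap: "linear_map K (tri_hat K V) U (tensor_swap K V T)"
  unfolding tri_hat_def by (rule tensor_swap_linear[OF V T])

lemma tensor_swap_tsu_label: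
  "\<omega> \<in> carrier V \<Longrightarrow> tensor_swap K V T (tsu_label K V p q \<omega>) = pure_tensor K T V (tsu_vec K p q) \<omega>"
  by (simp add: tsu_label_eq[OF V] tensor_swap_pure[OF V T] tsu_vec_closed[OF V])

lemma tri_relator_coset:
  "tri_relator K J = multilinear_rels K T 3 +>\<^bsub>TF (carrier T) 3\<^esub>
    (basis_vec K (tree1 (tsu_vec K (1 \<in> J \<or> 2 \<in> J) (3 \<in> J)) (tsu_vec K (1 \<in> J) (2 \<in> J)))
     \<ominus>\<^bsub>TF (carrier T) 3\<^esub>
     basis_vec K (tree2 (tsu_vec K (1 \<in> J) (2 \<in> J \<or> 3 \<in> J)) (tsu_vec K (2 \<in> J) (3 \<in> J))))"
proof -
  note L = multilinear_rels_submodule[OF T, of 3]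
  note b = basis_vec_closed[OF V.R.cring_axioms trees_3_intros(1)]
    basis_vec_closed[OF V.R.cring_axioms trees_3_intros(2)]
  show ?thesis
    unfolding tri_relator_def free_op_component tree_class_def
    by (subst linear_map_minus[OF FM quot_mod_module[OF FM L] linear_map_coset[OF FM L]])
      (simp_all add: b tsu_vec_closed[OF V])
qed

text \<open>Both sides are linear in a representative of \<open>r\<close>, so a single tree
  \<open>u\<close> decides. \<Psi> pairs \<open>u\<close> only with the term of
  \<open>s\<^sub>J\<close> of the same shape, and the symbols of that term are by construction those
  which \<open>TSu\<^sub>J\<close> puts on \<open>u\<close>.\<close>

lemma psi_tri_relator:
  assumes r: "r \<in> carrier (component (free_op K V) 3)" and J: "J \<subseteq> {1, 2, 3}"
  shows "free_relabel K U (tensor_swap K V T) 3 (tsu K V 3 J r) = psi K T V (tri_relator K J) r"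
proof -
  note K = V.R.cring_axioms
  note hat = tri_hat_module[OF V]
  note rl = relabel_linear[OF K linear_map_closed[OF swap]]
  note tl = tsu_lin_linear[OF V, of 3 J]
  obtain b where b: "b \<in> carrier (TF (carrier V) 3)"
    "r = multilinear_rels K V 3 +>\<^bsub>TF (carrier V) 3\<^esub> b"
    using r unfolding free_op_component by (rule quot_modE[OF FM multilinear_rels_submodule[OF V]])
  let ?t1 = "tree1 (tsu_vec K (1 \<in> J \<or> 2 \<in> J) (3 \<in> J)) (tsu_vec K (1 \<in> J) (2 \<in> J))"
  let ?t2 = "tree2 (tsu_vec K (1 \<in> J) (2 \<in> J \<or> 3 \<in> J)) (tsu_vec K (2 \<in> J) (3 \<in> J))"
  let ?s = "basis_vec K ?t1 \<ominus>\<^bsub>TF (carrier T) 3\<^esub> basis_vec K ?t2"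
  interpret FT: module K "TF (carrier T) 3" by (rule FM)
  interpret FU: module K "TF (carrier U) 3" by (rule FM)
  have t: "?t1 \<in> trees (carrier T) 3" "?t2 \<in> trees (carrier T) 3"
    by (intro trees_3_intros tsu_vec_closed[OF V])+
  note \<delta>t = basis_vec_closed[OF K t(1)] basis_vec_closed[OF K t(2)]
  have s: "?s \<in> carrier (TF (carrier T) 3)" by (rule FT.M.minus_closed[OF \<delta>t])
  have "relabel K (carrier U) (tensor_swap K V T) 3 (tsu_lin K V 3 J b) = psi_lin K T V ?s b"
  proof (rule free_mod_ext[OF K FM linear_map_comp[OF tl rl] psi_lin_linear_right[OF T V s] _ b(1)])
    fix u assume u: "u \<in> trees (carrier V) 3"
    note \<delta>u = basis_vec_closed[OF K u]
    have "relabel K (carrier U) (tensor_swap K V T) 3 (tsu_lin K V 3 J (basis_vec K u))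
        = basis_vec K (map_tree (tensor_swap K V T) (tsu_tree K V J u))"
      by (simp only: tsu_lin_basis_vec[OF V u]
          relabel_basis_vec[OF K linear_map_closed[OF swap] tsu_tree_trees[OF V u]])
    moreover have "psi_lin K T V ?s (basis_vec K u)
        = psi_tree K T V ?t1 u \<ominus>\<^bsub>TF (carrier U) 3\<^esub> psi_tree K T V ?t2 u"
      by (simp only: linear_map_minus[OF FM FM psi_lin_linear_left[OF T V \<delta>u] \<delta>t]
          psi_lin_basis_vec[OF T V t(1) u] psi_lin_basis_vec[OF T V t(2) u])
    moreover have "basis_vec K (map_tree (tensor_swap K V T) (tsu_tree K V J u))
        = psi_tree K T V ?t1 u \<ominus>\<^bsub>TF (carrier U) 3\<^esub> psi_tree K T V ?t2 u"
      using u
    proof (rule trees_3_cases)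
      fix \<omega> \<nu> assume u: "\<omega> \<in> carrier V" "\<nu> \<in> carrier V" "u = tree1 \<omega> \<nu>"
      \<comment> \<open>The second term vanishes on a left comb; membership in the carrier is what
        allows the zero to be subtracted away.\<close>
      have "psi_tree K T V ?t1 u \<in> carrier (TF (carrier U) 3)"
        by (rule psi_tree_closed[OF T V t(1)]) (simp add: u trees_3_intros)
      then show ?thesis
        by (simp add: u tsu_tree_tree1[OF J] tensor_swap_tsu_label a_minus_def del: tsu_tree.simps(2))
    next
      fix \<omega> \<nu> assume u: "\<omega> \<in> carrier V" "\<nu> \<in> carrier V" "u = tree2 \<omega> \<nu>"
      let ?w = "tree2 (pure_tensor K T V (tsu_vec K (1 \<in> J) (2 \<in> J \<or> 3 \<in> J)) \<omega>)
        (pure_tensor K T V (tsu_vec K (2 \<in> J) (3 \<in> J)) \<nu>)"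
      \<comment> \<open>Here the first term vanishes and the second is subtracted with the sign of
        \<Psi>; membership in the carrier is what lets the two negations cancel.\<close>
      have "basis_vec K ?w \<in> carrier (TF (carrier U) 3)"
        by (intro basis_vec_closed[OF K] trees_3_intros pure_tensor_closed[OF T V]
            tsu_vec_closed[OF V] u)
      then show ?thesis
        by (simp add: u tsu_tree_tree2[OF J] tensor_swap_tsu_label a_minus_def del: tsu_tree.simps(2))
    qed
    ultimately show "relabel K (carrier U) (tensor_swap K V T) 3 (tsu_lin K V 3 J (basis_vec K u))
        = psi_lin K T V ?s (basis_vec K u)" by simp
  qed
  moreover have "free_relabel K U (tensor_swap K V T) 3 (tsu K V 3 J r)
      = multilinear_rels K U 3 +>\<^bsub>TF (carrier U) 3\<^esub>
        relabel K (carrier U) (tensor_swap K V T) 3 (tsu_lin K V 3 J b)"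
    unfolding b(2) tsu_coset[OF V b(1)] free_relabel_def
    by (rule quot_map_coset[OF FM multilinear_rels_submodule[OF hat] FM multilinear_rels_submodule[OF U]
          rl relabel_multilinear_rels[OF hat U swap] linear_map_closed[OF tl b(1)]])
  ultimately show ?thesis
    unfolding b(2) tri_relator_coset psi_coset[OF T V s b(1)] by simp
qed

text \<open>The relators of the black square product involve every element of the span of the
  \<open>s\<^sub>J\<close>. Linearity in this argument brings them back to the
  \<open>s\<^sub>J\<close> themselves, where \<open>psi_tri_relator\<close> applies.\<close>

lemma psi_linear_left:
  fixes W :: "('k, 'w, 'n) module_scheme"
  assumes W: "module K W" and r: "r \<in> carrier (component (free_op K V) 3)"
  shows "linear_map K (component (free_op K W) 3) (component (free_op K (tensor K W V)) 3)
    (\<lambda>s. psi K W V s r)"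
proof -
  note K = V.R.cring_axioms
  note WV = tensor_module[OF W V]
  note L = multilinear_rels_submodule
  obtain b where b: "b \<in> carrier (TF (carrier V) 3)"
    "r = multilinear_rels K V 3 +>\<^bsub>TF (carrier V) 3\<^esub> b"
    using r unfolding free_op_component by (rule quot_modE[OF FM L[OF V]])
  let ?q = "quot_map (TF (carrier (tensor K W V)) 3) (multilinear_rels K (tensor K W V) 3)
    (\<lambda>a. psi_lin K W V a b)"
  note pl = psi_lin_linear_left[OF W V b(1)] psi_lin_multilinear_left[OF W V _ b(1)]
  \<comment> \<open>With \<open>r\<close> fixed, \<open>psi\<close> coincides on cosets with the map
    induced by \<open>psi_lin\<close>, whose linearity is already known.\<close>
  have eq: "psi K W V s r = ?q s" if "s \<in> carrier (component (free_op K W) 3)" for s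
    using that unfolding free_op_component
  proof (rule quot_modE[OF FM L[OF W]])
    fix a assume a: "a \<in> carrier (TF (carrier W) 3)" "s = multilinear_rels K W 3 +>\<^bsub>TF (carrier W) 3\<^esub> a"
    show "psi K W V s r = ?q s"
      unfolding a(2) b(2) psi_coset[OF W V a(1) b(1)]
      by (rule quot_map_coset[OF FM L[OF W] FM L[OF WV] pl a(1), symmetric])
  qed
  have q: "linear_map K (component (free_op K W) 3) (component (free_op K (tensor K W V)) 3) ?q"
    unfolding free_op_component by (rule linear_map_quot_map[OF FM L[OF W] FM L[OF WV] pl])
  interpret M: module K "component (free_op K W) 3"
    by (rule ns_operad.component_module[OF free_op_operad[OF W]])
  show ?thesis
    by (rule linear_mapI) (simp_all only: eq linear_mapD[OF q] M.M.a_closed M.smult_closed)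
qed

lemma tsu_closed:
  assumes "r \<in> carrier (component (free_op K V) n)"
  shows "tsu K V n J r \<in> carrier (component (free_op K (tri_hat K V)) n)"
  using assms unfolding free_op_component
proof (rule quot_modE[OF FM multilinear_rels_submodule[OF V]])
  fix b assume b: "b \<in> carrier (TF (carrier V) n)" "r = multilinear_rels K V n +>\<^bsub>TF (carrier V) n\<^esub> b"
  show "tsu K V n J r \<in> carrier (quot_mod (TF (carrier (tri_hat K V)) n) (multilinear_rels K (tri_hat K V) n))"
    unfolding b(2) tsu_coset[OF V b(1)]
    by (rule quot_mod_closed[OF FM multilinear_rels_submodule[OF tri_hat_module[OF V]]
          linear_map_closed[OF tsu_lin_linear[OF V] b(1)]])
qed

lemma tri_relator_closed: "tri_relator K J \<in> carrier (component (free_op K T) 3)"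
  unfolding tri_relator_coset free_op_component
  by (intro quot_mod_closed[OF FM multilinear_rels_submodule[OF T]]
      abelian_group.minus_closed[OF module.axioms(2)[OF FM]] basis_vec_closed[OF V.R.cring_axioms]
      trees_3_intros tsu_vec_closed[OF V])

section \<open>Comparison of the two ideals of relations\<close>

lemma trisuccessor_iso:
  assumes R: "submodule R K (component (free_op K V) 3)"
  shows "ns_isomorphic K (trisuccessor K V R) (black_square K T (tridend_rels K) V R)"
proof -
  let ?\<sigma> = "tensor_swap K V T" and ?\<tau> = "tensor_swap K T V"
  let ?\<phi> = "free_relabel K U ?\<sigma>" and ?\<psi> = "free_relabel K (tri_hat K V) ?\<tau>"
  let ?P = "free_op K (tri_hat K V)" and ?Q = "free_op K U" and ?T3 = "component (free_op K T) 3"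
  let ?A = "{tsu K V 3 J r | r J. r \<in> R \<and> J \<noteq> {} \<and> J \<subseteq> {1, 2, 3}}"
  let ?G = "{psi K T V s r | s r. s \<in> tridend_rels K \<and> r \<in> R}"
  let ?B = "gen_submodule K (component ?Q 3) ?G"
  note hat = tri_hat_module[OF V]
  note comp = ns_operad.component_module[OF free_op_operad]
  have swap': "linear_map K U (tri_hat K V) ?\<tau>"
    unfolding tri_hat_def by (rule tensor_swap_linear[OF T V])
  have iso: "ns_iso_pair K ?P ?Q ?\<phi> ?\<psi>"
    using tensor_swap_swap[OF V T] tensor_swap_swap[OF T V]
    by (intro free_relabel_iso hat U swap swap') (simp_all add: tri_hat_def)
  then have \<psi>: "linear_map K (component ?Q 3) (component ?P 3) (?\<psi> 3)"
    and inv: "\<And>a. a \<in> carrier (component ?P 3) \<Longrightarrow> ?\<psi> 3 (?\<phi> 3 a) = a"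
    by (auto simp: ns_iso_pair_def intro: ns_hom_linear)
  have Rc: "r \<in> carrier (component (free_op K V) 3)" if "r \<in> R" for r
    by (rule submodule_carrier[OF comp[OF V] R that])
  have relators: "{tri_relator K J | J. J \<noteq> {} \<and> J \<subseteq> {1, 2, 3}} \<subseteq> carrier ?T3"
    using tri_relator_closed by blast
  have rels: "tri_relator K J \<in> tridend_rels K" if "J \<noteq> {}" "J \<subseteq> {1, 2, 3}" for J
    unfolding tridend_rels_eq by (rule subsetD[OF gen_submodule_incl]) (use that in blast)
  have relsc: "tridend_rels K \<subseteq> carrier ?T3"
    unfolding tridend_rels_eq
    by (rule submodule_subset[OF comp[OF T] gen_submodule_submodule[OF comp[OF T] relators]])
  have A: "?A \<subseteq> carrier (component ?P 3)"
    using tsu_closed[OF Rc] by blast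
  have G: "?G \<subseteq> carrier (component ?Q 3)"
    using linear_map_closed[OF psi_linear_left[OF T Rc]] relsc by blast
  have B: "?B \<subseteq> carrier (component ?Q 3)"
    by (rule submodule_subset[OF comp[OF U] gen_submodule_submodule[OF comp[OF U] G]])
  have A_sub: "submodule (gen_ideal K ?P 3 ?A 3) K (component ?P 3)"
    by (rule ns_ideal_submodule[OF ns_operad.gen_ideal_ideal[OF free_op_operad[OF hat] A]])
  \<comment> \<open>A relator \<open>TSu\<^sub>J r\<close> is sent to one of the spanning elements
    of the other side, so no linearity is involved in this direction.\<close>
  have AB: "?\<phi> 3 a \<in> gen_ideal K ?Q 3 ?B 3" if a: "a \<in> ?A" for a
  proof -
    obtain r J where rJ: "r \<in> R" "J \<noteq> {}" "J \<subseteq> {1, 2, 3}" "a = tsu K V 3 J r"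
      using a by blast
    have "?\<phi> 3 a \<in> ?G"
      unfolding rJ(4) psi_tri_relator[OF Rc[OF rJ(1)] rJ(3)] using rels[OF rJ(2,3)] rJ(1) by blast
    then show ?thesis
      by (intro subsetD[OF gen_ideal_incl] subsetD[OF gen_submodule_incl])
  qed
  \<comment> \<open>With \<open>r\<close> fixed, the map in \<open>s\<close> is linear and the
    target is a submodule, so it suffices that each \<open>s\<^sub>J\<close> is sent to the relator
    \<open>TSu\<^sub>J r\<close>; this is \<open>psi_tri_relator\<close> read backwards through the
    inverse.\<close>
  have GA: "?\<psi> 3 (psi K T V s r) \<in> gen_ideal K ?P 3 ?A 3" if s: "s \<in> tridend_rels K" and r: "r \<in> R" for s r
  proof (rule gen_submodule_image[OF comp[OF T] comp[OF hat]
        linear_map_comp[OF psi_linear_left[OF T Rc[OF r]] \<psi>] A_sub relators _ s[unfolded tridend_rels_eq]])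
    fix s assume "s \<in> {tri_relator K J | J. J \<noteq> {} \<and> J \<subseteq> {1, 2, 3}}"
    then obtain J where J: "J \<noteq> {}" "J \<subseteq> {1, 2, 3}" "s = tri_relator K J" by blast
    have "?\<psi> 3 (psi K T V s r) = tsu K V 3 J r"
      unfolding J(3) psi_tri_relator[OF Rc[OF r] J(2), symmetric] by (rule inv[OF tsu_closed[OF Rc[OF r]]])
    moreover have "tsu K V 3 J r \<in> ?A" using r J(1,2) by blast
    ultimately show "?\<psi> 3 (psi K T V s r) \<in> gen_ideal K ?P 3 ?A 3"
      by (simp only: subsetD[OF gen_ideal_incl])
  qed
  \<comment> \<open>A second passage from generators to a span, now for the span of all values of
    \<Psi>.\<close>
  have BA: "?\<psi> 3 b \<in> gen_ideal K ?P 3 ?A 3" if "b \<in> ?B" for b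
    by (rule gen_submodule_image[OF comp[OF U] comp[OF hat] \<psi> A_sub G _ that]) (use GA in blast)
  show ?thesis
    unfolding trisuccessor_def black_square_def
    by (rule quadratic_op_iso[OF hat U iso A B AB BA])
qed

end

theorem theorem3p12:
  fixes K :: "('k, 'r) ring_scheme"
    and V :: "('k, 'v, 'm) module_scheme"
    and R :: "('v tree \<Rightarrow> 'k) set set"
  assumes "field K"
    and "module K V"
    and "submodule R K (component (free_op K V) 3)"
  shows "ns_isomorphic K (trisuccessor K V R) (black_square K (tri_space K) (tridend_rels K) V R)"
  using assms(2,3) by (rule trisuccessor_iso)

end
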